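(* Let $n\ge 1$ be an integer, let $0<\gamma<\sqrt{3/5}$, and let $$h(y)=\frac{2\gamma}{(\gamma^2+1)\pi}\begin{cases}\sin(\pi y), & 0\le y\le (2n+1)/2,\\ (-1)^{n}, & y>(2n+1)/2.\end{cases}$$ Consider the planar piecewise linear system with two zones, for $X=(x,y)\in\mathbb{R}^2$, $$X'=\begin{cases}G^-X & \text{if } H(X)<0,\\ G^+X & \text{if } H(X)\ge 0,\end{cases}\qquad G^{\pm}=\begin{pmatrix}\pm 2\gamma&-1\\ \gamma^2+1&0\end{pmatrix},\qquad H(x,y)=\begin{cases}x & \text{if } y\le 0,\\ x-h(y) & \text{if } y>0.\end{cases}$$ Then this system has exactly $n$ limit cycles. These limit cycles are nested and surround the origin, which is a stable singular point of focus type. The limit cycles cut the $y$-axis at the points $(0,k)$ and $(0,-k\,e^{-\pi\gamma})$ for $k=1,\dots,n$, and the $k$-th one is stable if $k$ is even and unstable if $k$ is odd.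
   Context: Solutions are understood by concatenation: a solution is a continuous curve that follows the linear flow of $G^-$ in $\{H<0\}$ and that of $G^+$ in $\{H>0\}$, passing from one zone to the other across $\{H=0\}$ (both fields cross the switching curve in the same direction, so there is no sliding). A limit cycle is an isolated (nonconstant) periodic orbit. It is stable if all orbits starting near it, on both sides, converge to it as $t\to+\infty$, and unstable if all orbits starting near it, on both sides, converge to it as $t\to-\infty$. "Stable singular point of focus type" means that the origin is an equilibrium and that nearby nonconstant orbits spiral around it and converge to it as $t\to+\infty$. *)

theory Defs
  imports "HOL-Analysis.Analysis"
begin

text \<open>
  \<open>F\<close> is linear on each of the zones \<open>{H < 0}\<close> and \<open>{H > 0}\<close>, and \<open>{H = 0}\<close> contains the
  origin.  Solutions by concatenation: a continuous curve that obeys \<open>X' = F X\<close>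
  inside both zones and that, whenever it meets the switching curve away from the
  origin, passes from one zone to the other.  At the origin, where both linear fields
  vanish, the differential equation is imposed as well.  The requirement of crossing
  excludes curves that stay on the switching curve.  At an end point of \<open>I\<close> one of the
  two one-sided filters is trivial, so only the other side is constrained.
\<close>

definition crosses_at :: "(real^2 \<Rightarrow> real) \<Rightarrow> real set \<Rightarrow> (real \<Rightarrow> real^2) \<Rightarrow> real \<Rightarrow> bool" where
  "crosses_at H I \<phi> t \<longleftrightarrow>
     (\<forall>\<^sub>F s in at t within I \<inter> {..<t}. H (\<phi> s) < 0) \<and>
     (\<forall>\<^sub>F s in at t within I \<inter> {t<..}. H (\<phi> s) > 0)
   \<or> (\<forall>\<^sub>F s in at t within I \<inter> {..<t}. H (\<phi> s) > 0) \<and>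
     (\<forall>\<^sub>F s in at t within I \<inter> {t<..}. H (\<phi> s) < 0)"

definition solution_on ::
  "(real^2 \<Rightarrow> real^2) \<Rightarrow> (real^2 \<Rightarrow> real) \<Rightarrow> real set \<Rightarrow> (real \<Rightarrow> real^2) \<Rightarrow> bool" where
  "solution_on F H I \<phi> \<longleftrightarrow>
     continuous_on I \<phi> \<and>
     (\<forall>t\<in>I. H (\<phi> t) \<noteq> 0 \<or> \<phi> t = 0 \<longrightarrow>
        (\<phi> has_vector_derivative F (\<phi> t)) (at t within I)) \<and>
     (\<forall>t\<in>I. H (\<phi> t) = 0 \<and> \<phi> t \<noteq> 0 \<longrightarrow> crosses_at H I \<phi> t)"

definition periodic_orbit ::
  "(real^2 \<Rightarrow> real^2) \<Rightarrow> (real^2 \<Rightarrow> real) \<Rightarrow> (real^2) set \<Rightarrow> bool" where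
  "periodic_orbit F H \<Gamma> \<longleftrightarrow>
     (\<exists>\<phi> T. solution_on F H UNIV \<phi> \<and> T > 0 \<and> (\<forall>t. \<phi> (t + T) = \<phi> t) \<and>
            (\<exists>t. \<phi> t \<noteq> \<phi> 0) \<and> \<Gamma> = range \<phi>)"

definition limit_cycle ::
  "(real^2 \<Rightarrow> real^2) \<Rightarrow> (real^2 \<Rightarrow> real) \<Rightarrow> (real^2) set \<Rightarrow> bool" where
  "limit_cycle F H \<Gamma> \<longleftrightarrow>
     periodic_orbit F H \<Gamma> \<and>
     (\<exists>U. open U \<and> \<Gamma> \<subseteq> U \<and>
          (\<forall>\<Gamma>'. periodic_orbit F H \<Gamma>' \<and> \<Gamma>' \<noteq> \<Gamma> \<longrightarrow> \<Gamma>' \<inter> U = {}))"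

text \<open>
  In the following three definitions the existence of a solution through each nearby
  point, defined for all positive (negative) times, is part of the notion, so that the
  condition on all such solutions is not vacuous.  The neighbourhood \<open>U\<close> covers both
  sides of the orbit.
\<close>

definition stable_orbit ::
  "(real^2 \<Rightarrow> real^2) \<Rightarrow> (real^2 \<Rightarrow> real) \<Rightarrow> (real^2) set \<Rightarrow> bool" where
  "stable_orbit F H \<Gamma> \<longleftrightarrow>
     (\<exists>U. open U \<and> \<Gamma> \<subseteq> U \<and> (\<forall>p\<in>U.
        (\<exists>\<phi>. solution_on F H {0..} \<phi> \<and> \<phi> 0 = p) \<and>
        (\<forall>\<phi>. solution_on F H {0..} \<phi> \<and> \<phi> 0 = p \<longrightarrow>
             ((\<lambda>t. infdist (\<phi> t) \<Gamma>) \<longlongrightarrow> 0) at_top)))"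

definition unstable_orbit ::
  "(real^2 \<Rightarrow> real^2) \<Rightarrow> (real^2 \<Rightarrow> real) \<Rightarrow> (real^2) set \<Rightarrow> bool" where
  "unstable_orbit F H \<Gamma> \<longleftrightarrow>
     (\<exists>U. open U \<and> \<Gamma> \<subseteq> U \<and> (\<forall>p\<in>U.
        (\<exists>\<phi>. solution_on F H {..0} \<phi> \<and> \<phi> 0 = p) \<and>
        (\<forall>\<phi>. solution_on F H {..0} \<phi> \<and> \<phi> 0 = p \<longrightarrow>
             ((\<lambda>t. infdist (\<phi> t) \<Gamma>) \<longlongrightarrow> 0) at_bot)))"

text \<open>
  The polar angle is required to tend to infinity in absolute value, so that the
  direction of rotation is left open.
\<close>

definition spirals_around_origin :: "(real \<Rightarrow> real^2) \<Rightarrow> bool" where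
  "spirals_around_origin \<phi> \<longleftrightarrow>
     (\<forall>t\<ge>0. \<phi> t \<noteq> 0) \<and>
     (\<exists>\<theta>::real \<Rightarrow> real. continuous_on {0..} \<theta> \<and>
        (\<forall>t\<ge>0. \<phi> t = norm (\<phi> t) *\<^sub>R vector [cos (\<theta> t), sin (\<theta> t)]) \<and>
        filterlim (\<lambda>t. \<bar>\<theta> t\<bar>) at_top at_top)"

definition stable_focus_origin ::
  "(real^2 \<Rightarrow> real^2) \<Rightarrow> (real^2 \<Rightarrow> real) \<Rightarrow> bool" where
  "stable_focus_origin F H \<longleftrightarrow>
     solution_on F H UNIV (\<lambda>t. 0) \<and>
     (\<exists>U. open U \<and> 0 \<in> U \<and> (\<forall>p\<in>U.
        (\<exists>\<phi>. solution_on F H {0..} \<phi> \<and> \<phi> 0 = p) \<and>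
        (\<forall>\<phi>. solution_on F H {0..} \<phi> \<and> \<phi> 0 = p \<and> (\<exists>t\<ge>0. \<phi> t \<noteq> \<phi> 0) \<longrightarrow>
             spirals_around_origin \<phi> \<and> (\<phi> \<longlongrightarrow> 0) at_top)))"

text \<open>\<open>H\<close> evaluates \<open>h\<close> only for \<open>y > 0\<close>, so its values for negative \<open>y\<close> are irrelevant.\<close>

definition h :: "nat \<Rightarrow> real \<Rightarrow> real \<Rightarrow> real" where
  "h n \<gamma> y = 2 * \<gamma> / ((\<gamma>\<^sup>2 + 1) * pi) *
     (if y \<le> (2 * real n + 1) / 2 then sin (pi * y) else (-1) ^ n)"

definition H :: "nat \<Rightarrow> real \<Rightarrow> real^2 \<Rightarrow> real" where
  "H n \<gamma> X = (if X $ 2 \<le> 0 then X $ 1 else X $ 1 - h n \<gamma> (X $ 2))"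

definition G_minus :: "real \<Rightarrow> real^2^2" where
  "G_minus \<gamma> = vector [vector [- 2 * \<gamma>, -1], vector [\<gamma>\<^sup>2 + 1, 0]]"

definition G_plus :: "real \<Rightarrow> real^2^2" where
  "G_plus \<gamma> = vector [vector [2 * \<gamma>, -1], vector [\<gamma>\<^sup>2 + 1, 0]]"

definition F :: "nat \<Rightarrow> real \<Rightarrow> real^2 \<Rightarrow> real^2" where
  "F n \<gamma> X = (if H n \<gamma> X < 0 then G_minus \<gamma> *v X else G_plus \<gamma> *v X)"

end

theory Submission imports Defs begin

text \<open>
  In the coordinate \<open>z = e x + i (e y - \<gamma> x)\<close> the field of the zone \<open>{e H > 0}\<close>, \<open>e = 1\<close> or \<open>e = - 1\<close>,
  reads \<open>z' = (e \<gamma> + i) z\<close>.  Hence \<open>exp (\<gamma> \<pi> / 2 + Re (Ln z) - e \<gamma> Im (Ln z))\<close> is a first integral,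
  the amplitude; it equals \<open>y\<close> at \<open>(0, y)\<close> for \<open>y > 0\<close>, and the amplitudes of the two zones agree on the
  negative \<open>y\<close>-axis.  Along a solution the amplitude therefore changes only where the
  upper branch \<open>x = h y\<close> of the switching curve is crossed; there it jumps from \<open>sig 1 y\<close> to
  \<open>sig (- 1) y\<close>.  Because both fields are transversal to the curve, both functions increase with \<open>y\<close>, and
  the sign of their difference is that of \<open>h y\<close>, which vanishes exactly at \<open>y = 1, ..., n\<close>.
  So the closed orbits are the curves of amplitude \<open>k = 1, ..., n\<close>; between two of them the
  amplitude of every solution is monotone, and the sign of \<open>h\<close> tells to which of the two it converges.
  Reversing time together with the reflection \<open>x \<mapsto> - x\<close> replaces \<open>h\<close> by \<open>- h\<close>, which
  reduces instability to stability.
\<close>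

section \<open>The trigonometric inequality behind transversality\<close>

text \<open>Origin of the bound on \<gamma>: with \<open>t = pi * y\<close>, transversality of both
  fields to the curve \<open>x = h y\<close> becomes \<open>4 * \<gamma>\<^sup>2 / (\<gamma>\<^sup>2
  + 1) * (\<bar>sin t\<bar> - sin t * cos t) < t\<close>. The factor is below 3/2 exactly when
  \<open>\<gamma>\<^sup>2 < 3/5\<close>, and with 3/2 in its place the inequality is nearly sharp
  near t = 1.8, which forces explicit rational estimates. The main obstacle is that a solution is
  given only by local conditions: the direction of crossing is not prescribed, crossing times are
  not listed, and the origin might be reached. Therefore no return map is used. Facts about a
  solution are proved in a neighbourhood of each time and propagated through a compactness argument
  for reflexive transitive relations; solutions are shown to avoid the origin by a growth estimate
  that does not see the crossings. The amplitude of the true system is discontinuous at the upper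
  branch and so cannot define open neighbourhoods. These are cut out by the continuous amplitude for
  h = 0, which lies on the same side of each level k with h k = 0.\<close>

lemma sin_le_taylor5:
  fixes x :: real
  assumes "0 \<le> x"
  shows "sin x \<le> x - x^3/6 + x^5/120"
proof -
  obtain t where t: "sin x = (\<Sum>m<5. sin_coeff m * x ^ m) + sin (t + 1/2 * real 5 * pi) / fact 5 * x^5"
    using Maclaurin_sin_expansion[of x 5] by blast
  have I: "{..<5::nat} = {0,1,2,3,4}" by auto
  have "(\<Sum>m<5. sin_coeff m * x ^ m) = x - x^3/6"
    unfolding I by (simp add: sin_coeff_def fact_numeral)
  moreover have "sin (t + 1/2 * real 5 * pi) / fact 5 * x^5 \<le> x^5/120"
  proof -
    have "sin (t + 1/2 * real 5 * pi) * x^5 \<le> 1 * x^5"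
      using assms by (intro mult_right_mono) auto
    then show ?thesis by (simp add: fact_numeral)
  qed
  ultimately show ?thesis using t by linarith
qed

lemma cos_le_taylor4:
  fixes x :: real
  shows "cos x \<le> 1 - x^2/2 + x^4/24"
proof -
  obtain t where t: "cos x = (\<Sum>m<4. cos_coeff m * x ^ m) + cos (t + 1/2 * real 4 * pi) / fact 4 * x^4"
    using Maclaurin_cos_expansion[of x 4] by blast
  have I: "{..<4::nat} = {0,1,2,3}" by auto
  have "(\<Sum>m<4. cos_coeff m * x ^ m) = 1 - x^2/2"
    unfolding I by (simp add: cos_coeff_def)
  moreover have "cos (t + 1/2 * real 4 * pi) / fact 4 * x^4 \<le> x^4/24"
  proof -
    have "cos (t + 1/2 * real 4 * pi) * x^4 \<le> 1 * x^4"
      by (intro mult_right_mono) auto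
    then show ?thesis by (simp add: fact_numeral)
  qed
  ultimately show ?thesis using t by linarith
qed

lemma cos_ge_taylor2:
  fixes x :: real
  shows "1 - x^2/2 \<le> cos x"
proof -
  obtain t where t: "cos x = (\<Sum>m<2. cos_coeff m * x ^ m) + cos (t + 1/2 * real 2 * pi) / fact 2 * x^2"
    using Maclaurin_cos_expansion[of x 2] by blast
  have "(\<Sum>m<2. cos_coeff m * x ^ m) = 1"
    by (simp add: cos_coeff_def numeral_eq_Suc lessThan_Suc)
  moreover have "- (x^2/2) \<le> cos (t + 1/2 * real 2 * pi) / fact 2 * x^2"
  proof -
    have "(-1) * x^2 \<le> cos (t + 1/2 * real 2 * pi) * x^2"
      by (intro mult_right_mono cos_ge_minus_one) auto
    then show ?thesis by (simp add: fact_numeral)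
  qed
  ultimately show ?thesis using t by linarith
qed

text \<open>The bound \<open>pi > 3\<close> is too weak for the tightest case of
  \<open>sin_one_minus_cos_bound\<close>. The value is six times 0.52249, where the Taylor bound of
  the sine is just below \<open>1/2 = sin (pi/6)\<close>.\<close>

lemma pi_gt_313: "pi > 313494/100000"
proof (rule ccontr)
  let ?x = "52249/100000 :: real"
  assume "\<not> ?thesis"
  then have "pi/6 \<le> ?x" by simp
  moreover have "?x \<le> pi/2" using pi_ge_two by simp
  ultimately have "sin (pi/6) \<le> sin ?x"
    by (intro sin_monotone_2pi_le) auto
  also have "\<dots> \<le> ?x - ?x^3/6 + ?x^5/120" by (rule sin_le_taylor5) simp
  also have "\<dots> < 1/2" by (simp add: power_divide field_simps)
  finally show False by (simp add: sin_30)
qed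

text \<open>The ratio of the two sides comes closest to 1 near t = 1.8. Hence crude bounds up to
  pi/2, Taylor polynomials in \<open>e = t - pi/2\<close> on the critical piece, and the global
  maximum of the left side from 2 on.\<close>

lemma sin_one_minus_cos_bound:
  fixes t :: real
  assumes "0 < t"
  shows "3/2 * (sin t * (1 - cos t)) < t"
proof -
  consider "t \<le> 1" | "1 < t" "t \<le> pi/2" | "pi/2 < t" "t < 2" | "2 \<le> t" by linarith
  then show ?thesis
  proof cases
    case 1
    have s: "0 \<le> sin t" using 1 assms pi_gt3 by (intro sin_ge_zero) auto
    have "sin t \<le> t" using assms by (simp add: sin_x_le_x)
    moreover have "1 - cos t \<le> 1/2"
    proof -
      have "t^2 \<le> 1" using 1 assms by (simp add: power_le_one)
      then show ?thesis using cos_ge_taylor2[of t] by linarith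
    qed
    moreover have "0 \<le> 1 - cos t" by simp
    ultimately have "sin t * (1 - cos t) \<le> t * (1/2)" using s assms by (intro mult_mono) auto
    then show ?thesis using assms by linarith
  next
    case 2
    define e where "e = pi/2 - t"
    have e: "0 \<le> e" "e \<le> 1" using 2 pi_less_4 unfolding e_def by linarith+
    have "\<bar>sin e - (\<Sum>m<3. sin_coeff m * e ^ m)\<bar> \<le> inverse (fact 3) * \<bar>e\<bar> ^ 3"
      by (rule Maclaurin_sin_bound)
    moreover have "(\<Sum>m<3. sin_coeff m * e ^ m) = e"
      by (simp add: sin_coeff_def numeral_eq_Suc lessThan_Suc)
    moreover have "e^3 \<le> e" using e power_decreasing[of 1 3 e] by simp
    ultimately have s: "5/6 * e \<le> sin e" using e abs_ge_minus_self[of "sin e - e"] by (simp add: fact_numeral)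
    have st: "sin t = cos e" "cos t = sin e"
      unfolding e_def by (simp_all add: cos_diff sin_diff)
    have "cos e * (1 - sin e) \<le> 1 * (1 - sin e)" by (intro mult_right_mono) auto
    then show ?thesis using s pi_gt_313 e unfolding st by (simp add: e_def)
  next
    case 3
    define e where "e = t - pi/2"
    have e: "0 < e" "e < 1/2" using 3 pi_gt_313 unfolding e_def by linarith+
    have st: "sin t = cos e" and ct: "cos t = - sin e" 
      unfolding e_def by (simp_all add: cos_diff sin_diff)
    have "cos e \<le> 1 - e^2/2 + e^4/24" "sin e \<le> e" "0 \<le> cos e" "0 \<le> sin e"
      using e pi_gt_313 by (auto simp: cos_le_taylor4 sin_x_le_x intro!: cos_ge_zero sin_ge_zero)
    then have "cos e * (1 + sin e) \<le> (1 - e^2/2 + e^4/24) * (1 + e)"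
      by (intro mult_mono) auto
    then have 1: "3/2 * (cos e * (1 + sin e)) \<le> 3/2 * ((1 - e^2/2 + e^4/24) * (1 + e))" by simp
    have 2: "3/2 * ((1 - e^2/2 + e^4/24) * (1 + e)) < 313494/200000 + e"
    proof -
      \<comment> \<open>The cube and the square are bounded by tangents close to the maximum, which is near \<open>e = 0.244\<close>,
        where only about \<open>0.004\<close> is to spare.\<close>
      have "0 \<le> (e + 488/1000) * (e - 244/1000)^2" using e by simp
      then have a: "e^3 \<ge> 178608/1000000*e - 29053568/1000000000"
        by (simp add: power2_eq_square power3_eq_cube field_simps)
      have "e^4 * (1 + e) \<le> (e^3 * (1/2)) * (3/2)"
        unfolding power4_eq_xxxx power3_eq_cube using e by (intro mult_mono) auto
      then have "3/2 * ((1 - e^2/2 + e^4/24) * (1 + e)) \<le> 3/2 + 3/2*e - 3/4*e^2 - 3/4*e^3 + 3/64*e^3"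
        by (simp add: field_simps power2_eq_square power3_eq_cube power4_eq_xxxx)
      moreover have "0 \<le> (e - 249/1000)^2" by simp
      then have "e^2 \<ge> 498/1000*e - 62001/1000000" by (simp add: power2_eq_square field_simps)
      ultimately show ?thesis using a e by linarith
    qed
    have "t = pi/2 + e" unfolding e_def by simp
    moreover have "3/2 * (sin t * (1 - cos t)) = 3/2 * (cos e * (1 + sin e))" by (simp only: st ct) simp
    ultimately show ?thesis using 1 2 pi_gt_313 by linarith
  next
    case 4
    \<comment> \<open>With c = cos t the square is a polynomial whose maximum 27/16 is attained at c
      = -1/2. So the product is below 4/3, and 3/2 times it is below 2.\<close>
    have "(sin t * (1 - cos t))^2 = (1 - cos t)^3 * (1 + cos t)"
      unfolding power_mult_distrib sin_squared_eq by algebra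
    also have "\<dots> \<le> 27/16"
    proof -
      have "27/16 - (1 - cos t)^3 * (1 + cos t) = (cos t + 1/2)^2 * ((cos t - 3/2)^2 + 1/2)"
        by algebra
      also have "\<dots> \<ge> 0" by (intro mult_nonneg_nonneg add_nonneg_nonneg) auto
      finally show ?thesis by linarith
    qed
    also have "\<dots> < (4/3)^2" by (simp add: power2_eq_square)
    finally have "sin t * (1 - cos t) < 4/3" by (rule power2_less_imp_less) simp
    then show ?thesis using 4 by linarith
  qed
qed

text \<open>This replaces an enumeration of crossing times: P has to be known only between t and its
  near neighbours on either side, and compactness of the interval from a to b does the rest.\<close>

lemma local_to_global_order:
  fixes P :: "real \<Rightarrow> real \<Rightarrow> bool"
  assumes I: "is_interval I" and ab: "a \<in> I" "b \<in> I" "a \<le> b"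
    and refl: "\<And>t. P t t"
    and trans: "\<And>r s t. r \<le> s \<Longrightarrow> s \<le> t \<Longrightarrow> P r s \<Longrightarrow> P s t \<Longrightarrow> P r t"
    and loc: "\<And>t. t \<in> I \<Longrightarrow> \<exists>d>0. (\<forall>s\<in>I. t < s \<and> s < t + d \<longrightarrow> P t s) \<and>
                                      (\<forall>s\<in>I. t - d < s \<and> s < t \<longrightarrow> P s t)"
  shows "P a b"
proof -
  \<comment> \<open>The local step of the Bolzano rule may meet subintervals that stick out beyond a
    or b; the implication makes these vacuous.\<close>
  define Q where "Q s t \<longleftrightarrow> (a \<le> s \<and> t \<le> b \<longrightarrow> P s t)" for s t
  have "Q a b"
    using ab(3)
  proof (induction rule: Bolzano)
    case (trans r s t)
    show ?case unfolding Q_def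
    proof
      assume *: "a \<le> r \<and> t \<le> b"
      then have "P r s" "P s t" using trans unfolding Q_def by auto
      then show "P r t" using assms(6) trans by blast
    qed
  next
    case (local x)
    have sub: "s \<in> I" if "a \<le> s" "s \<le> b" for s
      using I ab that by (meson mem_is_interval_1_I)
    obtain d where d: "d > 0" "\<And>s. s\<in>I \<Longrightarrow> x < s \<Longrightarrow> s < x + d \<Longrightarrow> P x s"
       "\<And>s. s\<in>I \<Longrightarrow> x - d < s \<Longrightarrow> s < x \<Longrightarrow> P s x"
      using loc[OF sub[OF local]] by blast
    have "Q r t" if "r \<le> x" "x \<le> t" "t - r < d" for r t
      unfolding Q_def
    proof
      assume rt: "a \<le> r \<and> t \<le> b"
      have "P r x" using d(3)[of r] sub[of r] refl[of x] that rt local by (cases "r = x") auto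
      moreover have "P x t" using d(2)[of t] sub[of t] refl[of x] that rt local by (cases "t = x") auto
      ultimately show "P r t" using assms(6) that by blast
    qed
    then show ?case using d(1) by blast
  qed
  then show ?thesis unfolding Q_def by simp
qed

section \<open>Polar coordinates adapted to the two linear foci\<close>

definition zc :: "real \<Rightarrow> real \<Rightarrow> real^2 \<Rightarrow> complex" where
  "zc \<gamma> e X = Complex (e * X $ 1) (e * X $ 2 - \<gamma> * X $ 1)"

definition LV :: "real \<Rightarrow> real \<Rightarrow> real^2 \<Rightarrow> real" where
  "LV \<gamma> e X = \<gamma> * pi / 2 + Re (Ln (zc \<gamma> e X)) - e * \<gamma> * Im (Ln (zc \<gamma> e X))"

definition amp :: "real \<Rightarrow> real \<Rightarrow> real^2 \<Rightarrow> real" where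
  "amp \<gamma> e X = exp (LV \<gamma> e X)"

text \<open>For e = 1 and e = -1 this is the squared modulus of \<open>zc \<gamma> e X\<close>, and
  also x y' - y x' along the field \<open>fld \<gamma> e\<close>, the numerator of the angular
  speed.\<close>

definition qf :: "real \<Rightarrow> real \<Rightarrow> real^2 \<Rightarrow> real" where
  "qf \<gamma> e X = (\<gamma>\<^sup>2 + 1) * (X $ 1)\<^sup>2 - 2 * e * \<gamma> * (X $ 1) * (X $ 2) + (X $ 2)\<^sup>2"

definition fld :: "real \<Rightarrow> real \<Rightarrow> real^2 \<Rightarrow> real^2" where
  "fld \<gamma> e X = vector [2 * e * \<gamma> * X $ 1 - X $ 2, (\<gamma>\<^sup>2 + 1) * X $ 1]"

text \<open>The cut of \<open>Ln\<close> becomes the ray y = e \<gamma> x with e x \<le> 0. For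
  \<gamma> > 0 it points into the lower half-plane on the side opposite to zone e, so the amplitude
  of zone e is smooth on its closed zone without the origin and on the whole upper
  half-plane.\<close>

lemma zc_nonpos: "zc \<gamma> e X \<in> \<real>\<^sub>\<le>\<^sub>0 \<longleftrightarrow> e * X $ 1 \<le> 0 \<and> e * X $ 2 = \<gamma> * X $ 1"
  by (simp add: zc_def complex_nonpos_Reals_iff)

lemma vec2_eq_0: "X = 0 \<longleftrightarrow> X $ 1 = 0 \<and> X $ 2 = 0" for X :: "real^2"
  by (simp add: vec_eq_iff forall_2)

lemma zc_dom_upper:
  assumes "\<gamma> > 0" "e \<in> {1, -1}" "X $ 2 > 0"
  shows "zc \<gamma> e X \<notin> \<real>\<^sub>\<le>\<^sub>0"
proof
  assume "zc \<gamma> e X \<in> \<real>\<^sub>\<le>\<^sub>0"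
  then have 1: "e * X $ 1 \<le> 0" "e * X $ 2 = \<gamma> * X $ 1" by (auto simp: zc_nonpos)
  have "X $ 2 = \<gamma> * (e * X $ 1)" using 1(2) assms(2) by auto
  moreover have "\<gamma> * (e * X $ 1) \<le> 0" using assms(1) 1 by (simp add: mult_nonneg_nonpos)
  ultimately show False using assms(3) by simp
qed

lemma zc_dom_side:
  assumes "e \<in> {1, -1}" "e * X $ 1 \<ge> 0" "X \<noteq> 0"
  shows "zc \<gamma> e X \<notin> \<real>\<^sub>\<le>\<^sub>0"
  using assms by (auto simp: zc_nonpos vec2_eq_0)

lemma norm_zc_square: 
  assumes "e \<in> {1, -1}"
  shows "(cmod (zc \<gamma> e X))\<^sup>2 = qf \<gamma> e X"
  unfolding cmod_power2 using assms by (auto simp: zc_def qf_def power2_eq_square algebra_simps)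

lemma zc_eq_0: "e \<in> {1, -1} \<Longrightarrow> zc \<gamma> e X = 0 \<longleftrightarrow> X = 0"
  by (auto simp: zc_def vec2_eq_0 complex_eq_iff)

lemma qf_pos: "e \<in> {1, -1} \<Longrightarrow> X \<noteq> 0 \<Longrightarrow> qf \<gamma> e X > 0"
  by (metis norm_zc_square zc_eq_0 zero_less_norm_iff zero_less_power)

lemma bounded_linear_zc: "bounded_linear (zc \<gamma> e)"
  unfolding zc_def
  by (intro linear_conv_bounded_linear[THEN iffD1] linearI) (auto simp: complex_eq_iff algebra_simps)

text \<open>The logarithmic derivative of z is z' times the conjugate of z, divided by the squared
  modulus \<open>qf\<close>. The direction X' stays arbitrary because three are inserted later: the
  field, the horizontal direction and the tangent of the switching curve.\<close>

lemma LV_has_derivative: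
  assumes e: "e \<in> {1, -1}" and d: "(X has_vector_derivative X') (at t within S)"
    and n: "zc \<gamma> e (X t) \<notin> \<real>\<^sub>\<le>\<^sub>0"
  shows "((\<lambda>t. LV \<gamma> e (X t)) has_real_derivative
           ((\<gamma>\<^sup>2 + 1) * X t $ 1 * X' $ 1 - 2 * e * \<gamma> * X t $ 1 * X' $ 2 + X t $ 2 * X' $ 2) / qf \<gamma> e (X t))
         (at t within S)"
proof -
  let ?z = "zc \<gamma> e (X t)" and ?z' = "zc \<gamma> e X'"
  have dz: "((\<lambda>t. zc \<gamma> e (X t)) has_vector_derivative ?z') (at t within S)"
    by (rule bounded_linear.has_vector_derivative[OF bounded_linear_zc d])
  have "(Ln has_field_derivative inverse ?z) (at ?z)"
    using n by (rule has_field_derivative_Ln)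
  from field_vector_diff_chain_within[OF dz has_field_derivative_at_within[OF this]]
  have dl: "((\<lambda>t. Ln (zc \<gamma> e (X t))) has_vector_derivative ?z' * inverse ?z) (at t within S)"
    by (simp add: o_def)
  have "((\<lambda>t. LV \<gamma> e (X t)) has_real_derivative
      Re (?z' * inverse ?z) - e * \<gamma> * Im (?z' * inverse ?z)) (at t within S)"
    unfolding LV_def
    by (rule derivative_eq_intros refl
          bounded_linear.has_vector_derivative[OF bounded_linear_Re dl, folded has_real_derivative_iff_has_vector_derivative]
          bounded_linear.has_vector_derivative[OF bounded_linear_Im dl, folded has_real_derivative_iff_has_vector_derivative])+ simp
  moreover have "Re (?z' * inverse ?z) - e * \<gamma> * Im (?z' * inverse ?z) = 
     ((\<gamma>\<^sup>2 + 1) * X t $ 1 * X' $ 1 - 2 * e * \<gamma> * X t $ 1 * X' $ 2 + X t $ 2 * X' $ 2) / qf \<gamma> e (X t)"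
  proof -
    have "?z' * inverse ?z = ?z' * cnj ?z / of_real (qf \<gamma> e (X t))"
      unfolding norm_zc_square[OF e, symmetric]
      using complex_div_cnj[of ?z' ?z] by (simp add: divide_inverse)
    then have "Re (?z' * inverse ?z) = Re (?z' * cnj ?z) / qf \<gamma> e (X t)"
      "Im (?z' * inverse ?z) = Im (?z' * cnj ?z) / qf \<gamma> e (X t)" by (metis Re_divide_of_real, metis Im_divide_of_real)
    then have "Re (?z' * inverse ?z) - e * \<gamma> * Im (?z' * inverse ?z) = 
      (Re (?z' * cnj ?z) - e * \<gamma> * Im (?z' * cnj ?z)) / qf \<gamma> e (X t)"
      unfolding \<open>Re (?z' * inverse ?z) = _\<close> \<open>Im (?z' * inverse ?z) = _\<close>
      by (simp only: diff_divide_distrib times_divide_eq_right)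
    also have "Re (?z' * cnj ?z) - e * \<gamma> * Im (?z' * cnj ?z) = 
      (\<gamma>\<^sup>2 + 1) * X t $ 1 * X' $ 1 - 2 * e * \<gamma> * X t $ 1 * X' $ 2 + X t $ 2 * X' $ 2"
      using e by (auto simp: zc_def algebra_simps power2_eq_square)
    finally show ?thesis .
  qed
  ultimately show ?thesis by simp
qed

lemma amp_pos: "amp \<gamma> e X > 0" by (simp add: amp_def)

lemma LV_continuous_at:
  assumes "e \<in> {1, -1}" "zc \<gamma> e X \<notin> \<real>\<^sub>\<le>\<^sub>0"
  shows "isCont (LV \<gamma> e) X"
proof -
  have "isCont (zc \<gamma> e) X" by (rule linear_continuous_at[OF bounded_linear_zc])
  then have "isCont (\<lambda>X. Ln (zc \<gamma> e X)) X" using assms(2) by (rule isCont_Ln')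
  then have "isCont (\<lambda>X. Re (Ln (zc \<gamma> e X))) X" "isCont (\<lambda>X. Im (Ln (zc \<gamma> e X))) X"
    by (auto intro: isCont_Re isCont_Im)
  then show ?thesis unfolding LV_def by (intro continuous_intros)
qed

lemma amp_scale:
  assumes "e \<in> {1, -1}" "X \<noteq> 0" "r > 0"
  shows "amp \<gamma> e (r *\<^sub>R X) = r * amp \<gamma> e X"
proof -
  have "zc \<gamma> e (r *\<^sub>R X) = of_real r * zc \<gamma> e X" by (simp add: zc_def complex_eq_iff algebra_simps)
  then have "Ln (zc \<gamma> e (r *\<^sub>R X)) = of_real (ln r) + Ln (zc \<gamma> e X)"
    using assms by (simp add: Ln_times_of_real zc_eq_0 Ln_of_real)
  then have "LV \<gamma> e (r *\<^sub>R X) = ln r + LV \<gamma> e X" by (simp add: LV_def)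
  then show ?thesis using assms by (simp add: amp_def exp_add)
qed

text \<open>The two half-axes lie at \<open>Im (Ln z)\<close> equal to e pi/2 and - e pi/2, so the
  constant \<gamma> pi/2 in \<open>LV\<close> is cancelled on the upper one and doubled on the lower
  one, for both signs of e.\<close>

lemma amp_axis:
  assumes "e \<in> {1, -1}" "y > 0"
  shows "amp \<gamma> e (vector [0, y]) = y" "amp \<gamma> e (vector [0, - y]) = y * exp (\<gamma> * pi)"
proof -
  have 1: "Ln (\<i> * of_real y) = of_real (ln y) + \<i> * (pi/2)"
    using assms Ln_times_of_real[of y \<i>] by (simp add: mult.commute Ln_of_real)
  have 2: "Ln (- (\<i> * of_real y)) = of_real (ln y) - \<i> * (pi/2)"
    using assms Ln_times_of_real[of y "-\<i>"] by (simp add: mult.commute Ln_of_real)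
  have z1: "zc \<gamma> e (vector [0, y]) = (if e = 1 then \<i> * of_real y else - (\<i> * of_real y))"
    "zc \<gamma> e (vector [0, -y]) = (if e = 1 then - (\<i> * of_real y) else (\<i> * of_real y))"
    using assms by (auto simp: zc_def complex_eq_iff)
  have "LV \<gamma> e (vector [0, y]) = ln y" "LV \<gamma> e (vector [0, -y]) = ln y + \<gamma> * pi"
    unfolding LV_def z1 using assms by (auto simp: 1 2 norm_mult field_simps)
  then show "amp \<gamma> e (vector [0, y]) = y" "amp \<gamma> e (vector [0, - y]) = y * exp (\<gamma> * pi)"
    using assms by (auto simp: amp_def exp_add)
qed

lemma norm_zc_bounds:
  assumes "\<gamma> > 0" "e \<in> {1, -1}"
  shows "cmod (zc \<gamma> e X) \<le> (2 + \<gamma>) * norm X" "norm X \<le> (2 + \<gamma>) * cmod (zc \<gamma> e X)"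
proof -
  have n: "norm X \<le> \<bar>X $ 1\<bar> + \<bar>X $ 2\<bar>" using norm_le_l1_cart[of X] by (simp add: UNIV_2)
  have gp: "\<bar>\<gamma>\<bar> = \<gamma>" using assms by simp
  have c: "\<bar>X $ 1\<bar> \<le> norm X" "\<bar>X $ 2\<bar> \<le> norm X" by (rule component_le_norm_cart)+
  have e: "\<bar>e\<bar> = 1" using assms by auto
  have g: "\<bar>\<gamma> * X $ 1\<bar> = \<gamma> * \<bar>X $ 1\<bar>" using assms by (simp add: abs_mult)
  have "cmod (zc \<gamma> e X) \<le> \<bar>e * X $ 1\<bar> + \<bar>e * X $ 2 - \<gamma> * X $ 1\<bar>"
    using cmod_le[of "zc \<gamma> e X"] by (simp add: zc_def)
  also have "\<dots> \<le> \<bar>X $ 1\<bar> + (\<bar>X $ 2\<bar> + \<gamma> * \<bar>X $ 1\<bar>)"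
    using abs_triangle_ineq4[of "e * X $ 2" "\<gamma> * X $ 1"] e by (simp add: abs_mult g gp)
  also have "\<dots> \<le> norm X + (norm X + \<gamma> * norm X)"
    using c assms by (intro add_mono mult_left_mono) auto
  finally show "cmod (zc \<gamma> e X) \<le> (2 + \<gamma>) * norm X" by (simp add: algebra_simps)
  have r: "\<bar>e * X $ 1\<bar> \<le> cmod (zc \<gamma> e X)" "\<bar>e * X $ 2 - \<gamma> * X $ 1\<bar> \<le> cmod (zc \<gamma> e X)"
    using abs_Re_le_cmod[of "zc \<gamma> e X"] abs_Im_le_cmod[of "zc \<gamma> e X"] by (auto simp: zc_def)
  have "\<bar>X $ 2\<bar> = \<bar>(e * X $ 2 - \<gamma> * X $ 1) + \<gamma> * X $ 1\<bar>" using e by (simp add: abs_mult)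
  also have "\<dots> \<le> \<bar>e * X $ 2 - \<gamma> * X $ 1\<bar> + \<gamma> * \<bar>X $ 1\<bar>" using g by linarith
  finally have "norm X \<le> \<bar>X $ 1\<bar> + (\<bar>e * X $ 2 - \<gamma> * X $ 1\<bar> + \<gamma> * \<bar>X $ 1\<bar>)" using n by linarith
  also have "\<dots> \<le> cmod (zc \<gamma> e X) + (cmod (zc \<gamma> e X) + \<gamma> * cmod (zc \<gamma> e X))"
    using r assms e by (intro add_mono mult_left_mono) (auto simp: abs_mult)
  finally show "norm X \<le> (2 + \<gamma>) * cmod (zc \<gamma> e X)" by (simp add: algebra_simps)
qed

text \<open>\<open>Im (Ln z)\<close> is bounded by pi, so the angular factor of the amplitude stays
  between fixed positive constants, and z is linear and invertible in X.\<close>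

lemma amp_norm_bounds:
  assumes "\<gamma> > 0"
  obtains M where "M > 0" "\<And>e X. e \<in> {1,-1} \<Longrightarrow> X \<noteq> 0 \<Longrightarrow> amp \<gamma> e X \<le> M * norm X"
    "\<And>e X. e \<in> {1,-1} \<Longrightarrow> X \<noteq> 0 \<Longrightarrow> norm X \<le> M * amp \<gamma> e X"
proof
  define M where "M = exp (2 * \<gamma> * pi) * (2 + \<gamma>)"
  show "M > 0" using assms by (simp add: M_def)
  fix e :: real and X :: "real^2"
  assume e: "e \<in> {1,-1}" and X: "X \<noteq> 0"
  let ?z = "zc \<gamma> e X"
  have z: "?z \<noteq> 0" using e X by (simp add: zc_eq_0)
  have "\<bar>e * \<gamma> * Im (Ln ?z)\<bar> = \<gamma> * \<bar>Im (Ln ?z)\<bar>" using e assms by (auto simp: abs_mult)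
  also have "\<dots> \<le> \<gamma> * pi" using mpi_less_Im_Ln[OF z] Im_Ln_le_pi[OF z] assms by (intro mult_left_mono) auto
  finally have i: "\<bar>e * \<gamma> * Im (Ln ?z)\<bar> \<le> \<gamma> * pi" .
  have p: "\<gamma> * pi > 0" using assms by simp
  have re: "Re (Ln ?z) = ln (cmod ?z)" using z by simp
  have "LV \<gamma> e X \<le> 2 * \<gamma> * pi + ln (cmod ?z)"
    unfolding LV_def re using i p by linarith
  then have "amp \<gamma> e X \<le> exp (2 * \<gamma> * pi + ln (cmod ?z))" by (simp add: amp_def)
  also have "\<dots> = exp (2 * \<gamma> * pi) * cmod ?z" using z by (simp add: exp_add)
  also have "\<dots> \<le> M * norm X" using norm_zc_bounds(1)[OF assms e, of X] by (simp add: M_def mult_ac)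
  finally show "amp \<gamma> e X \<le> M * norm X" .
  have "ln (cmod ?z) \<le> 2 * \<gamma> * pi + LV \<gamma> e X"
    unfolding LV_def re using i p by linarith
  then have "exp (ln (cmod ?z)) \<le> exp (2 * \<gamma> * pi + LV \<gamma> e X)" by simp
  then have "cmod ?z \<le> exp (2 * \<gamma> * pi) * amp \<gamma> e X" using z by (simp add: exp_add amp_def)
  then have "(2 + \<gamma>) * cmod ?z \<le> M * amp \<gamma> e X" using assms by (simp add: M_def mult_ac)
  then show "norm X \<le> M * amp \<gamma> e X" using norm_zc_bounds(2)[OF assms e, of X] by linarith
qed

text \<open>This is the numerator in \<open>LV_has_derivative\<close> with the field itself
  inserted; its vanishing makes \<open>LV\<close> a first integral.\<close>

lemma amp_fld_zero:
  "(\<gamma>\<^sup>2 + 1) * X $ 1 * fld \<gamma> e X $ 1 - 2 * e * \<gamma> * X $ 1 * fld \<gamma> e X $ 2 + X $ 2 * fld \<gamma> e X $ 2 = 0"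
  by (simp add: fld_def algebra_simps)

lemma has_vector_derivative_vector2:
  assumes "(f has_real_derivative f') (at t within S)" "(g has_real_derivative g') (at t within S)"
  shows "((\<lambda>t. vector [f t, g t] :: real^2) has_vector_derivative vector [f', g']) (at t within S)"
proof -
  have v: "(vector [a, b] :: real^2) = a *\<^sub>R axis 1 1 + b *\<^sub>R axis 2 1" for a b :: real
    by (simp add: vec_eq_iff forall_2 axis_def)
  have "((\<lambda>t. f t *\<^sub>R axis 1 1 + g t *\<^sub>R axis 2 1 :: real^2) has_vector_derivative 
     (f t *\<^sub>R 0 + f' *\<^sub>R axis 1 1) + (g t *\<^sub>R 0 + g' *\<^sub>R axis 2 1)) (at t within S)"
    by (intro has_vector_derivative_add has_vector_derivative_scaleR assms has_vector_derivative_const)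
  then show ?thesis by (simp add: v)
qed

lemma LV_horizontal_derivative:
  assumes "\<gamma> > 0" "e \<in> {1, -1}" "y > 0"
  shows "((\<lambda>x. LV \<gamma> e (vector [x, y])) has_real_derivative
            (\<gamma>\<^sup>2 + 1) * x / qf \<gamma> e (vector [x, y])) (at x)"
proof -
  have "((\<lambda>x. vector [x, y] :: real^2) has_vector_derivative vector [1, 0]) (at x)"
    by (intro has_vector_derivative_vector2 derivative_intros)
  from LV_has_derivative[OF assms(2) this] show ?thesis
    using assms by (simp add: zc_dom_upper)
qed

text \<open>By \<open>LV_horizontal_derivative\<close> the slope has the sign of x: at a fixed
  height the amplitude is least on the y-axis.\<close>

lemma amp_horizontal_mono:
  assumes g: "\<gamma> > 0" and e: "e \<in> {1, -1}" and y: "y > 0"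
  shows "0 \<le> a \<Longrightarrow> a < b \<Longrightarrow> amp \<gamma> e (vector [a, y]) < amp \<gamma> e (vector [b, y])"
    and "a \<le> 0 \<Longrightarrow> b < a \<Longrightarrow> amp \<gamma> e (vector [a, y]) < amp \<gamma> e (vector [b, y])"
proof -
  have q: "qf \<gamma> e (vector [x, y]) > 0" for x using y qf_pos[OF e, of "vector [x,y]"] by (simp add: vec2_eq_0)
  note D = LV_horizontal_derivative[OF g e y]
  have C: "continuous_on S (\<lambda>x. LV \<gamma> e (vector [x, y]))" for S
    using D DERIV_isCont continuous_at_imp_continuous_on by blast
  show "amp \<gamma> e (vector [a, y]) < amp \<gamma> e (vector [b, y])" if "0 \<le> a" "a < b"
  proof -
    have pos: "(\<gamma>\<^sup>2 + 1) * x / qf \<gamma> e (vector [x, y]) > 0" if "x > 0" for x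
      using that q by (intro divide_pos_pos mult_pos_pos) (auto simp: add_nonneg_pos)
    have "\<exists>d. ((\<lambda>x. LV \<gamma> e (vector [x, y])) has_real_derivative d) (at x) \<and> d > 0" if "a < x" for x
      by (rule exI[of _ "(\<gamma>\<^sup>2 + 1) * x / qf \<gamma> e (vector [x, y])"]) (use D[of x] pos[of x] that \<open>0 \<le> a\<close> in simp)
    then have "LV \<gamma> e (vector [a, y]) < LV \<gamma> e (vector [b, y])"
      by (intro DERIV_pos_imp_increasing_open[OF that(2) _ C]) blast
    then show ?thesis by (simp add: amp_def)
  qed
  show "amp \<gamma> e (vector [a, y]) < amp \<gamma> e (vector [b, y])" if "a \<le> 0" "b < a"
  proof -
    have pos: "(\<gamma>\<^sup>2 + 1) * x / qf \<gamma> e (vector [x, y]) < 0" if "x < 0" for x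
      using that q by (intro divide_neg_pos mult_pos_neg) (auto simp: add_nonneg_pos)
    have "\<exists>d. ((\<lambda>x. LV \<gamma> e (vector [x, y])) has_real_derivative d) (at x) \<and> d < 0" if "x < a" for x
      by (rule exI[of _ "(\<gamma>\<^sup>2 + 1) * x / qf \<gamma> e (vector [x, y])"]) (use D[of x] pos[of x] that \<open>a \<le> 0\<close> in simp)
    then have "LV \<gamma> e (vector [b, y]) > LV \<gamma> e (vector [a, y])"
      by (intro DERIV_neg_imp_decreasing_open[OF that(2) _ C]) blast
    then show ?thesis by (simp add: amp_def)
  qed
qed

text \<open>Both logarithms agree at x = 0. The two forms \<open>qf\<close> differ by 4 \<gamma> x
  y, so the derivative of the difference of the logarithms is positive for x \<noteq> 0, whatever
  the sign of x.\<close>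

lemma amp_compare:
  assumes g: "\<gamma> > 0" and y: "y > 0"
  shows "0 < x \<Longrightarrow> amp \<gamma> (-1) (vector [x, y]) < amp \<gamma> 1 (vector [x, y])"
    and "x < 0 \<Longrightarrow> amp \<gamma> 1 (vector [x, y]) < amp \<gamma> (-1) (vector [x, y])"
proof -
  define f where "f x = LV \<gamma> 1 (vector [x, y]) - LV \<gamma> (-1) (vector [x, y])" for x
  define f' where "f' x = (\<gamma>\<^sup>2 + 1) * x / qf \<gamma> 1 (vector [x, y]) - (\<gamma>\<^sup>2 + 1) * x / qf \<gamma> (-1) (vector [x, y])" for x
  have D: "(f has_real_derivative f' x) (at x)" for x
    unfolding f_def f'_def using g y by (intro derivative_intros LV_horizontal_derivative) auto
  have q: "qf \<gamma> 1 (vector [x, y]) > 0" "qf \<gamma> (-1) (vector [x, y]) > 0" for x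
    using y qf_pos[of _ "vector [x,y]"] by (simp_all add: vec2_eq_0)
  have f'_eq: "f' x = (\<gamma>\<^sup>2 + 1) * 4 * \<gamma> * x\<^sup>2 * y / (qf \<gamma> 1 (vector [x, y]) * qf \<gamma> (-1) (vector [x, y]))" for x
  proof -
    have "f' x = (\<gamma>\<^sup>2 + 1) * x * (qf \<gamma> (-1) (vector [x, y]) - qf \<gamma> 1 (vector [x, y])) / (qf \<gamma> 1 (vector [x, y]) * qf \<gamma> (-1) (vector [x, y]))"
      unfolding f'_def using q[of x] by (simp add: field_simps)
    also have "qf \<gamma> (-1) (vector [x, y]) - qf \<gamma> 1 (vector [x, y]) = 4 * \<gamma> * x * y"
      by (simp add: qf_def)
    finally show ?thesis by (simp add: power2_eq_square mult_ac)
  qed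
  have pos: "f' x > 0" if "x \<noteq> 0" for x
    unfolding f'_eq using q that g y by (intro divide_pos_pos mult_pos_pos add_nonneg_pos) auto
  have "amp \<gamma> 1 (vector [0, y]) = amp \<gamma> (-1) (vector [0, y])" using y by (simp add: amp_axis)
  then have f0: "f 0 = 0" by (simp add: f_def amp_def)
  have C: "continuous_on S f" for S
    using D DERIV_isCont continuous_at_imp_continuous_on by blast
  show "amp \<gamma> (-1) (vector [x, y]) < amp \<gamma> 1 (vector [x, y])" if "0 < x"
  proof -
    have "f 0 < f x" by (rule DERIV_pos_imp_increasing_open[OF that _ C], intro exI conjI, rule D, rule pos) auto
    then show ?thesis unfolding f0 by (simp add: f_def amp_def)
  qed
  show "amp \<gamma> 1 (vector [x, y]) < amp \<gamma> (-1) (vector [x, y])" if "x < 0"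
  proof -
    have "f x < f 0" by (rule DERIV_pos_imp_increasing_open[OF that _ C], intro exI conjI, rule D, rule pos) auto
    then show ?thesis unfolding f0 by (simp add: f_def amp_def)
  qed
qed

lemma amp_continuous_at:
  assumes "e \<in> {1, -1}" "zc \<gamma> e X \<notin> \<real>\<^sub>\<le>\<^sub>0"
  shows "isCont (amp \<gamma> e) X"
  unfolding amp_def using LV_continuous_at[OF assms] by (intro continuous_intros)

text \<open>The amplitude for \<open>h = 0\<close>.  It is continuous and homogeneous, and on the levels \<open>k > 0\<close> with
  \<open>h k = 0\<close> it agrees with the amplitude for \<open>h\<close>.\<close>

definition NN :: "real \<Rightarrow> real^2 \<Rightarrow> real" where
  "NN \<gamma> X = (if X = 0 then 0 else if X $ 1 \<ge> 0 then amp \<gamma> 1 X else amp \<gamma> (-1) X)"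

lemma vec2_eq: "X = vector [a, b] \<longleftrightarrow> X $ 1 = a \<and> X $ 2 = b" for X :: "real^2"
  by (simp add: vec_eq_iff forall_2)

lemma amp_axis_agree:
  assumes "X $ 1 = 0" "X \<noteq> 0"
  shows "amp \<gamma> 1 X = amp \<gamma> (-1) X"
proof -
  have "X = vector [0, X $ 2]" unfolding vec2_eq using assms by simp
  then obtain y where X: "X = vector [0, y]" ..
  then have "y \<noteq> 0" using assms(2) by (auto simp: vec2_eq_0)
  then consider "y > 0" | "- y > 0" by linarith
  then show ?thesis
  proof cases
    case 1
    then show ?thesis by (simp add: X amp_axis)
  next
    case 2
    then show ?thesis using amp_axis(2)[of 1 "-y" \<gamma>] amp_axis(2)[of "-1" "-y" \<gamma>] by (simp add: X)
  qed
qed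

lemma NN_simps:
  assumes "X \<noteq> 0"
  shows "X $ 1 \<ge> 0 \<Longrightarrow> NN \<gamma> X = amp \<gamma> 1 X" "X $ 1 \<le> 0 \<Longrightarrow> NN \<gamma> X = amp \<gamma> (-1) X"
  using assms amp_axis_agree[of X] by (auto simp: NN_def)

lemma NN_amp: "e \<in> {1, -1} \<Longrightarrow> X \<noteq> 0 \<Longrightarrow> e * X $ 1 \<ge> 0 \<Longrightarrow> NN \<gamma> X = amp \<gamma> e X"
  using NN_simps[of X] by auto

lemma NN_zero [simp]: "NN \<gamma> 0 = 0" by (simp add: NN_def)

lemma NN_pos: "X \<noteq> 0 \<Longrightarrow> NN \<gamma> X > 0" by (simp add: NN_def amp_pos)

lemma NN_nonneg: "NN \<gamma> X \<ge> 0" using NN_pos[of X \<gamma>] by (cases "X = 0") auto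

lemma NN_scale: "r \<ge> 0 \<Longrightarrow> NN \<gamma> (r *\<^sub>R X) = r * NN \<gamma> X"
  by (auto simp: NN_def amp_scale zero_le_mult_iff)

lemma NN_norm_bounds:
  assumes "\<gamma> > 0"
  obtains M where "M > 0" "\<And>X. NN \<gamma> X \<le> M * norm X" "\<And>X. norm X \<le> M * NN \<gamma> X"
proof -
  obtain M where M: "M > 0" "\<And>e X. e \<in> {1,-1} \<Longrightarrow> X \<noteq> 0 \<Longrightarrow> amp \<gamma> e X \<le> M * norm X"
    "\<And>e X. e \<in> {1,-1} \<Longrightarrow> X \<noteq> 0 \<Longrightarrow> norm X \<le> M * amp \<gamma> e X"
    using amp_norm_bounds[OF assms] by blast
  show thesis
    by (rule that[of M]) (use M in \<open>auto simp: NN_def\<close>)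
qed

lemma NN_continuous:
  assumes "\<gamma> > 0"
  shows "continuous_on UNIV (NN \<gamma>)"
proof -
  have "isCont (NN \<gamma>) X" for X
  proof (cases "X = 0")
    case True
    obtain M where M: "\<And>X. NN \<gamma> X \<le> M * norm X"
      by (rule NN_norm_bounds[OF assms]) (rule that)
    have "(NN \<gamma> \<longlongrightarrow> 0) (at 0)"
    proof (rule tendsto_sandwich[of "\<lambda>_. 0"])
      show "((\<lambda>X. M * norm X) \<longlongrightarrow> 0) (at (0::real^2))" by (intro tendsto_mult_right_zero tendsto_norm_zero tendsto_ident_at)
      show "\<forall>\<^sub>F X in at 0. 0 \<le> NN \<gamma> X" by (simp add: NN_nonneg)
      show "\<forall>\<^sub>F X in at 0. NN \<gamma> X \<le> M * norm X" by (simp add: M)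
    qed simp
    then show ?thesis using True by (simp add: isCont_def)
  next
    case False
    let ?S = "- {0 :: real^2}"
    let ?A = "?S \<inter> {X. X $ 1 \<ge> 0}" and ?B = "?S \<inter> {X. X $ 1 \<le> 0}"
    have cA: "continuous_on ?A (amp \<gamma> 1)" and cB: "continuous_on ?B (amp \<gamma> (-1))"
      by (rule continuous_at_imp_continuous_on, rule ballI, rule amp_continuous_at, simp, rule zc_dom_side, auto)+
    have AB: "?A \<union> ?B = ?S" by auto
    have clA: "closedin (top_of_set ?S) ?A" and clB: "closedin (top_of_set ?S) ?B"
      by (intro closedin_closed_Int closed_halfspace_component_ge_cart closed_halfspace_component_le_cart)+
    have "continuous_on (?A \<union> ?B) (\<lambda>X. if X $ 1 \<ge> 0 then amp \<gamma> 1 X else amp \<gamma> (-1) X)"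
    proof (rule continuous_on_cases_local[OF _ _ cA cB])
      show "closedin (top_of_set (?A \<union> ?B)) ?A" "closedin (top_of_set (?A \<union> ?B)) ?B"
        unfolding AB by (fact clA clB)+
      show "amp \<gamma> 1 X = amp \<gamma> (-1) X" if "X \<in> ?A \<and> \<not> X $ 1 \<ge> 0 \<or> X \<in> ?B \<and> X $ 1 \<ge> 0" for X
        by (rule amp_axis_agree) (use that in auto)
    qed
    then have "continuous_on ?S (\<lambda>X. if X $ 1 \<ge> 0 then amp \<gamma> 1 X else amp \<gamma> (-1) X)" unfolding AB .
    then have "continuous_on ?S (NN \<gamma>)" 
      by (rule continuous_on_eq) (auto simp: NN_def)
    then show ?thesis using False by (simp add: continuous_on_eq_continuous_at open_Compl)
  qed
  then show ?thesis by (simp add: continuous_on_eq_continuous_at)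
qed

section \<open>Level curves of \<open>NN\<close> as closed curves around the origin\<close>

definition loop :: "real \<Rightarrow> real \<Rightarrow> (real^2) set" where
  "loop \<gamma> r = {X. NN \<gamma> X = r}"

lemma open_NN_less: 
  assumes "\<gamma> > 0"
  shows "open {X. NN \<gamma> X < r}" "open {X. r < NN \<gamma> X}"
  using NN_continuous[OF assms] by (auto intro!: open_Collect_less continuous_intros)

text \<open>The complement of the curve is the union of the disjoint open sets \<open>?D\<close> and
  \<open>?E\<close>. Components of points of \<open>?D\<close> are confined to this bounded set;
  from a point of \<open>?E\<close> the outward ray avoids the curve by homogeneity, so its
  component is unbounded. No Jordan curve theorem is involved.\<close>

lemma inside_loop:
  assumes g: "\<gamma> > 0" and r: "r > 0"
  shows "inside (loop \<gamma> r) = {X. NN \<gamma> X < r}"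
proof
  let ?D = "{X. NN \<gamma> X < r}" and ?E = "{X. r < NN \<gamma> X}"
  obtain M where M: "M > 0" "\<And>X. NN \<gamma> X \<le> M * norm X" "\<And>X. norm X \<le> M * NN \<gamma> X"
    using NN_norm_bounds[OF g] by blast
  have seg: "closed_segment 0 X \<subseteq> ?D" if "X \<in> ?D" for X
  proof
    fix Y assume "Y \<in> closed_segment 0 X"
    then obtain u where u: "0 \<le> u" "u \<le> 1" "Y = u *\<^sub>R X" by (auto simp: closed_segment_def)
    then have "NN \<gamma> Y = u * NN \<gamma> X" by (simp add: NN_scale)
    also have "\<dots> \<le> NN \<gamma> X" using u NN_nonneg[of \<gamma> X] by (simp add: mult_left_le_one_le)
    finally show "Y \<in> ?D" using that by simp
  qed
  have "starlike ?D" unfolding starlike_def using seg r by (intro bexI[of _ 0]) auto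
  then have con: "connected ?D" by (rule starlike_imp_connected)
  have bd: "bounded ?D"
  proof (rule boundedI)
    fix X assume "X \<in> ?D"
    then have "M * NN \<gamma> X \<le> M * r" using M(1) by simp
    then show "norm X \<le> M * r" using M(3)[of X] by linarith
  qed
  have comp: "connected_component_set (- loop \<gamma> r) X \<subseteq> ?D" if "X \<in> ?D" for X
  proof -
    let ?C = "connected_component_set (- loop \<gamma> r) X"
    have "?C \<subseteq> - loop \<gamma> r" by (rule connected_component_subset)
    then have "?C \<subseteq> ?D \<union> ?E" unfolding loop_def using linorder_neqE by auto
    moreover have "X \<in> ?C" using that by (auto simp: loop_def)
    moreover have "connected ?C" by simp
    moreover have "?D \<inter> ?E \<inter> ?C = {}" by auto
    ultimately show ?thesis
      using connectedD[of ?C ?D ?E] open_NN_less[OF g] that by blast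
  qed
  show "?D \<subseteq> inside (loop \<gamma> r)"
  proof
    fix X assume X: "X \<in> ?D"
    then show "X \<in> inside (loop \<gamma> r)"
      unfolding inside_def using bounded_subset[OF bd comp[OF X]] by (auto simp: loop_def)
  qed
  show "inside (loop \<gamma> r) \<subseteq> ?D"
  proof
    fix X assume X: "X \<in> inside (loop \<gamma> r)"
    show "X \<in> ?D"
    proof (rule ccontr)
      assume "X \<notin> ?D"
      moreover have "X \<notin> loop \<gamma> r" using X inside_no_overlap by blast
      ultimately have XE: "r < NN \<gamma> X" by (auto simp: loop_def)
      then have X0: "X \<noteq> 0" using r by auto
      let ?R = "(\<lambda>t. t *\<^sub>R X) ` {1..}"
      have "connected ?R" by (intro connected_continuous_image continuous_intros) (simp add: is_interval_connected_1)
      moreover have "X \<in> ?R" by (rule image_eqI[of _ _ 1]) auto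
      moreover have "?R \<subseteq> - loop \<gamma> r"
      proof
        fix Y assume "Y \<in> ?R"
        then obtain t where t: "t \<ge> 1" "Y = t *\<^sub>R X" by auto
        then have "NN \<gamma> Y = t * NN \<gamma> X" by (simp add: NN_scale)
        also have "\<dots> \<ge> 1 * NN \<gamma> X" using t NN_nonneg[of \<gamma> X] by (intro mult_right_mono) auto
        finally show "Y \<in> - loop \<gamma> r" using XE by (simp add: loop_def)
      qed
      ultimately have "?R \<subseteq> connected_component_set (- loop \<gamma> r) X"
        by (intro connected_component_maximal)
      moreover have "bounded (connected_component_set (- loop \<gamma> r) X)" using X by (simp add: inside_def)
      ultimately have "bounded ?R" by (rule bounded_subset[rotated])
      then obtain K where K: "\<And>Y. Y \<in> ?R \<Longrightarrow> norm Y \<le> K" unfolding bounded_iff by blast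
      define t where "t = max 1 ((\<bar>K\<bar> + 1) / norm X)"
      have "t *\<^sub>R X \<in> ?R" by (auto simp: t_def)
      then have "norm (t *\<^sub>R X) \<le> K" by (rule K)
      moreover have "norm (t *\<^sub>R X) \<ge> ((\<bar>K\<bar> + 1) / norm X) * norm X"
        unfolding t_def norm_scaleR by (intro mult_right_mono) auto
      ultimately show False using X0 by simp
    qed
  qed
qed

lemma loop_axis:
  assumes r: "r > 0"
  shows "loop \<gamma> r \<inter> {X. X $ 1 = 0} = {vector [0, r], vector [0, - r * exp (- pi * \<gamma>)]}"
proof -
  have "NN \<gamma> (vector [0, y]) = r \<longleftrightarrow> y = r \<or> y = - r * exp (- pi * \<gamma>)" for y
  proof -
    consider "y > 0" | "y = 0" | "y < 0" by linarith
    then show ?thesis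
    proof cases
      case 1
      have "NN \<gamma> (vector [0, y]) = y" using 1 amp_axis(1)[of 1 y \<gamma>] by (simp add: NN_def vec2_eq_0)
      moreover have "y \<noteq> - r * exp (- pi * \<gamma>)"
        using 1 r mult_pos_pos[OF r exp_gt_zero[of "- pi * \<gamma>"]] by linarith
      ultimately show ?thesis by simp
    next
      case 2
      then have "(vector [0, y] :: real^2) = 0" by (simp add: vec2_eq_0)
      then show ?thesis using r 2 by simp
    next
      case 3
      have "NN \<gamma> (vector [0, y]) = - y * exp (\<gamma> * pi)"
        using 3 amp_axis(2)[of 1 "-y" \<gamma>] by (simp add: NN_def vec2_eq_0)
      moreover have "- y * exp (\<gamma> * pi) = r \<longleftrightarrow> y = - r * exp (- pi * \<gamma>)"
        by (auto simp: exp_minus field_simps)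
      ultimately show ?thesis using 3 r by auto
    qed
  qed
  moreover have "X = vector [0, X $ 2]" if "X $ 1 = 0" for X :: "real^2" using that by (simp add: vec2_eq)
  ultimately have "X \<in> loop \<gamma> r \<longleftrightarrow> X $ 2 = r \<or> X $ 2 = - r * exp (- pi * \<gamma>)" if "X $ 1 = 0" for X
    unfolding loop_def mem_Collect_eq using that by metis
  then show ?thesis by (auto simp: vec2_eq)
qed

section \<open>The abstract piecewise linear system\<close>

definition HH :: "(real \<Rightarrow> real) \<Rightarrow> real^2 \<Rightarrow> real" where
  "HH f X = (if X $ 2 \<le> 0 then X $ 1 else X $ 1 - f (X $ 2))"

definition FF :: "real \<Rightarrow> (real \<Rightarrow> real) \<Rightarrow> real^2 \<Rightarrow> real^2" where
  "FF \<gamma> f X = (if HH f X < 0 then fld \<gamma> (-1) X else fld \<gamma> 1 X)"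

text \<open>The quantity in \<open>transversal\<close> is the smaller one, over e = 1 and e = -1, of
  \<open>(\<gamma>\<^sup>2 + 1) * h y * h' y - 2 * e * \<gamma> * h y + y\<close>. This is minus the
  rate of \<open>HH\<close> along the field e on the upper branch, and also the numerator of the
  derivative of \<open>LV\<close> along that branch; one condition thus yields the crossing
  direction and the monotonicity of \<open>sig\<close>. The assumptions are invariant under
  replacing h by - h, as the reversal of time requires. The linear bound gives continuity of
  \<open>HH\<close> at y = 0 and makes heights comparable to amplitudes.\<close>

locale two_zone =
  fixes \<gamma> :: real and h h' :: "real \<Rightarrow> real"
  assumes g_pos: "\<gamma> > 0"
    and h_deriv: "y > 0 \<Longrightarrow> (h has_real_derivative h' y) (at y)"
    and transversal: "y > 0 \<Longrightarrow> 0 < y - 2 * \<gamma> * \<bar>h y\<bar> + (\<gamma>\<^sup>2 + 1) * h y * h' y"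
    and h_linear_bound: "\<exists>C. \<forall>y>0. \<bar>h y\<bar> \<le> C * y"
begin

definition sig :: "real \<Rightarrow> real \<Rightarrow> real" where
  "sig e y = amp \<gamma> e (vector [h y, y])"

lemma sig_pos: "sig e y > 0" by (simp add: sig_def amp_pos)

lemma transversal_signed:
  assumes "e \<in> {1, -1}" "y > 0"
  shows "0 < (\<gamma>\<^sup>2 + 1) * h y * h' y - 2 * e * \<gamma> * h y + y"
proof -
  have "2 * e * \<gamma> * h y \<le> 2 * \<gamma> * \<bar>h y\<bar>"
  proof -
    have "e * h y \<le> \<bar>h y\<bar>" using assms by auto
    then have "(2 * \<gamma>) * (e * h y) \<le> (2 * \<gamma>) * \<bar>h y\<bar>" using g_pos by (intro mult_left_mono) auto
    then show ?thesis by (simp add: mult_ac)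
  qed
  then show ?thesis using transversal[OF assms(2)] by linarith
qed

lemma LV_curve_derivative:
  assumes e: "e \<in> {1, -1}" and y: "y > 0"
  obtains d where "((\<lambda>y. LV \<gamma> e (vector [h y, y])) has_real_derivative d) (at y)" "d > 0"
proof -
  have d: "((\<lambda>y. vector [h y, y] :: real^2) has_vector_derivative vector [h' y, 1]) (at y)"
    by (intro has_vector_derivative_vector2 h_deriv y derivative_intros)
  have q: "qf \<gamma> e (vector [h y, y]) > 0" using y by (intro qf_pos e) (simp add: vec2_eq_0)
  show thesis
    by (rule that[OF LV_has_derivative[OF e d]])
       (use y e transversal_signed[OF e y] q in \<open>auto simp: zc_dom_upper g_pos\<close>)
qed

lemma sig_strict_mono:
  assumes e: "e \<in> {1, -1}" and "0 < a" "a < b"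
  shows "sig e a < sig e b"
proof -
  have "\<exists>d. ((\<lambda>y. LV \<gamma> e (vector [h y, y])) has_real_derivative d) (at x) \<and> d > 0" if "a \<le> x" for x
    using LV_curve_derivative[OF e, of x] that assms by (metis less_le_trans)
  then have "LV \<gamma> e (vector [h a, a]) < LV \<gamma> e (vector [h b, b])"
    by (intro DERIV_pos_imp_increasing[OF assms(3)]) blast
  then show ?thesis by (simp add: sig_def amp_def)
qed

lemma sig_less_iff: "e \<in> {1, -1} \<Longrightarrow> 0 < a \<Longrightarrow> 0 < b \<Longrightarrow> sig e a < sig e b \<longleftrightarrow> a < b"
  using sig_strict_mono[of e a b] sig_strict_mono[of e b a] by (cases a b rule: linorder_cases) auto

lemma sig_eq_iff: "e \<in> {1, -1} \<Longrightarrow> 0 < a \<Longrightarrow> 0 < b \<Longrightarrow> sig e a = sig e b \<longleftrightarrow> a = b"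
  using sig_strict_mono[of e a b] sig_strict_mono[of e b a] by (cases a b rule: linorder_cases) auto

lemma sig_fix: "e \<in> {1, -1} \<Longrightarrow> y > 0 \<Longrightarrow> h y = 0 \<Longrightarrow> sig e y = y"
  by (simp add: sig_def amp_axis)

lemma sig_compare: 
  assumes "y > 0"
  shows "h y > 0 \<Longrightarrow> sig (-1) y < sig 1 y" "h y < 0 \<Longrightarrow> sig 1 y < sig (-1) y"
  using amp_compare[OF g_pos assms] by (auto simp: sig_def)

lemma sig_equal_iff: "y > 0 \<Longrightarrow> sig 1 y = sig (-1) y \<longleftrightarrow> h y = 0"
  using sig_compare[of y] sig_fix[of 1 y] sig_fix[of "-1" y] by (cases "h y" "0::real" rule: linorder_cases) auto

text \<open>Both functions \<open>sig\<close> fix a zero j of h and increase strictly, so they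
  preserve the side of j. No crossing can therefore carry an amplitude past a level.\<close>

lemma sig_level:
  assumes "e \<in> {1, -1}" "y > 0" "j > 0" "h j = 0"
  shows "sig e y < j \<longleftrightarrow> y < j" "j < sig e y \<longleftrightarrow> j < y" "sig e y = j \<longleftrightarrow> y = j"
  using sig_less_iff[OF assms(1), of y j] sig_less_iff[OF assms(1), of j y] sig_eq_iff[OF assms(1), of y j]
    sig_fix[OF assms(1,3,4)] assms by auto

lemma sig_continuous: "e \<in> {1, -1} \<Longrightarrow> continuous_on {0<..} (sig e)"
proof (intro continuous_at_imp_continuous_on ballI)
  fix y :: real assume e: "e \<in> {1, -1}" and "y \<in> {0<..}"
  then have "isCont (\<lambda>y. LV \<gamma> e (vector [h y, y])) y"
    using LV_curve_derivative[OF e, of y] DERIV_isCont by (metis greaterThan_iff)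
  then show "isCont (sig e) y" unfolding sig_def amp_def by (intro continuous_intros)
qed

text \<open>Only the line y = 0 is delicate; there the two cases fit together because the linear
  bound forces h y to tend to 0.\<close>

lemma HH_continuous: "continuous_on UNIV (HH h)"
proof -
  define k where "k y = (if y \<le> 0 then 0 else h y)" for y
  obtain C where C: "\<And>y. y > 0 \<Longrightarrow> \<bar>h y\<bar> \<le> C * y" using h_linear_bound by blast
  have k: "isCont k y" for y
  proof -
    consider "y < 0" | "y = 0" | "y > 0" by linarith
    then show ?thesis
    proof cases
      case 1
      have "\<forall>\<^sub>F x in nhds y. k x = 0"
        using eventually_nhds_in_open[of "{..<0}" y] 1 by (auto simp: k_def elim!: eventually_mono)
      then show ?thesis using isCont_cong[of k "\<lambda>_. 0" y] by simp
    next
      case 2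
      have "(k \<longlongrightarrow> 0) (at 0)"
      proof (rule Lim_null_comparison)
        show "\<forall>\<^sub>F x in at 0. norm (k x) \<le> C * \<bar>x\<bar>"
        proof (intro always_eventually allI)
          fix x :: real
          have "0 \<le> C" using C[of 1] by simp
          then show "norm (k x) \<le> C * \<bar>x\<bar>"
            using C[of x] mult_nonneg_nonpos[of C x] by (cases "x \<le> 0") (auto simp: k_def)
        qed
        show "((\<lambda>x. C * \<bar>x\<bar>) \<longlongrightarrow> 0) (at 0)" by (auto intro!: tendsto_eq_intros)
      qed
      then show ?thesis using 2 by (simp add: isCont_def k_def)
    next
      case 3
      have "\<forall>\<^sub>F x in nhds y. k x = h x"
        using eventually_nhds_in_open[of "{0<..}" y] 3 by (auto simp: k_def elim!: eventually_mono)
      then show ?thesis using isCont_cong[of k h y] DERIV_isCont[OF h_deriv[OF 3]] by simp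
    qed
  qed
  have "HH h = (\<lambda>X. X $ 1 - k (X $ 2))" by (auto simp: HH_def k_def)
  moreover have "isCont (\<lambda>X. k (X $ 2)) X" for X :: "real^2"
    by (rule isCont_o2[OF _ k]) (intro continuous_intros)
  ultimately show ?thesis 
    by (auto intro!: continuous_at_imp_continuous_on continuous_intros)
qed

lemma zone_dom:
  assumes "e \<in> {1, -1}" "e * HH h X \<ge> 0" "X \<noteq> 0"
  shows "zc \<gamma> e X \<notin> \<real>\<^sub>\<le>\<^sub>0"
proof (cases "X $ 2 > 0")
  case False
  then show ?thesis using assms by (intro zc_dom_side) (auto simp: HH_def)
qed (use zc_dom_upper g_pos assms in auto)

text \<open>The amplitude belonging to the switching function \<open>HH h\<close>; on the upper branch it takes the value
  after the crossing.\<close>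

definition BB :: "real^2 \<Rightarrow> real" where
  "BB X = (if HH h X > 0 then amp \<gamma> 1 X else amp \<gamma> (-1) X)"

lemma BB_pos: "BB X > 0" by (simp add: BB_def amp_pos)

text \<open>Between the \<open>y\<close>-axis and the switching curve, at height \<open>y\<close>, both amplitudes lie between
  \<open>y\<close> and their values on the switching curve at that height.\<close>

lemma amp_between:
  assumes e: "e \<in> {1, -1}" and y: "y > 0" and j: "j > 0" "h j = 0"
    and b: "0 \<le> x \<and> x \<le> h y \<or> h y \<le> x \<and> x \<le> 0"
  shows "amp \<gamma> e (vector [x, y]) < j \<longleftrightarrow> y < j" "j < amp \<gamma> e (vector [x, y]) \<longleftrightarrow> j < y"
proof -
  note m = amp_horizontal_mono[OF g_pos e y]
  have 1: "y \<le> amp \<gamma> e (vector [x, y])"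
    using m(1)[of 0 x] m(2)[of 0 x] amp_axis(1)[OF e y, of \<gamma>] by (cases x "0::real" rule: linorder_cases) auto
  have 2: "amp \<gamma> e (vector [x, y]) \<le> sig e y"
    using m(1)[of x "h y"] m(2)[of x "h y"] b by (cases "x = h y") (auto simp: sig_def)
  show "amp \<gamma> e (vector [x, y]) < j \<longleftrightarrow> y < j" "j < amp \<gamma> e (vector [x, y]) \<longleftrightarrow> j < y"
    using 1 2 sig_level[OF e y j] by linarith+
qed

text \<open>\<open>BB\<close> and \<open>NN\<close> can differ only between the y-axis and the upper
  branch, and there both lie on the same side of j as the height does.\<close>

lemma BB_NN_compare:
  assumes j: "j > 0" "h j = 0" and X: "X \<noteq> 0"
  shows "BB X < j \<longleftrightarrow> NN \<gamma> X < j" "j < BB X \<longleftrightarrow> j < NN \<gamma> X"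
proof -
  have "(BB X < j \<longleftrightarrow> NN \<gamma> X < j) \<and> (j < BB X \<longleftrightarrow> j < NN \<gamma> X)"
  proof (cases "X $ 2 > 0 \<and> (0 \<le> X $ 1 \<and> X $ 1 \<le> h (X $ 2) \<or> h (X $ 2) \<le> X $ 1 \<and> X $ 1 \<le> 0)")
    case True
    have X': "vector [X $ 1, X $ 2] = X" using vec2_eq[of X "X $ 1" "X $ 2"] by simp
    have *: "amp \<gamma> e X < j \<longleftrightarrow> X $ 2 < j" "j < amp \<gamma> e X \<longleftrightarrow> j < X $ 2" if "e \<in> {1,-1}" for e
      using amp_between[OF that _ j, of "X $ 2" "X $ 1"] True unfolding X' by blast+
    show ?thesis using *[of 1] *[of "-1"] X by (auto simp: BB_def NN_def)
  next
    case False
    then have "HH h X > 0 \<longleftrightarrow> X $ 1 > 0" by (auto simp: HH_def)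
    then have "BB X = NN \<gamma> X" using X NN_simps[OF X] by (auto simp: BB_def)
    then show ?thesis by simp
  qed
  then show "BB X < j \<longleftrightarrow> NN \<gamma> X < j" "j < BB X \<longleftrightarrow> j < NN \<gamma> X" by auto
qed

lemma BB_NN_eq: "j > 0 \<Longrightarrow> h j = 0 \<Longrightarrow> X \<noteq> 0 \<Longrightarrow> BB X = j \<longleftrightarrow> NN \<gamma> X = j"
  using BB_NN_compare[of j X] by (cases "BB X" j rule: linorder_cases) auto

text \<open>A point of amplitude j between the y-axis and the upper branch must have height j by
  \<open>amp_between\<close>, and at that height the gap has width h j = 0.\<close>

lemma level_side:
  assumes e: "e \<in> {1, -1}" and j: "j > 0" "h j = 0" and X: "X \<noteq> 0" and a: "amp \<gamma> e X = j"
  shows "sgn (HH h X) = sgn (X $ 1)"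
proof (cases "X $ 2 > 0 \<and> (0 \<le> X $ 1 \<and> X $ 1 \<le> h (X $ 2) \<or> h (X $ 2) \<le> X $ 1 \<and> X $ 1 \<le> 0)")
  case True
  have X': "vector [X $ 1, X $ 2] = X" using vec2_eq[of X "X $ 1" "X $ 2"] by simp
  have "amp \<gamma> e X < j \<longleftrightarrow> X $ 2 < j" "j < amp \<gamma> e X \<longleftrightarrow> j < X $ 2"
    using amp_between[OF e _ j, of "X $ 2" "X $ 1"] True unfolding X' by blast+
  then have "X $ 2 = j" using a by auto
  then show ?thesis using True j by (auto simp: HH_def)
next
  case False
  then show ?thesis by (auto simp: HH_def sgn_if)
qed

end

section \<open>The linear flows\<close>

definition iz :: "real \<Rightarrow> real \<Rightarrow> complex \<Rightarrow> real^2" where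
  "iz \<gamma> e z = vector [e * Re z, e * Im z + \<gamma> * Re z]"

definition flow :: "real \<Rightarrow> real \<Rightarrow> real \<Rightarrow> real^2 \<Rightarrow> real^2" where
  "flow \<gamma> e t X = iz \<gamma> e (exp (of_real t * Complex (e * \<gamma>) 1) * zc \<gamma> e X)"

lemma iz_zc: "e \<in> {1, -1} \<Longrightarrow> iz \<gamma> e (zc \<gamma> e X) = X"
  by (auto simp: iz_def zc_def vec_eq_iff forall_2)

lemma zc_iz: "e \<in> {1, -1} \<Longrightarrow> zc \<gamma> e (iz \<gamma> e z) = z"
  by (auto simp: iz_def zc_def complex_eq_iff)

lemma zc_fld: "e \<in> {1, -1} \<Longrightarrow> zc \<gamma> e (fld \<gamma> e X) = Complex (e * \<gamma>) 1 * zc \<gamma> e X"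
  by (auto simp: zc_def fld_def complex_eq_iff power2_eq_square algebra_simps)

lemma bounded_linear_iz: "bounded_linear (iz \<gamma> e)"
  unfolding iz_def
  by (intro linear_conv_bounded_linear[THEN iffD1] linearI) (auto simp: vec_eq_iff forall_2 algebra_simps)

lemma zc_flow: "e \<in> {1, -1} \<Longrightarrow> zc \<gamma> e (flow \<gamma> e t X) = exp (of_real t * Complex (e * \<gamma>) 1) * zc \<gamma> e X"
  by (simp add: flow_def zc_iz)

lemma flow_0 [simp]: "e \<in> {1, -1} \<Longrightarrow> flow \<gamma> e 0 X = X"
  by (simp add: flow_def iz_zc)

lemma flow_add: "e \<in> {1, -1} \<Longrightarrow> flow \<gamma> e s (flow \<gamma> e t X) = flow \<gamma> e (s + t) X"
  by (simp add: flow_def[of _ _ s] zc_flow) (simp add: flow_def distrib_right exp_add mult.assoc)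

lemma flow_eq_0: "e \<in> {1, -1} \<Longrightarrow> flow \<gamma> e t X = 0 \<longleftrightarrow> X = 0"
  using zc_eq_0[of e \<gamma> "flow \<gamma> e t X"] by (simp add: zc_flow zc_eq_0)

lemma flow_has_derivative:
  assumes e: "e \<in> {1, -1}"
  shows "((\<lambda>t. flow \<gamma> e t X) has_vector_derivative fld \<gamma> e (flow \<gamma> e t X)) (at t within S)"
proof -
  let ?l = "Complex (e * \<gamma>) 1"
  have "((\<lambda>t. exp (of_real t * ?l) * zc \<gamma> e X) has_vector_derivative ?l * (exp (of_real t * ?l) * zc \<gamma> e X)) (at t within S)"
    by (rule has_vector_derivative_real_field derivative_eq_intros refl)+ simp
  from bounded_linear.has_vector_derivative[OF bounded_linear_iz this]
  have "((\<lambda>t. flow \<gamma> e t X) has_vector_derivative iz \<gamma> e (?l * (exp (of_real t * ?l) * zc \<gamma> e X))) (at t within S)"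
    by (simp add: flow_def)
  moreover have "iz \<gamma> e (?l * (exp (of_real t * ?l) * zc \<gamma> e X)) = fld \<gamma> e (flow \<gamma> e t X)"
    using iz_zc[OF e, of \<gamma> "fld \<gamma> e (flow \<gamma> e t X)"] by (simp only: zc_fld[OF e] zc_flow[OF e])
  ultimately show ?thesis by simp
qed

lemma flow_continuous: "e \<in> {1, -1} \<Longrightarrow> continuous_on S (\<lambda>t. flow \<gamma> e t X)"
  unfolding continuous_on_eq_continuous_within
  by (blast intro: has_vector_derivative_continuous flow_has_derivative)

section \<open>Local structure of solutions\<close>

lemma solution_on_subset:
  assumes s: "solution_on F' H' I \<phi>" and sub: "J \<subseteq> I"
  shows "solution_on F' H' J \<phi>"
proof -
  have m: "at t within J \<inter> A \<le> at t within I \<inter> A" for t A by (rule at_le) (use sub in auto)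
  have c: "crosses_at H' J \<phi> t" if "crosses_at H' I \<phi> t" for t
    using that filter_leD[OF m[of t "{..<t}"]] filter_leD[OF m[of t "{t<..}"]] unfolding crosses_at_def by blast
  show ?thesis
    unfolding solution_on_def
  proof (intro conjI ballI impI)
    show "continuous_on J \<phi>" using s continuous_on_subset[OF _ sub] unfolding solution_on_def by blast
    fix t assume "t \<in> J"
    then have t: "t \<in> I" using sub by blast
    show "(\<phi> has_vector_derivative F' (\<phi> t)) (at t within J)" if "H' (\<phi> t) \<noteq> 0 \<or> \<phi> t = 0"
      by (rule has_vector_derivative_within_subset[OF _ sub]) (use s t that in \<open>simp add: solution_on_def\<close>)
    show "crosses_at H' J \<phi> t" if "H' (\<phi> t) = 0 \<and> \<phi> t \<noteq> 0"
      by (rule c) (use s t that in \<open>simp add: solution_on_def\<close>)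
  qed
qed

context two_zone
begin

abbreviation sol :: "real set \<Rightarrow> (real \<Rightarrow> real^2) \<Rightarrow> bool" where
  "sol I \<phi> \<equiv> solution_on (FF \<gamma> h) (HH h) I \<phi>"

lemma HH_0 [simp]: "HH h 0 = 0" by (simp add: HH_def)

lemma FF_zone: "e \<in> {1, -1} \<Longrightarrow> e * HH h X > 0 \<Longrightarrow> FF \<gamma> h X = fld \<gamma> e X"
  by (auto simp: FF_def)

lemma sol_continuous: "sol I \<phi> \<Longrightarrow> continuous_on I \<phi>" by (simp add: solution_on_def)

lemma HH_sol_continuous: "sol I \<phi> \<Longrightarrow> continuous_on I (\<lambda>t. HH h (\<phi> t))"
  by (rule continuous_on_compose2[OF HH_continuous sol_continuous]) auto

lemma sol_derivative_zone:
  assumes "sol I \<phi>" "{a<..<b} \<subseteq> I" "a < s" "s < b" "e \<in> {1, -1}" "e * HH h (\<phi> s) > 0"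
  shows "(\<phi> has_vector_derivative fld \<gamma> e (\<phi> s)) (at s)"
proof -
  have "s \<in> I" using assms by auto
  moreover have "HH h (\<phi> s) \<noteq> 0" using assms by auto
  ultimately have "(\<phi> has_vector_derivative FF \<gamma> h (\<phi> s)) (at s within I)" 
    using assms(1) by (auto simp: solution_on_def)
  then have "(\<phi> has_vector_derivative FF \<gamma> h (\<phi> s)) (at s within {a<..<b})"
    by (rule has_vector_derivative_within_subset[OF _ assms(2)])
  then show ?thesis
    using assms FF_zone[OF assms(5,6)] by (simp add: at_within_open[of s "{a<..<b}"])
qed

text \<open>The integrating factor \<open>exp (- t * (e * \<gamma> + i))\<close> turns z into a
  constant. The zone condition is asked only in the open interval, since the end points may lie on
  the switching curve; continuity covers them.\<close>

lemma sol_flow: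
  assumes s: "sol I \<phi>" and ab: "a \<le> b" "{a..b} \<subseteq> I" and e: "e \<in> {1, -1}"
    and z: "\<And>s. a < s \<Longrightarrow> s < b \<Longrightarrow> e * HH h (\<phi> s) > 0"
  shows "\<phi> b = flow \<gamma> e (b - a) (\<phi> a)"
proof (cases "a = b")
  case False
  let ?l = "Complex (e * \<gamma>) 1"
  define w where "w s = exp (of_real s * (- ?l)) * zc \<gamma> e (\<phi> s)" for s
  have sub: "{a<..<b} \<subseteq> I" using ab by auto
  have dz: "((\<lambda>s. zc \<gamma> e (\<phi> s)) has_vector_derivative ?l * zc \<gamma> e (\<phi> s)) (at s)" if "a < s" "s < b" for s
    using bounded_linear.has_vector_derivative[OF bounded_linear_zc sol_derivative_zone[OF s sub that e z[OF that]], of \<gamma> e]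
    by (simp add: zc_fld[OF e])
  have dw: "(w has_derivative (\<lambda>_. 0)) (at s)" if "a < s" "s < b" for s
  proof -
    have "((\<lambda>s. exp (of_real s * (- ?l))) has_vector_derivative - ?l * exp (of_real s * (- ?l))) (at s)"
      by (rule has_vector_derivative_real_field derivative_eq_intros refl)+ simp
    from has_vector_derivative_mult[OF this dz[OF that]]
    have "(w has_vector_derivative 0) (at s)" unfolding w_def by (simp add: algebra_simps)
    then show ?thesis by (simp add: has_vector_derivative_def)
  qed
  have "continuous_on {a..b} (\<lambda>s. zc \<gamma> e (\<phi> s))"
    by (rule linear_continuous_on_compose[OF continuous_on_subset[OF sol_continuous[OF s] ab(2)]
          bounded_linear.linear[OF bounded_linear_zc]])
  then have "continuous_on {a..b} w" unfolding w_def by (intro continuous_intros)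
  then have "w b = w a" using mvt_general[of a b w "\<lambda>_ _. 0", OF _ _ dw] ab False by simp
  then have "exp (of_real b * ?l) * w b = exp (of_real b * ?l) * w a" by simp
  moreover have "exp (of_real b * ?l) * exp (of_real b * (- ?l)) = 1"
    "exp (of_real b * ?l) * exp (of_real a * (- ?l)) = exp (of_real (b - a) * ?l)"
    unfolding mult_exp_exp by (simp, simp add: left_diff_distrib)
  ultimately have "zc \<gamma> e (\<phi> b) = exp (of_real (b - a) * ?l) * zc \<gamma> e (\<phi> a)"
    unfolding w_def mult.assoc[symmetric] by (simp only: mult_1_left)
  then show ?thesis unfolding flow_def using iz_zc[OF e, of \<gamma> "\<phi> b"] by simp
qed (use e in simp)

text \<open>A zero of \<open>HH\<close> other than the origin has y \<noteq> 0, so only one of the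
  two cases in the definition of \<open>HH\<close> is met nearby and a possible kink along y = 0
  does no harm.\<close>

lemma HH_path_derivative:
  assumes d: "(X has_vector_derivative X') (at t)" and "X t \<noteq> 0" "HH h (X t) = 0"
  shows "((\<lambda>t. HH h (X t)) has_real_derivative 
            (if X t $ 2 > 0 then X' $ 1 - h' (X t $ 2) * X' $ 2 else X' $ 1)) (at t)"
proof -
  have c: "((\<lambda>t. X t $ i) has_real_derivative X' $ i) (at t)" for i
    using bounded_linear.has_vector_derivative[OF bounded_linear_vec_nth d]
    by (simp add: has_real_derivative_iff_has_vector_derivative)
  have ev: "\<forall>\<^sub>F s in nhds t. X s $ 2 \<in> A" if "open A" "X t $ 2 \<in> A" for A
  proof -
    have "((\<lambda>s. X s $ 2) \<longlongrightarrow> X t $ 2) (nhds t)"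
      using DERIV_isCont[OF c[of 2]] tendsto_at_iff_tendsto_nhds[of "\<lambda>s. X s $ 2" t] by (simp add: isCont_def)
    then show ?thesis by (rule topological_tendstoD[OF _ that])
  qed
  have n: "X t $ 2 \<noteq> 0" using assms(2,3) by (auto simp: HH_def vec2_eq_0)
  show ?thesis
  proof (cases "X t $ 2 > 0")
    case True
    have "((\<lambda>s. X s $ 1 - h (X s $ 2)) has_real_derivative X' $ 1 - h' (X t $ 2) * X' $ 2) (at t)"
      by (intro DERIV_diff c DERIV_chain2[where f = h and g = "\<lambda>s. X s $ 2", OF h_deriv[OF True]])
    moreover have "\<forall>\<^sub>F s in nhds t. HH h (X s) = X s $ 1 - h (X s $ 2)"
      using ev[of "{0<..}"] True by (auto simp: HH_def elim: eventually_mono)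
    ultimately show ?thesis using True DERIV_cong_ev[OF refl _ refl] by fastforce
  next
    case False
    then have "\<forall>\<^sub>F s in nhds t. HH h (X s) = X s $ 1"
      using ev[of "{..<0}"] n by (auto simp: HH_def elim: eventually_mono)
    then show ?thesis using c[of 1] False DERIV_cong_ev[OF refl _ refl] by fastforce
  qed
qed

text \<open>Both fields cross the upper branch of the switching curve from right to left
  and the lower branch from left to right.\<close>

lemma flow_crossing:
  assumes e: "e \<in> {1, -1}" and p: "p \<noteq> 0" "HH h p = 0"
  obtains d where "d > 0" "\<And>t. 0 < t \<Longrightarrow> t < d \<Longrightarrow> sgn (p $ 2) * HH h (flow \<gamma> e t p) < 0"
    "\<And>t. 0 < t \<Longrightarrow> t < d \<Longrightarrow> sgn (p $ 2) * HH h (flow \<gamma> e (- t) p) > 0"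
proof -
  have n: "p $ 2 \<noteq> 0" using p by (auto simp: HH_def vec2_eq_0)
  define D where "D = (if p $ 2 > 0 then fld \<gamma> e p $ 1 - h' (p $ 2) * fld \<gamma> e p $ 2 else fld \<gamma> e p $ 1)"
  have "((\<lambda>t. HH h (flow \<gamma> e t p)) has_real_derivative D) (at 0)"
    using HH_path_derivative[OF flow_has_derivative[OF e, where X = p and t = 0 and S = UNIV and \<gamma> = \<gamma>]] p
    unfolding D_def flow_0[OF e] by blast
  then have dd: "((\<lambda>t. sgn (p $ 2) * HH h (flow \<gamma> e t p)) has_real_derivative sgn (p $ 2) * D) (at 0)"
    by (rule DERIV_cmult)
  have neg: "sgn (p $ 2) * D < 0"
  proof (cases "p $ 2 > 0")
    case True
    then have "p $ 1 = h (p $ 2)" using p by (simp add: HH_def)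
    then show ?thesis using True transversal_signed[OF e True]
      by (simp add: D_def fld_def algebra_simps)
  next
    case False
    then have "p $ 2 < 0" "p $ 1 = 0" using p n by (auto simp: HH_def)
    then show ?thesis by (simp add: D_def fld_def)
  qed
  obtain d1 where d1: "d1 > 0" "\<And>t. 0 < t \<Longrightarrow> t < d1 \<Longrightarrow> sgn (p $ 2) * HH h (flow \<gamma> e t p) < 0"
    using DERIV_neg_dec_right[OF dd neg] p e by auto
  obtain d2 where d2: "d2 > 0" "\<And>t. 0 < t \<Longrightarrow> t < d2 \<Longrightarrow> sgn (p $ 2) * HH h (flow \<gamma> e (- t) p) > 0"
    using DERIV_neg_dec_left[OF dd neg] p e by auto
  show thesis by (rule that[of "min d1 d2"]) (use d1 d2 in auto)
qed

text \<open>The sign of the zone in which a solution is just before it passes p; on the switching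
  curve it is read off from the branch, whose crossing direction is given by
  \<open>flow_crossing\<close>. The counterpart \<open>side_after\<close> differs only
  there.\<close>

definition side_before :: "real^2 \<Rightarrow> real" where
  "side_before p = (if HH h p = 0 then sgn (p $ 2) else sgn (HH h p))"

definition side_after :: "real^2 \<Rightarrow> real" where
  "side_after p = (if HH h p = 0 then - sgn (p $ 2) else sgn (HH h p))"

lemma sides:
  assumes "p \<noteq> 0"
  shows "side_before p \<in> {1, -1}" "side_after p \<in> {1, -1}"
    "side_before p * HH h p \<ge> 0" "side_after p * HH h p \<ge> 0"
proof -
  have "p $ 2 \<noteq> 0" if "HH h p = 0" using that assms by (auto simp: HH_def vec2_eq_0)
  then show "side_before p \<in> {1, -1}" "side_after p \<in> {1, -1}"
    "side_before p * HH h p \<ge> 0" "side_after p * HH h p \<ge> 0"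
    by (auto simp: side_before_def side_after_def sgn_if)
qed

text \<open>\<open>crosses_at\<close> leaves the direction open. But just before b the solution is
  the backward linear flow from \<open>\<phi> b\<close>, and \<open>flow_crossing\<close> tells on
  which side that lies.\<close>

lemma exit_side:
  assumes s: "sol I \<phi>" and ab: "a < b" "{a..b} \<subseteq> I" and e: "e \<in> {1, -1}"
    and z: "\<And>s. a < s \<Longrightarrow> s < b \<Longrightarrow> e * HH h (\<phi> s) > 0"
    and p: "\<phi> b \<noteq> 0" "HH h (\<phi> b) = 0"
  shows "e = sgn (\<phi> b $ 2)"
proof -
  obtain d where d: "d > 0" "\<And>t. 0 < t \<Longrightarrow> t < d \<Longrightarrow> sgn (\<phi> b $ 2) * HH h (flow \<gamma> e (- t) (\<phi> b)) > 0"
    using flow_crossing[OF e p] by metis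
  define t where "t = min (d / 2) ((b - a) / 2)"
  have t: "0 < t" "t < d" "a < b - t" "b - t < b" using d(1) ab by (auto simp: t_def min_def field_simps)
  have "\<phi> b = flow \<gamma> e (b - (b - t)) (\<phi> (b - t))"
    by (rule sol_flow[OF s _ _ e]) (use t ab z in auto)
  then have "\<phi> (b - t) = flow \<gamma> e (- t) (\<phi> b)" using e by (simp add: flow_add)
  then have "sgn (\<phi> b $ 2) * HH h (\<phi> (b - t)) > 0" using d(2)[OF t(1,2)] by simp
  moreover have "e * HH h (\<phi> (b - t)) > 0" by (rule z) (use t in auto)
  ultimately show ?thesis using e by (auto simp: sgn_if zero_less_mult_iff split: if_splits)
qed

lemma entry_side:
  assumes s: "sol I \<phi>" and ab: "a < b" "{a..b} \<subseteq> I" and e: "e \<in> {1, -1}"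
    and z: "\<And>s. a < s \<Longrightarrow> s < b \<Longrightarrow> e * HH h (\<phi> s) > 0"
    and p: "\<phi> a \<noteq> 0" "HH h (\<phi> a) = 0"
  shows "e = - sgn (\<phi> a $ 2)"
proof -
  obtain d where d: "d > 0" "\<And>t. 0 < t \<Longrightarrow> t < d \<Longrightarrow> sgn (\<phi> a $ 2) * HH h (flow \<gamma> e t (\<phi> a)) < 0"
    using flow_crossing[OF e p] by metis
  define t where "t = min (d / 2) ((b - a) / 2)"
  have t: "0 < t" "t < d" "a < a + t" "a + t < b" using d(1) ab by (auto simp: t_def min_def field_simps)
  have "\<phi> (a + t) = flow \<gamma> e (a + t - a) (\<phi> a)"
    by (rule sol_flow[OF s _ _ e]) (use t ab z in auto)
  then have "sgn (\<phi> a $ 2) * HH h (\<phi> (a + t)) < 0" using d(2)[OF t(1,2)] by simp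
  moreover have "e * HH h (\<phi> (a + t)) > 0" by (rule z) (use t in auto)
  ultimately show ?thesis using e by (auto simp: sgn_if zero_less_mult_iff mult_less_0_iff split: if_splits)
qed

lemma local_sides:
  assumes s: "sol I \<phi>" and I: "is_interval I" and t: "t \<in> I" and n: "\<phi> t \<noteq> 0"
  obtains d where "d > 0" "\<And>s. s \<in> I \<Longrightarrow> t - d < s \<Longrightarrow> s < t \<Longrightarrow> side_before (\<phi> t) * HH h (\<phi> s) > 0"
    "\<And>s. s \<in> I \<Longrightarrow> t < s \<Longrightarrow> s < t + d \<Longrightarrow> side_after (\<phi> t) * HH h (\<phi> s) > 0"
proof (cases "HH h (\<phi> t) = 0")
  case False
  define e where "e = sgn (HH h (\<phi> t))"
  have "continuous (at t within I) (\<lambda>s. e * HH h (\<phi> s))"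
    using HH_sol_continuous[OF s] t by (intro continuous_intros) (simp add: continuous_on_eq_continuous_within)
  moreover have "0 < e * HH h (\<phi> t)" using False by (simp add: e_def sgn_if)
  ultimately have "\<forall>\<^sub>F s in at t within I. 0 < e * HH h (\<phi> s)"
    by (simp add: continuous_within order_tendstoD)
  then obtain d where d: "d > 0" "\<And>s. s \<in> I \<Longrightarrow> s \<noteq> t \<Longrightarrow> dist s t < d \<Longrightarrow> 0 < e * HH h (\<phi> s)"
    by (auto simp: eventually_at)
  show thesis
    by (rule that[OF d(1)]) (use d(2) False in \<open>auto simp: side_before_def side_after_def e_def dist_real_def\<close>)
next
  case True
  have sub: "{a..b} \<subseteq> I" if "a \<in> I" "b \<in> I" for a b
    using I that by (meson atLeastAtMost_iff mem_is_interval_1_I subsetI)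
  have "crosses_at (HH h) I \<phi> t" using s t n True by (auto simp: solution_on_def)
  then obtain e where e: "e \<in> {1, -1::real}"
    and ev: "\<forall>\<^sub>F s in at t within I \<inter> {..<t}. e * HH h (\<phi> s) > 0"
    "\<forall>\<^sub>F s in at t within I \<inter> {t<..}. - e * HH h (\<phi> s) > 0"
  proof -
    assume *: "\<And>e. e \<in> {1, -1::real} \<Longrightarrow> \<forall>\<^sub>F s in at t within I \<inter> {..<t}. e * HH h (\<phi> s) > 0 \<Longrightarrow>
      \<forall>\<^sub>F s in at t within I \<inter> {t<..}. - e * HH h (\<phi> s) > 0 \<Longrightarrow> thesis"
    show thesis
      using \<open>crosses_at (HH h) I \<phi> t\<close> *[of 1] *[of "-1"] unfolding crosses_at_def by auto
  qed
  obtain d1 where d1: "d1 > 0" "\<And>s. s \<in> I \<Longrightarrow> t - d1 < s \<Longrightarrow> s < t \<Longrightarrow> e * HH h (\<phi> s) > 0"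
    using ev(1) by (auto simp: eventually_at dist_real_def)
  obtain d2 where d2: "d2 > 0" "\<And>s. s \<in> I \<Longrightarrow> t < s \<Longrightarrow> s < t + d2 \<Longrightarrow> - e * HH h (\<phi> s) > 0"
    using ev(2) by (auto simp: eventually_at dist_real_def)
  \<comment> \<open>At an end point of I the times of I lie on one side of t only, so e is
    identified from a single nearby time on either side. If there is none, both claims are
    vacuous.\<close>
  have "e = sgn (\<phi> t $ 2)" if ex: "s \<in> I" "t - d1 < s" "s < t \<or> t < s" "s < t + d2" for s
  proof (cases "s < t")
    case True
    have "e * HH h (\<phi> r) > 0" if "s < r" "r < t" for r
      by (rule d1(2)) (use that ex sub[OF ex(1) t] in auto)
    then show ?thesis by (rule exit_side[OF s True sub[OF ex(1) t] e _ n \<open>HH h (\<phi> t) = 0\<close>])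
  next
    case False
    then have st: "t < s" using ex by auto
    have "- e * HH h (\<phi> r) > 0" if "t < r" "r < s" for r
      by (rule d2(2)) (use that ex sub[OF t ex(1)] in auto)
    then have "- e = - sgn (\<phi> t $ 2)"
      by (rule entry_side[OF s st sub[OF t ex(1)] _ _ n \<open>HH h (\<phi> t) = 0\<close>, rotated]) (use e in auto)
    then show ?thesis by simp
  qed
  note E = this
  show thesis
  proof (rule that[of "min d1 d2"])
    show "min d1 d2 > 0" using d1 d2 by simp
    fix s assume sI: "s \<in> I"
    show "side_before (\<phi> t) * HH h (\<phi> s) > 0" if "t - min d1 d2 < s" "s < t"
      using E[OF sI] d1(2)[OF sI] that d2(1) True by (simp add: side_before_def)
    show "side_after (\<phi> t) * HH h (\<phi> s) > 0" if "t < s" "s < t + min d1 d2" 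
      using E[OF sI] d2(2)[OF sI] that d1(1) True by (simp add: side_after_def)
  qed
qed

section \<open>The amplitude along a solution\<close>

lemma HH_nz: "HH h X \<noteq> 0 \<Longrightarrow> X \<noteq> 0" by auto

lemma amp_const:
  assumes s: "sol I \<phi>" and ab: "a \<le> b" "{a..b} \<subseteq> I" and e: "e \<in> {1, -1}"
    and z: "\<And>s. a < s \<Longrightarrow> s < b \<Longrightarrow> e * HH h (\<phi> s) > 0"
    and ends: "\<phi> a \<noteq> 0" "\<phi> b \<noteq> 0" "e * HH h (\<phi> a) \<ge> 0" "e * HH h (\<phi> b) \<ge> 0"
  shows "amp \<gamma> e (\<phi> b) = amp \<gamma> e (\<phi> a)"
proof (cases "a = b")
  case False
  have dom: "zc \<gamma> e (\<phi> s) \<notin> \<real>\<^sub>\<le>\<^sub>0" if "s \<in> {a..b}" for s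
  proof -
    have "e * HH h (\<phi> s) \<ge> 0" "\<phi> s \<noteq> 0"
      using that ends z[of s] HH_nz[of "\<phi> s"] by (cases "s = a \<or> s = b"; force)+
    then show ?thesis by (intro zone_dom e)
  qed
  have sub: "{a<..<b} \<subseteq> I" using ab by auto
  have D: "((\<lambda>s. LV \<gamma> e (\<phi> s)) has_real_derivative 0) (at s)" if "a < s" "s < b" for s
    using LV_has_derivative[OF e sol_derivative_zone[OF s sub that e z[OF that]], of \<gamma>] dom[of s] that
      amp_fld_zero[of \<gamma> "\<phi> s" e] by simp
  have "continuous_on {a..b} (\<lambda>s. LV \<gamma> e (\<phi> s))"
    unfolding continuous_on_eq_continuous_within
  proof
    fix s assume sab: "s \<in> {a..b}"
    then have "continuous (at s within {a..b}) \<phi>"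
      using continuous_on_subset[OF sol_continuous[OF s] ab(2)] by (simp add: continuous_on_eq_continuous_within)
    moreover have "isCont (LV \<gamma> e) (\<phi> s)" by (rule LV_continuous_at[OF e dom[OF sab]])
    ultimately show "continuous (at s within {a..b}) (\<lambda>s. LV \<gamma> e (\<phi> s))"
      by (rule continuous_within_compose3[rotated])
  qed
  then have "LV \<gamma> e (\<phi> b) = LV \<gamma> e (\<phi> a)"
    by (intro DERIV_isconst_end D) (use ab False in auto)
  then show ?thesis by (simp add: amp_def)
qed simp

lemma BB_amp:
  assumes "e \<in> {1, -1}" "e * HH h X > 0"
  shows "BB X = amp \<gamma> e X"
  using assms by (auto simp: BB_def)

lemma BB_side_after:
  assumes "p \<noteq> 0"
  shows "BB p = amp \<gamma> (side_after p) p"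
proof -
  have "p $ 1 = 0" if "HH h p = 0" "p $ 2 < 0" using that by (auto simp: HH_def)
  moreover have "p $ 2 \<noteq> 0" if "HH h p = 0" using that assms by (auto simp: HH_def vec2_eq_0)
  ultimately show ?thesis using amp_axis_agree[of p \<gamma>] assms
    by (auto simp: BB_def side_after_def sgn_if)
qed

text \<open>The lower branch is part of the y-axis, where the two amplitudes agree; inside a zone
  the sides before and after coincide. Only the upper branch leaves a jump.\<close>

lemma amp_side_before:
  assumes "p \<noteq> 0"
  obtains "amp \<gamma> (side_before p) p = BB p"
  | "HH h p = 0" "p $ 2 > 0" "amp \<gamma> (side_before p) p = sig 1 (p $ 2)" "BB p = sig (-1) (p $ 2)"
proof (cases "HH h p = 0 \<and> p $ 2 > 0")
  case True
  then have "p = vector [h (p $ 2), p $ 2]" by (auto simp: vec2_eq HH_def)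
  then have "amp \<gamma> e p = sig e (p $ 2)" for e unfolding sig_def by (rule arg_cong)
  then show thesis using that(2) True by (simp add: side_before_def BB_def)
next
  case False
  have "p $ 1 = 0" if "HH h p = 0" "p $ 2 < 0" using that by (auto simp: HH_def)
  moreover have "p $ 2 \<noteq> 0" if "HH h p = 0" using that assms by (auto simp: HH_def vec2_eq_0)
  ultimately have "amp \<gamma> (side_before p) p = BB p" 
    using False amp_axis_agree[of p \<gamma>] assms by (auto simp: BB_def side_before_def sgn_if)
  then show thesis by (rule that(1))
qed

lemma interval_sub: "is_interval I \<Longrightarrow> a \<in> I \<Longrightarrow> b \<in> I \<Longrightarrow> {a..b} \<subseteq> (I :: real set)"
  by (meson atLeastAtMost_iff mem_is_interval_1_I subsetI)

lemma local_BB: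
  assumes s: "sol I \<phi>" and I: "is_interval I" and t: "t \<in> I" and n: "\<phi> t \<noteq> 0"
  obtains d where "d > 0" "\<And>s. s \<in> I \<Longrightarrow> t - d < s \<Longrightarrow> s < t \<Longrightarrow> BB (\<phi> s) = amp \<gamma> (side_before (\<phi> t)) (\<phi> t)"
    "\<And>s. s \<in> I \<Longrightarrow> t < s \<Longrightarrow> s < t + d \<Longrightarrow> BB (\<phi> s) = BB (\<phi> t)"
proof -
  obtain d where d: "d > 0" "\<And>s. s \<in> I \<Longrightarrow> t - d < s \<Longrightarrow> s < t \<Longrightarrow> side_before (\<phi> t) * HH h (\<phi> s) > 0"
    "\<And>s. s \<in> I \<Longrightarrow> t < s \<Longrightarrow> s < t + d \<Longrightarrow> side_after (\<phi> t) * HH h (\<phi> s) > 0"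
    by (rule local_sides[OF s I t n]) (rule that)
  note sd = sides[OF n]
  show thesis
  proof (rule that[OF d(1)])
    fix s assume sI: "s \<in> I"
    show "BB (\<phi> s) = amp \<gamma> (side_before (\<phi> t)) (\<phi> t)" if r: "t - d < s" "s < t"
    proof -
      note z = d(2)[OF sI r]
      have "amp \<gamma> (side_before (\<phi> t)) (\<phi> t) = amp \<gamma> (side_before (\<phi> t)) (\<phi> s)"
      proof (rule amp_const[OF s _ interval_sub[OF I sI t] sd(1) _ _ n _ sd(3)])
        show "0 < side_before (\<phi> t) * HH h (\<phi> u)" if "s < u" "u < t" for u
          by (rule d(2)) (use that r interval_sub[OF I sI t] in auto)
      qed (use z r in auto)
      then show ?thesis using BB_amp[OF sd(1) z] by simp
    qed
    show "BB (\<phi> s) = BB (\<phi> t)" if r: "t < s" "s < t + d"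
    proof -
      note z = d(3)[OF sI r]
      have "amp \<gamma> (side_after (\<phi> t)) (\<phi> s) = amp \<gamma> (side_after (\<phi> t)) (\<phi> t)"
      proof (rule amp_const[OF s _ interval_sub[OF I t sI] sd(2) _ n _ sd(4)])
        show "0 < side_after (\<phi> t) * HH h (\<phi> u)" if "t < u" "u < s" for u
          by (rule d(3)) (use that r interval_sub[OF I t sI] in auto)
      qed (use z r in auto)
      then show ?thesis using BB_amp[OF sd(2) z] BB_side_after[OF n] by simp
    qed
  qed
qed

text \<open>Between crossings \<open>BB\<close> is constant, so only the jumps have to be checked. R
  stays abstract because it serves in several forms: approach to a level, invariance of a half-line
  of amplitudes, constancy at a level.\<close>

lemma BB_monotone_relation:
  assumes s: "sol I \<phi>" and I: "is_interval I" and n: "\<And>t. t \<in> I \<Longrightarrow> \<phi> t \<noteq> 0"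
    and refl: "\<And>b. R b b" and trans: "\<And>a b c. R a b \<Longrightarrow> R b c \<Longrightarrow> R a c"
    and jump: "\<And>y. y > 0 \<Longrightarrow> R (sig 1 y) (sig (-1) y)"
    and ab: "a \<in> I" "b \<in> I" "a \<le> b"
  shows "R (BB (\<phi> a)) (BB (\<phi> b))"
proof (rule local_to_global_order[OF I ab])
  fix t assume t: "t \<in> I"
  obtain d where d: "d > 0" "\<And>s. s \<in> I \<Longrightarrow> t - d < s \<Longrightarrow> s < t \<Longrightarrow> BB (\<phi> s) = amp \<gamma> (side_before (\<phi> t)) (\<phi> t)"
    "\<And>s. s \<in> I \<Longrightarrow> t < s \<Longrightarrow> s < t + d \<Longrightarrow> BB (\<phi> s) = BB (\<phi> t)"
    by (rule local_BB[OF s I t n[OF t]]) (rule that)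
  have "R (amp \<gamma> (side_before (\<phi> t)) (\<phi> t)) (BB (\<phi> t))"
    by (rule amp_side_before[OF n[OF t]]) (simp_all add: refl jump)
  then show "\<exists>d>0. (\<forall>s\<in>I. t < s \<and> s < t + d \<longrightarrow> R (BB (\<phi> t)) (BB (\<phi> s))) \<and>
             (\<forall>s\<in>I. t - d < s \<and> s < t \<longrightarrow> R (BB (\<phi> s)) (BB (\<phi> t)))"
    using d refl by (intro exI[of _ d]) auto
next
  show "R (BB (\<phi> r)) (BB (\<phi> t))" if "R (BB (\<phi> r)) (BB (\<phi> s))" "R (BB (\<phi> s)) (BB (\<phi> t))" for r s t
    using that by (rule trans)
qed (rule refl)

section \<open>Solutions do not reach the origin\<close>

text \<open>A two-sided Gronwall estimate: in zone e the squared norm has derivative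
  \<open>4 * e * \<gamma> * x\<^sup>2 + 2 * \<gamma>\<^sup>2 * x * y\<close>, at most K times itself
  in absolute value. As K is the same in both zones, the estimates chain through any number of
  crossings.\<close>

lemma sol_norm_growth:
  assumes s: "sol I \<phi>" and I: "is_interval I" and n: "\<And>t. t \<in> I \<Longrightarrow> \<phi> t \<noteq> 0"
    and ab: "a \<in> I" "b \<in> I" "a \<le> b"
  defines "K \<equiv> 4 * \<gamma> + 2 * \<gamma>\<^sup>2"
  shows "(norm (\<phi> b))\<^sup>2 \<le> exp (K * (b - a)) * (norm (\<phi> a))\<^sup>2 \<and>
         (norm (\<phi> a))\<^sup>2 \<le> exp (K * (b - a)) * (norm (\<phi> b))\<^sup>2"
proof -
  define f where "f t = (norm (\<phi> t))\<^sup>2" for t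
  define P where "P s t \<longleftrightarrow> f t \<le> exp (K * (t - s)) * f s \<and> f s \<le> exp (K * (t - s)) * f t" for s t
  have f_eq: "f t = (\<phi> t $ 1)\<^sup>2 + (\<phi> t $ 2)\<^sup>2" for t
    by (simp add: f_def norm_vec_def L2_set_def UNIV_2)
  have zone: "P u v" if uv: "u \<le> v" "u \<in> I" "v \<in> I" and e: "e \<in> {1,-1}" 
    and z: "\<And>s. u < s \<Longrightarrow> s < v \<Longrightarrow> e * HH h (\<phi> s) > 0" for u v e
  proof -
    have sub: "{u<..<v} \<subseteq> I" "{u..v} \<subseteq> I" using interval_sub[OF I uv(2,3)] by auto
    have D: "\<exists>d. (f has_real_derivative d) (at r) \<and> \<bar>d\<bar> \<le> K * f r" if r: "u < r" "r < v" for r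
    proof -
      have c: "((\<lambda>t. \<phi> t $ i) has_real_derivative fld \<gamma> e (\<phi> r) $ i) (at r)" for i
        using bounded_linear.has_vector_derivative[OF bounded_linear_vec_nth sol_derivative_zone[OF s sub(1) r e z[OF r]]]
        by (simp add: has_real_derivative_iff_has_vector_derivative)
      let ?x = "\<phi> r $ 1" and ?y = "\<phi> r $ 2"
      define d where "d = 4 * e * \<gamma> * ?x\<^sup>2 + 2 * \<gamma>\<^sup>2 * ?x * ?y"
      have "(f has_real_derivative d) (at r)"
        unfolding f_eq[abs_def] d_def
        by (rule derivative_eq_intros c refl)+ (simp add: fld_def power2_eq_square algebra_simps)
      moreover have "\<bar>d\<bar> \<le> K * f r"
      proof -
        have "\<bar>4 * e * \<gamma> * ?x\<^sup>2\<bar> = 4 * \<gamma> * ?x\<^sup>2" using e g_pos by (auto simp: abs_mult)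
        also have "\<dots> \<le> 4 * \<gamma> * f r" using g_pos by (simp add: f_eq)
        finally have 1: "\<bar>4 * e * \<gamma> * ?x\<^sup>2\<bar> \<le> 4 * \<gamma> * f r" .
        have "\<bar>?x * ?y\<bar> \<le> f r"
        proof -
          have "2 * \<bar>?x * ?y\<bar> \<le> f r"
            using sum_squares_bound[of "\<bar>?x\<bar>" "\<bar>?y\<bar>"] by (simp add: f_eq abs_mult)
          then show ?thesis using abs_ge_zero[of "?x * ?y"] by linarith
        qed
        then have "2 * \<gamma>\<^sup>2 * \<bar>?x * ?y\<bar> \<le> 2 * \<gamma>\<^sup>2 * f r" by (intro mult_left_mono) auto
        then have 2: "\<bar>2 * \<gamma>\<^sup>2 * ?x * ?y\<bar> \<le> 2 * \<gamma>\<^sup>2 * f r" by (simp add: abs_mult)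
        show ?thesis using 1 2 abs_triangle_ineq[of "4 * e * \<gamma> * ?x\<^sup>2" "2 * \<gamma>\<^sup>2 * ?x * ?y"]
          by (simp add: d_def K_def distrib_right)
      qed
      ultimately show ?thesis by blast
    qed
    have cf: "continuous_on {u..v} f"
      unfolding f_def using continuous_on_subset[OF sol_continuous[OF s] sub(2)] by (intro continuous_intros)
    have "exp (- K * v) * f v \<le> exp (- K * u) * f u"
    proof (rule DERIV_nonpos_imp_decreasing_open[OF uv(1)])
      fix r assume r: "u < r" "r < v"
      obtain d where d: "(f has_real_derivative d) (at r)" "\<bar>d\<bar> \<le> K * f r" using D[OF r] by blast
      have "((\<lambda>r. exp (- K * r) * f r) has_real_derivative exp (- K * r) * (d - K * f r)) (at r)"
        by (rule derivative_eq_intros d refl)+ (simp add: algebra_simps)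
      moreover have "exp (- K * r) * (d - K * f r) \<le> 0" using d by (intro mult_nonneg_nonpos) auto
      ultimately show "\<exists>y. ((\<lambda>r. exp (- K * r) * f r) has_real_derivative y) (at r) \<and> y \<le> 0" by blast
    qed (intro continuous_intros cf)
    then have "exp (K * v) * (exp (- K * v) * f v) \<le> exp (K * v) * (exp (- K * u) * f u)" by simp
    then have 1: "f v \<le> exp (K * (v - u)) * f u"
      by (simp add: mult.assoc[symmetric] mult_exp_exp right_diff_distrib)
    have "exp (K * u) * f u \<le> exp (K * v) * f v"
    proof (rule DERIV_nonneg_imp_increasing_open[OF uv(1)])
      fix r assume r: "u < r" "r < v"
      obtain d where d: "(f has_real_derivative d) (at r)" "\<bar>d\<bar> \<le> K * f r" using D[OF r] by blast
      have "((\<lambda>r. exp (K * r) * f r) has_real_derivative exp (K * r) * (d + K * f r)) (at r)"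
        by (rule derivative_eq_intros d refl)+ (simp add: algebra_simps)
      moreover have "exp (K * r) * (d + K * f r) \<ge> 0" using d by (intro mult_nonneg_nonneg) auto
      ultimately show "\<exists>y. ((\<lambda>r. exp (K * r) * f r) has_real_derivative y) (at r) \<and> y \<ge> 0" by blast
    qed (intro continuous_intros cf)
    then have "exp (- K * u) * (exp (K * u) * f u) \<le> exp (- K * u) * (exp (K * v) * f v)" by simp
    then have 2: "f u \<le> exp (K * (v - u)) * f v"
      by (simp add: mult.assoc[symmetric] mult_exp_exp right_diff_distrib)
    show ?thesis using 1 2 by (simp add: P_def)
  qed
  have "P a b"
  proof (rule local_to_global_order[OF I ab])
    show "P t t" for t by (simp add: P_def)
    show "P r t" if "r \<le> s" "s \<le> t" "P r s" "P s t" for r s t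
    proof -
      have m: "exp (K * (t - s)) * exp (K * (s - r)) = exp (K * (t - r))"
        unfolding mult_exp_exp by (simp add: right_diff_distrib)
      have "exp (K * (t - s)) * f s \<le> exp (K * (t - s)) * (exp (K * (s - r)) * f r)"
        by (rule mult_left_mono) (use that in \<open>simp_all add: P_def\<close>)
      also have "\<dots> = exp (K * (t - r)) * f r" unfolding mult.assoc[symmetric] m ..
      finally have 1: "f t \<le> exp (K * (t - r)) * f r" using that(4) by (simp add: P_def)
      have "exp (K * (s - r)) * f s \<le> exp (K * (s - r)) * (exp (K * (t - s)) * f t)"
        by (rule mult_left_mono) (use that in \<open>simp_all add: P_def\<close>)
      also have "\<dots> = exp (K * (t - r)) * f t" unfolding mult.assoc[symmetric] m[symmetric] by (simp add: mult_ac)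
      finally have "f r \<le> exp (K * (t - r)) * f t" using that(3) by (simp add: P_def)
      with 1 show ?thesis by (simp add: P_def)
    qed
    fix t assume t: "t \<in> I"
    obtain d where d: "d > 0" "\<And>s. s \<in> I \<Longrightarrow> t - d < s \<Longrightarrow> s < t \<Longrightarrow> side_before (\<phi> t) * HH h (\<phi> s) > 0"
      "\<And>s. s \<in> I \<Longrightarrow> t < s \<Longrightarrow> s < t + d \<Longrightarrow> side_after (\<phi> t) * HH h (\<phi> s) > 0"
      by (rule local_sides[OF s I t n[OF t]]) (rule that)
    have "P t r" if "r \<in> I" "t < r" "r < t + d" for r
      by (rule zone[OF _ t that(1) sides(2)[OF n[OF t]]], use that in simp, rule d(3))
        (use that interval_sub[OF I t that(1)] in auto)
    moreover have "P r t" if "r \<in> I" "t - d < r" "r < t" for r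
      by (rule zone[OF _ that(1) t sides(1)[OF n[OF t]]], use that in simp, rule d(2))
        (use that interval_sub[OF I that(1) t] in auto)
    ultimately show "\<exists>d>0. (\<forall>s\<in>I. t < s \<and> s < t + d \<longrightarrow> P t s) \<and> (\<forall>s\<in>I. t - d < s \<and> s < t \<longrightarrow> P s t)"
      using d(1) by blast
  qed
  then show ?thesis unfolding P_def f_def .
qed

text \<open>The analysis of crossings is valid only off the origin. So the growth estimate is
  applied on the stretch from a to the zero nearest to a, that zero excluded, and is then extended
  to it by continuity, where it fails.\<close>

lemma sol_nonzero:
  assumes s: "sol I \<phi>" and I: "is_interval I" and a: "a \<in> I" "\<phi> a \<noteq> 0" and b: "b \<in> I"
  shows "\<phi> b \<noteq> 0"
proof
  assume b0: "\<phi> b = 0"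
  define K where "K = 4 * \<gamma> + 2 * \<gamma>\<^sup>2"
  define g where "g t = exp (K * \<bar>t - a\<bar>) * (norm (\<phi> t))\<^sup>2 - (norm (\<phi> a))\<^sup>2" for t
  have cg: "continuous_on I g" unfolding g_def using sol_continuous[OF s] by (intro continuous_intros)
  have ga: "g t \<ge> 0" if J: "is_interval J" "J \<subseteq> I" "a \<in> J" "t \<in> J" "\<And>t. t \<in> J \<Longrightarrow> \<phi> t \<noteq> 0" for J t
  proof (cases "a \<le> t")
    case True
    then show ?thesis
      using sol_norm_growth[OF solution_on_subset[OF s J(2)] J(1) J(5) J(3,4) True] by (simp add: g_def K_def)
  next
    case False
    then show ?thesis
      using sol_norm_growth[OF solution_on_subset[OF s J(2)] J(1) J(5) J(4,3)] by (simp add: g_def K_def)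
  qed
  have ab: "a \<noteq> b" using a b0 by auto
  define S where "S = closed_segment a b"
  have S: "S \<subseteq> I" unfolding S_def using a b I interval_sub[OF I, of a b] interval_sub[OF I, of b a]
    by (auto simp: closed_segment_eq_real_ivl)
  let ?Z = "{t \<in> S. \<phi> t = 0}"
  have "closed ?Z"
    using continuous_closed_preimage_constant[of S \<phi> 0] continuous_on_subset[OF sol_continuous[OF s] S]
    by (simp add: S_def)
  moreover have "?Z \<noteq> {}" using b0 by (auto simp: S_def)
  ultimately obtain m where m: "m \<in> ?Z" "\<And>t. t \<in> ?Z \<Longrightarrow> dist a m \<le> dist a t"
    using distance_attains_inf[of ?Z a] by blast
  then have am: "a \<noteq> m" using a by auto
  define J where "J = open_segment a m \<union> {a}"
  have Jn: "\<phi> t \<noteq> 0" if "t \<in> J" for t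
  proof
    assume "\<phi> t = 0"
    moreover have "t \<in> S" "dist a t < dist a m" using that m(1) am ab
      by (auto simp: J_def S_def open_segment_eq_real_ivl closed_segment_eq_real_ivl dist_real_def split: if_splits)
    ultimately show False using m(2)[of t] by auto
  qed
  have Jint: "is_interval J" using am by (auto simp: J_def is_interval_1 open_segment_eq_real_ivl split: if_splits)
  have "J \<subseteq> S" using m(1) by (auto simp: J_def S_def open_segment_eq_real_ivl closed_segment_eq_real_ivl split: if_splits)
  then have JI: "J \<subseteq> I" using S by blast
  have cl: "closed_segment a m \<subseteq> I" using m(1) S by (auto simp: S_def closed_segment_eq_real_ivl split: if_splits)
  have pos: "g t \<ge> 0" if "t \<in> open_segment a m" for t
    using ga[OF Jint JI _ _ Jn] that by (auto simp: J_def)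
  have "closure (open_segment a m) = closed_segment a m" using am by (simp add: closure_open_segment)
  then have "g m \<ge> 0"
    using continuous_ge_on_closure[of "open_segment a m" g m 0] continuous_on_subset[OF cg cl] pos by simp
  moreover have "g m < 0" using m(1) a by (simp add: g_def)
  ultimately show False by simp
qed

end

section \<open>Rotation around the origin\<close>

text \<open>Near r the quotient \<open>\<zeta> s / \<zeta> r\<close> is close to 1, so its principal
  logarithm is differentiable and equals g s - g r by continuity of g.\<close>

lemma has_real_derivative_continuous_angle:
  fixes g \<zeta> :: "real \<Rightarrow> complex"
  assumes g: "isCont g r" and ev: "\<forall>\<^sub>F s in nhds r. \<zeta> s = exp (g s)"
    and d: "(\<zeta> has_vector_derivative \<zeta>') (at r)"
  shows "((\<lambda>s. Im (g s)) has_real_derivative Im (\<zeta>' / \<zeta> r)) (at r)"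
proof -
  have zr: "\<zeta> r = exp (g r)" using ev by (rule eventually_nhds_x_imp_x)
  have "((\<lambda>s. \<zeta> s / \<zeta> r) has_vector_derivative \<zeta>' / \<zeta> r) (at r)"
    using has_vector_derivative_mult_left[OF d, of "inverse (\<zeta> r)"] by (simp add: divide_inverse)
  moreover have "(Ln has_field_derivative inverse (\<zeta> r / \<zeta> r)) (at (\<zeta> r / \<zeta> r))"
    by (rule has_field_derivative_Ln) (simp add: zr)
  ultimately have "(Ln \<circ> (\<lambda>s. \<zeta> s / \<zeta> r) has_vector_derivative \<zeta>' / \<zeta> r * inverse (\<zeta> r / \<zeta> r)) (at r)"
    by (rule field_vector_diff_chain_at)
  then have "((\<lambda>s. Ln (\<zeta> s / \<zeta> r)) has_vector_derivative \<zeta>' / \<zeta> r) (at r)"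
    by (simp add: o_def zr)
  from bounded_linear.has_vector_derivative[OF bounded_linear_Im this]
  have "((\<lambda>s. Im (Ln (\<zeta> s / \<zeta> r))) has_real_derivative Im (\<zeta>' / \<zeta> r)) (at r)"
    unfolding has_real_derivative_iff_has_vector_derivative .
  from DERIV_add[OF DERIV_const[of "Im (g r)"] this]
  have D: "((\<lambda>s. Im (g r) + Im (Ln (\<zeta> s / \<zeta> r))) has_real_derivative Im (\<zeta>' / \<zeta> r)) (at r)"
    by simp
  have "((\<lambda>s. Im (g s - g r)) \<longlongrightarrow> 0) (nhds r)"
  proof -
    have "isCont (\<lambda>s. Im (g s - g r)) r" using g by (intro isCont_Im isCont_diff continuous_const)
    then show ?thesis using tendsto_at_iff_tendsto_nhds[of "\<lambda>s. Im (g s - g r)" r] by (simp add: isCont_def)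
  qed
  then have "\<forall>\<^sub>F s in nhds r. Im (g s - g r) \<in> {-pi<..<pi}"
    by (rule topological_tendstoD) auto
  then have eq: "\<forall>\<^sub>F s in nhds r. Im (g s) = Im (g r) + Im (Ln (\<zeta> s / \<zeta> r))"
    using ev
  proof eventually_elim
    case (elim s)
    have "\<zeta> s / \<zeta> r = exp (g s - g r)" using elim zr by (simp add: exp_diff)
    then have "Ln (\<zeta> s / \<zeta> r) = g s - g r" using Ln_exp[of "g s - g r"] elim by simp
    then show ?case by simp
  qed
  show ?thesis by (rule iffD2[OF DERIV_cong_ev[OF refl eq refl] D])
qed

context two_zone
begin

text \<open>In zone e the angular speed is \<open>qf\<close> divided by the squared norm, which
  \<open>norm_zc_bounds\<close> bounds below by \<delta> in both zones. The bound passes through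
  crossings by \<open>local_to_global_order\<close>, so every solution turns counterclockwise
  forever.\<close>

lemma sol_angle:
  assumes s: "sol {0..} \<phi>" and n: "\<And>t. t \<ge> 0 \<Longrightarrow> \<phi> t \<noteq> 0"
  obtains \<theta> :: "real \<Rightarrow> real" and \<delta> where "continuous_on {0..} \<theta>"
    "\<And>t. t \<ge> 0 \<Longrightarrow> \<phi> t = norm (\<phi> t) *\<^sub>R vector [cos (\<theta> t), sin (\<theta> t)]"
    "\<delta> > 0" "\<And>s t. 0 \<le> s \<Longrightarrow> s \<le> t \<Longrightarrow> \<delta> * (t - s) \<le> \<theta> t - \<theta> s"
proof -
  define \<zeta> where "\<zeta> t = Complex (\<phi> t $ 1) (\<phi> t $ 2)" for t
  have bl: "bounded_linear (\<lambda>X :: real^2. Complex (X $ 1) (X $ 2))"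
    by (intro linear_conv_bounded_linear[THEN iffD1] linearI) (auto simp: complex_eq_iff algebra_simps)
  have nz: "norm (\<zeta> t) = norm (\<phi> t)" for t
    by (simp add: \<zeta>_def norm_vec_def L2_set_def UNIV_2 cmod_def)
  have c1: "continuous_on {0..} \<zeta>"
    unfolding \<zeta>_def by (rule linear_continuous_on_compose[OF sol_continuous[OF s] bounded_linear.linear[OF bl]])
  have c2: "contractible {0::real..}" by (simp add: convex_imp_contractible)
  have c3: "\<zeta> t \<noteq> 0" if "t \<in> {0..}" for t using n[of t] nz[of t] that by auto
  obtain g where g: "continuous_on {0..} g" "\<And>t. t \<in> {0..} \<Longrightarrow> \<zeta> t = exp (g t)"
    by (rule continuous_logarithm_on_contractible[OF c1 c2 c3], assumption) (rule that)
  define \<theta> where "\<theta> t = Im (g t)" for t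
  define \<delta> where "\<delta> = 1 / (2 + \<gamma>)\<^sup>2"
  have c\<theta>: "continuous_on {0..} \<theta>" unfolding \<theta>_def using g(1) by (intro continuous_intros)
  have polar: "\<phi> t = norm (\<phi> t) *\<^sub>R vector [cos (\<theta> t), sin (\<theta> t)]" if "t \<ge> 0" for t
  proof -
    have "norm (\<phi> t) = exp (Re (g t))" using g(2)[of t] that nz[of t] by simp
    moreover have "\<phi> t $ 1 = Re (\<zeta> t)" "\<phi> t $ 2 = Im (\<zeta> t)" by (simp_all add: \<zeta>_def)
    ultimately show ?thesis using g(2)[of t] that by (simp add: vec_eq_iff forall_2 Re_exp Im_exp \<theta>_def)
  qed
  have zone: "\<delta> * (v - u) \<le> \<theta> v - \<theta> u" if uv: "0 \<le> u" "u \<le> v" and e: "e \<in> {1,-1}" 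
    and z: "\<And>s. u < s \<Longrightarrow> s < v \<Longrightarrow> e * HH h (\<phi> s) > 0" for u v e
  proof -
    have "\<theta> u - \<delta> * u \<le> \<theta> v - \<delta> * v"
    proof (rule DERIV_nonneg_imp_increasing_open[OF uv(2)])
      fix r assume r: "u < r" "r < v"
      have r0: "r > 0" using r uv by simp
      have dz: "(\<zeta> has_vector_derivative Complex (fld \<gamma> e (\<phi> r) $ 1) (fld \<gamma> e (\<phi> r) $ 2)) (at r)"
        unfolding \<zeta>_def
        by (rule bounded_linear.has_vector_derivative[OF bl sol_derivative_zone[OF s _ r e z[OF r]]]) (use uv in auto)
      have gr: "isCont g r" using g(1) r0 by (simp add: continuous_on_interior)
      have ev: "\<forall>\<^sub>F s in nhds r. \<zeta> s = exp (g s)"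
        using eventually_nhds_in_open[of "{0<..}" r] r0 g(2) by (auto elim!: eventually_mono)
      let ?d = "Im (Complex (fld \<gamma> e (\<phi> r) $ 1) (fld \<gamma> e (\<phi> r) $ 2) / \<zeta> r)"
      have D: "(\<theta> has_real_derivative ?d) (at r)"
        unfolding \<theta>_def by (rule has_real_derivative_continuous_angle[OF gr ev dz])
      have "?d = qf \<gamma> e (\<phi> r) / (norm (\<phi> r))\<^sup>2"
        unfolding nz[symmetric] complex_div_cnj[of _ "\<zeta> r"] of_real_power[symmetric] Im_divide_of_real
        by (simp add: \<zeta>_def fld_def qf_def power2_eq_square algebra_simps)
      moreover have "\<delta> * (norm (\<phi> r))\<^sup>2 \<le> qf \<gamma> e (\<phi> r)"
      proof -
        have "(norm (\<phi> r))\<^sup>2 \<le> ((2 + \<gamma>) * cmod (zc \<gamma> e (\<phi> r)))\<^sup>2"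
          using norm_zc_bounds(2)[OF g_pos e, of "\<phi> r"] by (intro power_mono) auto
        then have "(norm (\<phi> r))\<^sup>2 \<le> qf \<gamma> e (\<phi> r) * (2 + \<gamma>)\<^sup>2"
          unfolding power_mult_distrib norm_zc_square[OF e] by (simp only: mult.commute)
        moreover have "(2 + \<gamma>)\<^sup>2 > 0" using g_pos by simp
        ultimately show ?thesis by (simp add: \<delta>_def pos_divide_le_eq)
      qed
      moreover have "(norm (\<phi> r))\<^sup>2 > 0" using n[of r] r0 by simp
      ultimately have "?d \<ge> \<delta>" by (simp only: pos_le_divide_eq)
      moreover have "((\<lambda>t. \<theta> t - \<delta> * t) has_real_derivative ?d - \<delta>) (at r)"
        by (rule derivative_eq_intros D refl)+ simp
      ultimately show "\<exists>y. ((\<lambda>t. \<theta> t - \<delta> * t) has_real_derivative y) (at r) \<and> 0 \<le> y"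
        by (intro exI[of _ "?d - \<delta>"]) simp
    next
      show "continuous_on {u..v} (\<lambda>t. \<theta> t - \<delta> * t)"
        using continuous_on_subset[OF c\<theta>, of "{u..v}"] uv by (intro continuous_intros) auto
    qed
    then show ?thesis by (simp add: right_diff_distrib)
  qed
  have I: "is_interval {0::real..}" by simp
  have mono: "\<delta> * (t - r) \<le> \<theta> t - \<theta> r" if "0 \<le> r" "r \<le> t" for r t
  proof (rule local_to_global_order[OF I, of r t "\<lambda>r t. \<delta> * (t - r) \<le> \<theta> t - \<theta> r"])
    show "\<delta> * (t - r) \<le> \<theta> t - \<theta> r" if "\<delta> * (s - r) \<le> \<theta> s - \<theta> r" "\<delta> * (t - s) \<le> \<theta> t - \<theta> s" for r s t
      using that by (simp add: right_diff_distrib)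
    fix t :: real assume t: "t \<in> {0..}"
    then have nt: "\<phi> t \<noteq> 0" using n by simp
    obtain d where d: "d > 0" "\<And>s. s \<in> {0..} \<Longrightarrow> t - d < s \<Longrightarrow> s < t \<Longrightarrow> side_before (\<phi> t) * HH h (\<phi> s) > 0"
      "\<And>s. s \<in> {0..} \<Longrightarrow> t < s \<Longrightarrow> s < t + d \<Longrightarrow> side_after (\<phi> t) * HH h (\<phi> s) > 0"
      by (rule local_sides[OF s I t nt]) (rule that)
    have "\<delta> * (r - t) \<le> \<theta> r - \<theta> t" if "r \<in> {0..}" "t < r" "r < t + d" for r
      by (rule zone[OF _ _ sides(2)[OF nt]], use that t in simp, use that in simp, rule d(3))
        (use that t in auto)
    moreover have "\<delta> * (t - r) \<le> \<theta> t - \<theta> r" if "r \<in> {0..}" "t - d < r" "r < t" for r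
      by (rule zone[OF _ _ sides(1)[OF nt]], use that t in simp, use that in simp, rule d(2))
        (use that t in auto)
    ultimately show "\<exists>d>0. (\<forall>s\<in>{0..}. t < s \<and> s < t + d \<longrightarrow> \<delta> * (s - t) \<le> \<theta> s - \<theta> t) \<and> 
        (\<forall>s\<in>{0..}. t - d < s \<and> s < t \<longrightarrow> \<delta> * (t - s) \<le> \<theta> t - \<theta> s)"
      using d(1) by blast
  qed (use that in auto)
  show thesis
    by (rule that[OF c\<theta> polar _ mono]) (use g_pos in \<open>auto simp: \<delta>_def\<close>)
qed

lemma angle_at_top:
  fixes \<theta> :: "real \<Rightarrow> real"
  assumes "\<delta> > 0" "\<And>s t. 0 \<le> s \<Longrightarrow> s \<le> t \<Longrightarrow> \<delta> * (t - s) \<le> \<theta> t - \<theta> s"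
  shows "filterlim \<theta> at_top at_top"
proof (rule filterlim_at_top_mono)
  show "filterlim (\<lambda>t. \<theta> 0 + \<delta> * t) at_top at_top"
    by (intro filterlim_tendsto_add_at_top[OF tendsto_const] filterlim_tendsto_pos_mult_at_top[OF tendsto_const] assms(1) filterlim_ident)
  show "\<forall>\<^sub>F t in at_top. \<theta> 0 + \<delta> * t \<le> \<theta> t"
    using eventually_ge_at_top[of 0]
  proof eventually_elim
    case (elim t)
    then show ?case using assms(2)[of 0 t] by simp
  qed
qed

lemma angle_attains:
  fixes \<theta> :: "real \<Rightarrow> real"
  assumes c: "continuous_on {0..} \<theta>" and d: "\<delta> > 0" "\<And>s t. 0 \<le> s \<Longrightarrow> s \<le> t \<Longrightarrow> \<delta> * (t - s) \<le> \<theta> t - \<theta> s"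
    and T: "0 \<le> T" "\<theta> T \<le> a"
  obtains t where "T \<le> t" "\<theta> t = a"
proof -
  obtain S where S: "\<And>t. t \<ge> S \<Longrightarrow> \<theta> t \<ge> a"
    using angle_at_top[OF d] unfolding filterlim_at_top eventually_at_top_linorder by blast
  have "\<exists>t. T \<le> t \<and> t \<le> max S T \<and> \<theta> t = a"
    by (rule IVT') (use S[of "max S T"] T continuous_on_subset[OF c, of "{T..max S T}"] in auto)
  then show thesis using that by blast
qed

text \<open>On the x-axis \<open>HH\<close> is the first coordinate. Hence during a half turn from
  angle 2 pi m to 2 pi m + pi it changes from positive to negative, and a zero in between lies in
  the upper half-plane.\<close>

lemma late_upper_crossing:
  assumes s: "sol {0..} \<phi>" and n: "\<And>t. t \<ge> 0 \<Longrightarrow> \<phi> t \<noteq> 0"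
  obtains t where "t > T" "t > 0" "HH h (\<phi> t) = 0" "\<phi> t $ 2 > 0"
proof -
  obtain \<theta> \<delta> where \<theta>: "continuous_on {0..} \<theta>"
    "\<And>t. t \<ge> 0 \<Longrightarrow> \<phi> t = norm (\<phi> t) *\<^sub>R vector [cos (\<theta> t), sin (\<theta> t)]"
    "\<delta> > 0" "\<And>s t. 0 \<le> s \<Longrightarrow> s \<le> t \<Longrightarrow> \<delta> * (t - s) \<le> \<theta> t - \<theta> s"
    by (rule sol_angle[OF s n], assumption) (rule that)
  have strict: "\<theta> u < \<theta> v" if "0 \<le> u" "u < v" for u v
    using \<theta>(4)[of u v] that mult_pos_pos[OF \<theta>(3), of "v - u"] by linarith
  define T' where "T' = max T 0"
  obtain m :: nat where m: "\<theta> T' / (2 * pi) < real m" using reals_Archimedean2 by blast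
  define a where "a = 2 * pi * real m"
  have Ta: "\<theta> T' < a" using m by (simp add: a_def field_simps)
  obtain t1 where t1: "T' \<le> t1" "\<theta> t1 = a"
    by (rule angle_attains[OF \<theta>(1,3,4), of T' a]) (use Ta in \<open>auto simp: T'_def intro: that\<close>)
  have T1: "T' < t1" using t1 Ta by (cases "T' = t1") auto
  obtain t2 where t2: "t1 \<le> t2" "\<theta> t2 = a + pi"
    by (rule angle_attains[OF \<theta>(1,3,4), of t1 "a + pi"]) (use t1 in \<open>auto simp: T'_def intro: that\<close>)
  have t10: "t1 \<ge> 0" using t1 by (simp add: T'_def)
  have ca: "cos a = 1" "sin a = 0" unfolding a_def by (metis cos_2npi mult.assoc mult.commute, metis sin_2npi mult.assoc mult.commute)
  have p1: "\<phi> t1 $ 1 = norm (\<phi> t1)" "\<phi> t1 $ 2 = 0" using arg_cong[OF \<theta>(2)[OF t10], of "\<lambda>X. X $ 1"]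
    arg_cong[OF \<theta>(2)[OF t10], of "\<lambda>X. X $ 2"] t1 ca by simp_all
  have t20: "t2 \<ge> 0" using t10 t2 by simp
  have p2: "\<phi> t2 $ 1 = - norm (\<phi> t2)" "\<phi> t2 $ 2 = 0" using arg_cong[OF \<theta>(2)[OF t20], of "\<lambda>X. X $ 1"]
    arg_cong[OF \<theta>(2)[OF t20], of "\<lambda>X. X $ 2"] t2 ca by (simp_all add: cos_add sin_add)
  have H1: "HH h (\<phi> t1) > 0" and H2: "HH h (\<phi> t2) < 0"
    using p1 p2 n[OF t10] n[OF t20] by (auto simp: HH_def)
  have "\<exists>t. t1 \<le> t \<and> t \<le> t2 \<and> HH h (\<phi> t) = 0"
    by (rule IVT2') (use H1 H2 t2 t10 continuous_on_subset[OF HH_sol_continuous[OF s], of "{t1..t2}"] in auto)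
  then obtain t where t: "t1 \<le> t" "t \<le> t2" "HH h (\<phi> t) = 0" by blast
  have "t1 < t" "t < t2" using t H1 H2 by (auto simp: less_le)
  then have "a < \<theta> t" "\<theta> t < a + pi" using strict[of t1 t] strict[of t t2] t10 t1 t2 by auto
  then have "sin (\<theta> t - a) > 0" by (intro sin_gt_zero) auto
  then have "sin (\<theta> t) > 0" using ca by (simp add: sin_diff)
  moreover have "\<phi> t $ 2 = norm (\<phi> t) * sin (\<theta> t)" using arg_cong[OF \<theta>(2)[of t], of "\<lambda>X. X $ 2"] t t10 by simp
  ultimately have "\<phi> t $ 2 > 0" using n[of t] t t10 by simp
  moreover have "t > T" "t > 0" using \<open>t1 < t\<close> T1 by (auto simp: T'_def)
  ultimately show thesis using that t by blast
qed

section \<open>Convergence to an attracting level\<close>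

definition between :: "real \<Rightarrow> real \<Rightarrow> real \<Rightarrow> bool" where
  "between k b b' \<longleftrightarrow> k \<le> b' \<and> b' \<le> b \<or> b \<le> b' \<and> b' \<le> k"

text \<open>The case k = 0 stands for the origin and is exempt from h k = 0. The last clause says
  that h has the sign of y - k in the band, so crossings push the amplitude towards k. The clause on
  \<open>sig\<close> makes heights and amplitudes enter J together.\<close>

definition attracting_band :: "real \<Rightarrow> real set \<Rightarrow> bool" where
  "attracting_band k J \<longleftrightarrow> is_interval J \<and> k \<in> J \<and> 0 \<le> k \<and> (k > 0 \<longrightarrow> h k = 0) \<and>
     (\<forall>y>0. \<forall>e\<in>{1, -1}. sig e y \<in> J \<longleftrightarrow> y \<in> J) \<and>
     (\<forall>y>0. y \<in> J \<longrightarrow> y \<noteq> k \<longrightarrow> h y * (y - k) > 0)"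

text \<open>The sign of h gives the direction of the jump, and \<open>sig_level\<close> keeps it
  from passing k.\<close>

lemma band_jump:
  assumes J: "attracting_band k J" and y: "y > 0" "y \<in> J"
  shows "between k (sig 1 y) (sig (-1) y)" "y \<noteq> k \<Longrightarrow> \<bar>sig (-1) y - k\<bar> < \<bar>sig 1 y - k\<bar>"
proof -
  have k: "0 \<le> k" "k > 0 \<Longrightarrow> h k = 0" using J by (auto simp: attracting_band_def)
  have "between k (sig 1 y) (sig (-1) y) \<and> (y \<noteq> k \<longrightarrow> \<bar>sig (-1) y - k\<bar> < \<bar>sig 1 y - k\<bar>)"
  proof (cases y k rule: linorder_cases)
    case less
    then have k0: "k > 0" using y by simp
    have "h y * (y - k) > 0" using J y less by (auto simp: attracting_band_def)
    then have "h y < 0" using less by (simp add: zero_less_mult_iff)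
    then have "sig 1 y < sig (-1) y" using sig_compare[OF y(1)] by simp
    moreover have "sig (-1) y < k" using sig_level[OF _ y(1) k0 k(2)[OF k0], of "-1"] less by simp
    ultimately show ?thesis by (simp add: between_def)
  next
    case equal
    then show ?thesis using sig_fix[of 1 y] sig_fix[of "-1" y] y k by (simp add: between_def)
  next
    case greater
    have "h y * (y - k) > 0" using J y greater by (auto simp: attracting_band_def)
    then have "h y > 0" using greater by (simp add: zero_less_mult_iff)
    then have "sig (-1) y < sig 1 y" using sig_compare[OF y(1)] by simp
    moreover have "k < sig (-1) y"
      using sig_level[OF _ y(1) _ k(2), of "-1"] greater sig_pos[of "-1" y] k by (cases "k = 0") auto
    ultimately show ?thesis by (simp add: between_def)
  qed
  then show "between k (sig 1 y) (sig (-1) y)" "y \<noteq> k \<Longrightarrow> \<bar>sig (-1) y - k\<bar> < \<bar>sig 1 y - k\<bar>" by auto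
qed

lemma sig_linear_bounds:
  obtains M where "M > 0" "\<And>y. y > 0 \<Longrightarrow> sig 1 y \<le> M * y" "\<And>y. y > 0 \<Longrightarrow> y \<le> M * sig 1 y"
proof -
  obtain M where M: "M > 0" "\<And>e X. e \<in> {1,-1} \<Longrightarrow> X \<noteq> 0 \<Longrightarrow> amp \<gamma> e X \<le> M * norm X"
    "\<And>e X. e \<in> {1,-1} \<Longrightarrow> X \<noteq> 0 \<Longrightarrow> norm X \<le> M * amp \<gamma> e X"
    by (rule amp_norm_bounds[OF g_pos]) (rule that)
  obtain C where C: "\<And>y. y > 0 \<Longrightarrow> \<bar>h y\<bar> \<le> C * y" using h_linear_bound by blast
  have C0: "C \<ge> 0" using C[of 1] by simp
  have 1: "sig 1 y \<le> (M * (C + 1)) * y" if "y > 0" for y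
  proof -
    have "norm (vector [h y, y] :: real^2) \<le> \<bar>h y\<bar> + \<bar>y\<bar>"
      using norm_le_l1_cart[of "vector [h y, y] :: real^2"] by (simp add: UNIV_2)
    also have "\<dots> \<le> (C + 1) * y" using C[OF that] that by (simp add: algebra_simps)
    finally have "M * norm (vector [h y, y] :: real^2) \<le> M * ((C + 1) * y)" using M(1) by simp
    moreover have "sig 1 y \<le> M * norm (vector [h y, y] :: real^2)"
      unfolding sig_def by (rule M(2)) (use that in \<open>auto simp: vec2_eq_0\<close>)
    ultimately show ?thesis by (simp add: mult.assoc)
  qed
  have 2: "y \<le> (M * (C + 1)) * sig 1 y" if "y > 0" for y
  proof -
    have "y \<le> norm (vector [h y, y] :: real^2)"
      using component_le_norm_cart[of "vector [h y, y] :: real^2" 2] that by simp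
    also have "\<dots> \<le> M * sig 1 y" unfolding sig_def by (rule M(3)) (use that in \<open>auto simp: vec2_eq_0\<close>)
    also have "\<dots> \<le> (M * (C + 1)) * sig 1 y"
      using M(1) C0 sig_pos[of 1 y] by (intro mult_right_mono) (auto simp: algebra_simps)
    finally show ?thesis .
  qed
  show thesis by (rule that[OF _ 1 2]) (use M(1) C0 in auto)
qed

lemma BB_before_upper:
  assumes s: "sol {0..} \<phi>" and n: "\<phi> t \<noteq> 0" and t: "0 \<le> T" "T < t" and u: "HH h (\<phi> t) = 0" "\<phi> t $ 2 > 0"
  obtains s where "T < s" "s < t" "BB (\<phi> s) = sig 1 (\<phi> t $ 2)" "BB (\<phi> t) = sig (-1) (\<phi> t $ 2)"
proof -
  have p: "\<phi> t = vector [h (\<phi> t $ 2), \<phi> t $ 2]" using u by (auto simp: vec2_eq HH_def)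
  have a: "amp \<gamma> e (\<phi> t) = sig e (\<phi> t $ 2)" for e unfolding sig_def by (rule arg_cong[OF p])
  have I: "is_interval {0::real..}" by simp
  have t0: "t \<in> {0..}" using t by simp
  obtain d where d: "d > 0" "\<And>s. s \<in> {0..} \<Longrightarrow> t - d < s \<Longrightarrow> s < t \<Longrightarrow> BB (\<phi> s) = amp \<gamma> (side_before (\<phi> t)) (\<phi> t)"
    "\<And>s. s \<in> {0..} \<Longrightarrow> t < s \<Longrightarrow> s < t + d \<Longrightarrow> BB (\<phi> s) = BB (\<phi> t)"
    by (rule local_BB[OF s I t0 n]) (rule that)
  define s' where "s' = max ((T + t) / 2) (t - d / 2)"
  have s': "T < s'" "s' < t" "t - d < s'" using t d(1) unfolding s'_def less_max_iff_disj max_less_iff_conj by auto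
  have "BB (\<phi> s') = sig 1 (\<phi> t $ 2)" using d(2)[of s'] s' t u by (simp add: side_before_def a)
  moreover have "BB (\<phi> t) = sig (-1) (\<phi> t $ 2)" using u by (simp add: BB_def a)
  ultimately show thesis using that s' by blast
qed

text \<open>The distance m from k never increases. If its infimum \<mu> were positive, every upper
  crossing at a positive time would decrease it by at least the minimum of f over the compact set K.
  Once m is below \<mu> plus this minimum, the next upper crossing brings it below \<mu>.\<close>

lemma BB_converges:
  assumes s: "sol {0..} \<phi>" and n: "\<And>t. t \<ge> 0 \<Longrightarrow> \<phi> t \<noteq> 0"
    and J: "attracting_band k J" and start: "BB (\<phi> 0) \<in> J"
  shows "((\<lambda>t. BB (\<phi> t)) \<longlongrightarrow> k) at_top"
proof -
  have k: "0 \<le> k" "k \<in> J" "is_interval J" using J by (auto simp: attracting_band_def)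
  have inv: "sig e y \<in> J \<longleftrightarrow> y \<in> J" if "y > 0" "e \<in> {1,-1}" for e y
    using J that by (auto simp: attracting_band_def)
  \<comment> \<open>The guard b \<in> J makes the jump condition, which is demanded at all heights,
    vacuous outside the band.\<close>
  define R where "R b b' \<longleftrightarrow> (b \<in> J \<longrightarrow> b' \<in> J \<and> between k b b')" for b b'
  have R: "R (BB (\<phi> a)) (BB (\<phi> b))" if "0 \<le> a" "a \<le> b" for a b
  proof (rule BB_monotone_relation[OF s])
    show "R b b" for b by (auto simp: R_def between_def)
    show "R a c" if "R a b" "R b c" for a b c using that by (auto simp: R_def between_def)
    show "R (sig 1 y) (sig (-1) y)" if "y > 0" for y
      using band_jump(1)[OF J that] inv[OF that, of 1] inv[OF that, of "-1"] by (simp add: R_def)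
  qed (use that n in auto)
  have BJ: "BB (\<phi> t) \<in> J" "between k (BB (\<phi> 0)) (BB (\<phi> t))" if "t \<ge> 0" for t
    using R[of 0 t] start that by (auto simp: R_def)
  define m where "m t = \<bar>BB (\<phi> t) - k\<bar>" for t
  have anti: "m t \<le> m s" if "0 \<le> s" "s \<le> t" for s t
    using R[OF that] BJ(1)[OF that(1)] by (auto simp: R_def between_def m_def)
  define \<mu> where "\<mu> = Inf (m ` {0..})"
  have bb: "bdd_below (m ` {0..})" by (rule bdd_belowI[of _ 0]) (auto simp: m_def)
  have \<mu>_le: "\<mu> \<le> m t" if "t \<ge> 0" for t unfolding \<mu>_def by (rule cInf_lower[OF _ bb]) (use that in auto)
  have \<mu>_ex: "\<exists>t\<ge>0. m t < \<mu> + \<eta>" if "\<eta> > 0" for \<eta>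
    using cInf_lessD[of "m ` {0..}" "\<mu> + \<eta>"] that unfolding \<mu>_def by auto
  have \<mu>0: "\<mu> \<ge> 0" unfolding \<mu>_def by (rule cInf_greatest) (auto simp: m_def)
  have "\<mu> = 0"
  proof (rule ccontr)
    assume "\<mu> \<noteq> 0"
    then have \<mu>: "\<mu> > 0" using \<mu>0 by simp
    define f where "f y = \<bar>sig 1 y - k\<bar> - \<bar>sig (-1) y - k\<bar>" for y
    obtain M where M: "M > 0" "\<And>y. y > 0 \<Longrightarrow> sig 1 y \<le> M * y" "\<And>y. y > 0 \<Longrightarrow> y \<le> M * sig 1 y"
      by (rule sig_linear_bounds) (rule that)
    \<comment> \<open>Amplitudes just before a crossing lie between min \<mu> (BB (\<phi> 0)) and
      max k (BB (\<phi> 0)); \<open>sig_linear_bounds\<close> turns this into bounds for the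
      heights.\<close>
    define lo where "lo = min \<mu> (BB (\<phi> 0)) / M"
    define hi where "hi = M * max k (BB (\<phi> 0))"
    have lo: "lo > 0" using \<mu> BB_pos M(1) by (simp add: lo_def)
    \<comment> \<open>All heights of crossings lie in a compact set on which each crossing brings the amplitude closer
      to \<open>k\<close> by at least a fixed amount.\<close>
    define K where "K = {lo..hi} \<inter> {y \<in> {lo..hi}. sig 1 y \<in> closed_segment k (BB (\<phi> 0)) - ball k \<mu>}"
    have c: "continuous_on {lo..hi} (sig e)" if "e \<in> {1,-1}" for e
      by (rule continuous_on_subset[OF sig_continuous[OF that]]) (use lo in auto)
    have "closed {y \<in> {lo..hi}. sig 1 y \<in> closed_segment k (BB (\<phi> 0)) - ball k \<mu>}"
      using continuous_closed_preimage[OF c[of 1], of "closed_segment k (BB (\<phi> 0)) - ball k \<mu>"]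
      by (simp add: closed_Diff vimage_def Int_def)
    then have K: "compact K" unfolding K_def by (intro compact_Int_closed) auto
    have KI: "t > 0 \<Longrightarrow> y > 0 \<Longrightarrow> BB (\<phi> t) = sig 1 y \<Longrightarrow> y \<in> K" for t y
    proof -
      assume a: "t > 0" "y > 0" "BB (\<phi> t) = sig 1 y"
      have b: "between k (BB (\<phi> 0)) (sig 1 y)" "\<mu> \<le> \<bar>sig 1 y - k\<bar>"
        using BJ(2)[of t] \<mu>_le[of t] a by (auto simp: m_def)
      then have seg: "sig 1 y \<in> closed_segment k (BB (\<phi> 0)) - ball k \<mu>"
        by (auto simp: between_def closed_segment_eq_real_ivl dist_real_def)
      have "min \<mu> (BB (\<phi> 0)) \<le> sig 1 y" "sig 1 y \<le> max k (BB (\<phi> 0))"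
        using b k by (auto simp: between_def abs_if split: if_splits)
      then have "lo * M \<le> M * y" "y \<le> hi"
        using M(2)[OF a(2)] M(3)[OF a(2)] M(1) mult_left_mono[of "sig 1 y" "max k (BB (\<phi> 0))" M]
        unfolding lo_def hi_def by (simp, linarith)
      then have "lo \<le> y" "y \<le> hi" using M(1) by (auto simp: mult.commute)
      then show "y \<in> K" using seg by (simp add: K_def)
    qed
    have fpos: "f y > 0" if "y \<in> K" for y
    proof -
      have y: "y > 0" "sig 1 y \<in> closed_segment k (BB (\<phi> 0))" "\<mu> \<le> dist k (sig 1 y)" 
        using that lo by (auto simp: K_def)
      have "closed_segment k (BB (\<phi> 0)) \<subseteq> J"
        using k start by (simp add: closed_segment_subset is_interval_convex)
      then have "y \<in> J" using y inv[OF y(1), of 1] by auto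
      moreover have "y \<noteq> k" using y \<mu> sig_fix[of 1 y] J by (auto simp: attracting_band_def)
      ultimately show ?thesis using band_jump(2)[OF J y(1)] by (simp add: f_def)
    qed
    have fc: "continuous_on K f" unfolding f_def
      by (intro continuous_intros continuous_on_subset[OF c]) (auto simp: K_def)
    have upper: "\<exists>s y. T < s \<and> 0 < y \<and> BB (\<phi> s) = sig 1 y \<and> (\<exists>t>s. BB (\<phi> t) = sig (-1) y)" if T0: "T \<ge> 0" for T
    proof -
      obtain t where t: "t > T" "t > 0" "HH h (\<phi> t) = 0" "\<phi> t $ 2 > 0"
        by (rule late_upper_crossing[OF s n, of T]) (auto intro: that)
      have nt: "\<phi> t \<noteq> 0" using n[of t] t by simp
      obtain s' where "T < s'" "s' < t" "BB (\<phi> s') = sig 1 (\<phi> t $ 2)" "BB (\<phi> t) = sig (-1) (\<phi> t $ 2)"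
        by (rule BB_before_upper[OF s nt T0 t(1,3,4)]) (rule that)
      then show ?thesis using t by blast
    qed
    have "K \<noteq> {}" using upper[of 0] KI by fastforce
    then obtain y0 where y0: "y0 \<in> K" "\<And>y. y \<in> K \<Longrightarrow> f y0 \<le> f y"
      using continuous_attains_inf[OF K _ fc] by blast
    obtain T where T: "T \<ge> 0" "m T < \<mu> + f y0" using \<mu>_ex[OF fpos[OF y0(1)]] by blast
    obtain s' y t where st: "T < s'" "0 < y" "BB (\<phi> s') = sig 1 y" "s' < t" "BB (\<phi> t) = sig (-1) y"
      using upper[OF T(1)] by blast
    have "f y0 \<le> f y" using y0(2) KI[of s' y] st T by simp
    moreover have "m s' \<le> m T" using anti T st by simp
    moreover have "f y = m s' - m t" by (simp add: f_def m_def st)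
    moreover have "\<mu> \<le> m t" using \<mu>_le st T by simp
    ultimately show False using T by linarith
  qed
  then have "\<exists>T\<ge>0. m T < \<epsilon>" if "\<epsilon> > 0" for \<epsilon> using \<mu>_ex[OF that] by simp
  then show ?thesis
    unfolding tendsto_iff eventually_at_top_linorder
    using anti by (fastforce simp: dist_real_def m_def)
qed

text \<open>\<open>BB\<close> is discontinuous, so compactness is used in each closed zone
  separately. There \<open>amp \<gamma> e\<close> is continuous, and it misses k away from the
  curve, since by \<open>level_side\<close> a point of the zone with amplitude k lies on the
  curve.\<close>

lemma infdist_loop:
  assumes k: "k > 0" "h k = 0" and ep: "\<epsilon> > 0"
  obtains \<delta> where "\<delta> > 0" "\<And>X. X \<noteq> 0 \<Longrightarrow> \<bar>BB X - k\<bar> < \<delta> \<Longrightarrow> infdist X (loop \<gamma> k) < \<epsilon>"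
proof -
  obtain M where M: "M > 0" "\<And>e X. e \<in> {1,-1} \<Longrightarrow> X \<noteq> 0 \<Longrightarrow> amp \<gamma> e X \<le> M * norm X"
    "\<And>e X. e \<in> {1,-1} \<Longrightarrow> X \<noteq> 0 \<Longrightarrow> norm X \<le> M * amp \<gamma> e X"
    by (rule amp_norm_bounds[OF g_pos]) (rule that)
  \<comment> \<open>The annulus is chosen to contain all nonzero X with k/2 < BB X < 2 k.\<close>
  define S where "S e = (cball 0 (2 * M * k) - ball 0 (k / (2 * M))) \<inter> {X. 0 \<le> e * HH h X \<and> \<epsilon> \<le> infdist X (loop \<gamma> k)}" for e :: real
  have ex: "\<exists>\<delta>>0. \<forall>X\<in>S e. \<delta> \<le> \<bar>amp \<gamma> e X - k\<bar>" if e: "e \<in> {1,-1}" for e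
  proof (cases "S e = {}")
    case False
    have nz: "X \<noteq> 0" if "X \<in> S e" for X using that k M(1) by (auto simp: S_def)
    have "closed {X. 0 \<le> e * HH h X \<and> \<epsilon> \<le> infdist X (loop \<gamma> k)}"
      by (intro closed_Collect_conj closed_Collect_le continuous_intros HH_continuous continuous_on_infdist)
    then have "compact (S e)" unfolding S_def by (intro compact_Int_closed compact_diff) auto
    moreover have "continuous_on (S e) (\<lambda>X. \<bar>amp \<gamma> e X - k\<bar>)"
    proof (intro continuous_intros continuous_at_imp_continuous_on ballI amp_continuous_at e zone_dom)
      fix X assume "X \<in> S e"
      then show "0 \<le> e * HH h X" "X \<noteq> 0" using nz by (auto simp: S_def)
    qed
    ultimately obtain X0 where X0: "X0 \<in> S e" "\<And>X. X \<in> S e \<Longrightarrow> \<bar>amp \<gamma> e X0 - k\<bar> \<le> \<bar>amp \<gamma> e X - k\<bar>"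
      using continuous_attains_inf[of "S e"] False by metis
    have "amp \<gamma> e X0 \<noteq> k"
    proof
      assume a: "amp \<gamma> e X0 = k"
      note sg = level_side[OF e k nz[OF X0(1)] a]
      have "0 \<le> e * HH h X0" using X0 by (simp add: S_def)
      then have "0 \<le> e * X0 $ 1" using sg e by (auto simp: sgn_if split: if_splits)
      then have "NN \<gamma> X0 = k" using NN_amp[OF e nz[OF X0(1)]] a by simp
      then show False using X0 ep by (simp add: S_def loop_def)
    qed
    then show ?thesis using X0 by (intro exI[of _ "\<bar>amp \<gamma> e X0 - k\<bar>"]) auto
  qed (auto intro: exI[of _ 1])
  obtain \<delta>1 \<delta>2 where \<delta>: "\<delta>1 > 0" "\<And>X. X \<in> S 1 \<Longrightarrow> \<delta>1 \<le> \<bar>amp \<gamma> 1 X - k\<bar>"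
     "\<delta>2 > 0" "\<And>X. X \<in> S (-1) \<Longrightarrow> \<delta>2 \<le> \<bar>amp \<gamma> (-1) X - k\<bar>"
    using ex[of 1] ex[of "-1"] by auto
  show thesis
  proof (rule that[of "min (k / 2) (min \<delta>1 \<delta>2)"])
    show "min (k / 2) (min \<delta>1 \<delta>2) > 0" using k \<delta> by simp
    fix X :: "real^2" assume X: "X \<noteq> 0" "\<bar>BB X - k\<bar> < min (k / 2) (min \<delta>1 \<delta>2)"
    define e where "e = (if HH h X > 0 then 1 else -1 :: real)"
    have e: "e \<in> {1,-1}" "0 \<le> e * HH h X" "BB X = amp \<gamma> e X" by (auto simp: e_def BB_def)
    show "infdist X (loop \<gamma> k) < \<epsilon>"
    proof (rule ccontr)
      assume far: "\<not> infdist X (loop \<gamma> k) < \<epsilon>"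
      have r: "k / 2 < BB X" "BB X < 2 * k" using X(2) k by linarith+
      have "norm X \<le> M * BB X" "BB X \<le> M * norm X" using M(2,3)[OF e(1) X(1)] e(3) by auto
      moreover have "M * BB X \<le> M * (2 * k)" using r M(1) by simp
      ultimately have "norm X \<le> 2 * M * k" "k / 2 < M * norm X" using r by (auto simp: mult_ac)
      then have "X \<in> S e" using e far M(1) by (auto simp: S_def field_simps)
      then show False using \<delta>(2,4)[of X] X(2) e(3) by (auto simp: e_def split: if_splits)
    qed
  qed
qed

lemma attracted_to_loop:
  assumes s: "sol {0..} \<phi>" and n: "\<And>t. t \<ge> 0 \<Longrightarrow> \<phi> t \<noteq> 0"
    and J: "attracting_band k J" and start: "BB (\<phi> 0) \<in> J" and k: "k > 0"
  shows "((\<lambda>t. infdist (\<phi> t) (loop \<gamma> k)) \<longlongrightarrow> 0) at_top"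
proof (rule tendstoI)
  fix \<epsilon> :: real assume "\<epsilon> > 0"
  have hk: "h k = 0" using J k by (auto simp: attracting_band_def)
  obtain \<delta> where \<delta>: "\<delta> > 0" "\<And>X. X \<noteq> 0 \<Longrightarrow> \<bar>BB X - k\<bar> < \<delta> \<Longrightarrow> infdist X (loop \<gamma> k) < \<epsilon>"
    by (rule infdist_loop[OF k hk \<open>\<epsilon> > 0\<close>]) (rule that)
  have "\<forall>\<^sub>F t in at_top. dist (BB (\<phi> t)) k < \<delta>" by (rule tendstoD[OF BB_converges[OF s n J start] \<delta>(1)])
  then show "\<forall>\<^sub>F t in at_top. dist (infdist (\<phi> t) (loop \<gamma> k)) 0 < \<epsilon>"
    using eventually_ge_at_top[of 0]
  proof eventually_elim
    case (elim t)
    then show ?case using \<delta>(2)[OF n] infdist_nonneg[of "\<phi> t"] by (simp add: dist_real_def)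
  qed
qed

lemma attracted_to_origin:
  assumes s: "sol {0..} \<phi>" and n: "\<And>t. t \<ge> 0 \<Longrightarrow> \<phi> t \<noteq> 0"
    and J: "attracting_band 0 J" and start: "BB (\<phi> 0) \<in> J"
  shows "(\<phi> \<longlongrightarrow> 0) at_top"
proof -
  obtain M where M: "M > 0" "\<And>e X. e \<in> {1,-1} \<Longrightarrow> X \<noteq> 0 \<Longrightarrow> amp \<gamma> e X \<le> M * norm X"
    "\<And>e X. e \<in> {1,-1} \<Longrightarrow> X \<noteq> 0 \<Longrightarrow> norm X \<le> M * amp \<gamma> e X"
    by (rule amp_norm_bounds[OF g_pos]) (rule that)
  show ?thesis
  proof (rule Lim_null_comparison)
    show "\<forall>\<^sub>F t in at_top. norm (\<phi> t) \<le> M * BB (\<phi> t)"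
      using eventually_ge_at_top[of 0]
    proof eventually_elim
      case (elim t)
      then show ?case using M(3)[OF _ n[OF elim]] by (simp add: BB_def)
    qed
    show "((\<lambda>t. M * BB (\<phi> t)) \<longlongrightarrow> 0) at_top"
      by (rule tendsto_mult_right_zero[OF BB_converges[OF s n J start]])
  qed
qed

end

section \<open>Periodic orbits\<close>

text \<open>On \<open>[- \<pi>, \<pi>]\<close> one has \<open>arccos (cos t) = \<bar>t\<bar>\<close>, so this is the \<open>2 \<pi>\<close>-periodic curve that consists of the
  arc of the right zone from \<open>(0, - k exp (- \<gamma> \<pi>))\<close> to \<open>(0, k)\<close> and the arc of the left zone back.\<close>

definition loop_curve :: "real \<Rightarrow> real \<Rightarrow> real \<Rightarrow> real^2" where
  "loop_curve \<gamma> k t = vector [k * exp (- \<gamma> * arccos (cos t)) * - sin t,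
                              k * exp (- \<gamma> * arccos (cos t)) * (cos t + \<gamma> * \<bar>sin t\<bar>)]"

text \<open>With t reduced to u in the interval from - pi to pi, z is the exponential of
  \<open>?z\<close>, whose imaginary part u + e pi/2 lies in the principal strip. So the logarithm
  is explicit, and u cancels in \<open>LV\<close>.\<close>

lemma loop_curve_amp:
  assumes k: "k > 0"
  obtains e where "e \<in> {1, -1}" "e * sin t \<le> 0" "amp \<gamma> e (loop_curve \<gamma> k t) = k" "loop_curve \<gamma> k t \<noteq> 0"
proof -
  obtain u where u: "- pi < u" "u \<le> pi" "sin u = sin t" "cos u = cos t"
    using sincos_principal_value[of t] by blast
  define e where "e = (if u < 0 then 1 else -1 :: real)"
  have e: "e \<in> {1, -1}" by (simp add: e_def)
  have ac: "arccos (cos u) = - e * u"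
    using u(1,2) arccos_cos[of u] arccos_cos2[of u] by (auto simp: e_def)
  have es: "e * sin t \<le> 0"
    unfolding u(3)[symmetric] using u(1,2) sin_ge_zero[of u] sin_ge_zero[of "-u"] by (auto simp: e_def)
  then have as: "\<bar>sin u\<bar> = - e * sin u" unfolding u(3) using e by (auto simp: abs_if)
  let ?z = "Complex (ln k + e * \<gamma> * u) (u + e * (pi / 2))"
  have "zc \<gamma> e (loop_curve \<gamma> k t) = exp ?z"
    unfolding zc_def loop_curve_def complex_eq_iff u(3,4)[symmetric] unfolding ac as using k e
    by (auto simp: Re_exp Im_exp exp_add cos_add sin_add algebra_simps)
  moreover have "Ln (exp ?z) = ?z"
    by (rule Ln_exp) (use u(1,2) in \<open>auto simp: e_def\<close>)
  ultimately have z: "zc \<gamma> e (loop_curve \<gamma> k t) \<noteq> 0" "Ln (zc \<gamma> e (loop_curve \<gamma> k t)) = ?z" by simp_all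
  have "LV \<gamma> e (loop_curve \<gamma> k t) = ln k"
    unfolding LV_def z(2) using e by (auto simp: algebra_simps)
  then have "amp \<gamma> e (loop_curve \<gamma> k t) = k" using k by (simp add: amp_def)
  moreover have "loop_curve \<gamma> k t \<noteq> 0" using z(1) zc_eq_0[OF e] by metis
  ultimately show thesis using that e es by blast
qed

lemma NN_loop_curve: 
  assumes "k > 0"
  shows "NN \<gamma> (loop_curve \<gamma> k t) = k"
proof -
  obtain e where e: "e \<in> {1, -1}" "e * sin t \<le> 0" "amp \<gamma> e (loop_curve \<gamma> k t) = k" "loop_curve \<gamma> k t \<noteq> 0"
    by (rule loop_curve_amp[OF assms]) (rule that)
  have "e * loop_curve \<gamma> k t $ 1 = (k * exp (- \<gamma> * arccos (cos t))) * - (e * sin t)"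
    by (simp add: loop_curve_def)
  also have "\<dots> \<ge> 0" using assms e(2) by (intro mult_nonneg_nonneg) auto
  finally show ?thesis using NN_amp[OF e(1,4)] e(3) by simp
qed

lemma loop_curve_derivative:
  assumes s: "e * sin t < 0" and e: "e \<in> {1, -1}"
  shows "(loop_curve \<gamma> k has_vector_derivative fld \<gamma> e (loop_curve \<gamma> k t)) (at t)"
proof -
  define A where "A s = k * exp (- \<gamma> * arccos (cos s))" for s
  have as: "\<bar>sin s\<bar> = - e * sin s" if "e * sin s < 0" for s using that e by (auto simp: abs_if)
  have "sin t \<noteq> 0" using s by auto
  then have "(sin t)\<^sup>2 > 0" by simp
  then have c2: "(cos t)\<^sup>2 < 1" using sin_cos_squared_add[of t] by linarith
  then have "\<bar>cos t\<bar> < 1" by (simp add: abs_square_less_1)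
  then have c: "- 1 < cos t" "cos t < 1" by auto
  have sq: "sqrt (1 - (cos t)\<^sup>2) = - e * sin t"
    using as[OF s] by (simp add: sin_squared_eq[symmetric])
  have "((\<lambda>s. arccos (cos s)) has_real_derivative inverse (- sqrt (1 - (cos t)\<^sup>2)) * - sin t) (at t)"
    by (rule DERIV_chain2[OF DERIV_arccos[OF c] DERIV_cos])
  moreover have "inverse (- sqrt (1 - (cos t)\<^sup>2)) * - sin t = - e"
    unfolding sq using s e by (auto simp: field_simps)
  ultimately have d: "((\<lambda>s. arccos (cos s)) has_real_derivative - e) (at t)" by simp
  have dA: "(A has_real_derivative e * \<gamma> * A t) (at t)"
    unfolding A_def by (rule derivative_eq_intros d refl)+ simp
  have d1: "((\<lambda>s. - sin s) has_real_derivative - cos t) (at t)"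
    by (auto intro!: derivative_eq_intros)
  have d2: "((\<lambda>s. cos s - e * \<gamma> * sin s) has_real_derivative - sin t - e * \<gamma> * cos t) (at t)"
    by (auto intro!: derivative_eq_intros)
  have D: "((\<lambda>s. vector [A s * - sin s, A s * (cos s - e * \<gamma> * sin s)] :: real^2) has_vector_derivative
      vector [e * \<gamma> * A t * - sin t + - cos t * A t,
              e * \<gamma> * A t * (cos t - e * \<gamma> * sin t) + (- sin t - e * \<gamma> * cos t) * A t]) (at t)"
    by (intro has_vector_derivative_vector2 DERIV_mult dA d1 d2)
  have "(loop_curve \<gamma> k has_vector_derivative
      vector [e * \<gamma> * A t * - sin t + - cos t * A t,
              e * \<gamma> * A t * (cos t - e * \<gamma> * sin t) + (- sin t - e * \<gamma> * cos t) * A t]) (at t)"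
  proof (rule has_vector_derivative_transform_within_open[OF D])
    show "open {s. e * sin s < 0}" by (intro open_Collect_less continuous_intros)
    fix r assume "r \<in> {s. e * sin s < 0}"
    then show "vector [A r * - sin r, A r * (cos r - e * \<gamma> * sin r)] = loop_curve \<gamma> k r"
      using as[of r] by (simp add: loop_curve_def A_def mult_ac)
  qed (use s in simp)
  moreover have "vector [e * \<gamma> * A t * - sin t + - cos t * A t,
              e * \<gamma> * A t * (cos t - e * \<gamma> * sin t) + (- sin t - e * \<gamma> * cos t) * A t] = fld \<gamma> e (loop_curve \<gamma> k t)"
    using e by (auto simp: loop_curve_def fld_def A_def as[OF s] vec2_eq power2_eq_square algebra_simps)
  ultimately show ?thesis by simp
qed

lemma loop_curve_continuous: "continuous_on S (loop_curve \<gamma> k)"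
proof -
  have v: "(vector [a, b] :: real^2) = a *\<^sub>R axis 1 1 + b *\<^sub>R axis 2 1" for a b :: real
    by (simp add: vec_eq_iff forall_2 axis_def)
  show ?thesis unfolding loop_curve_def v by (intro continuous_intros) auto
qed

lemma sin_side:
  fixes s t :: real
  assumes "sin t = 0" "\<bar>s - t\<bar> < pi" "s \<noteq> t"
  shows "sgn (sin s) = cos t * sgn (s - t)"
proof -
  have "sin s = cos t * sin (s - t)"
    using sin_add[of "s - t" t] assms(1) by simp
  moreover have "sgn (sin (s - t)) = sgn (s - t)"
  proof (cases "t < s")
    case True
    then show ?thesis using assms(2) sin_gt_zero[of "s - t"] by simp
  next
    case False
    then have "sin (t - s) > 0" using assms(2,3) by (intro sin_gt_zero) auto
    then show ?thesis using False assms(3) sin_minus[of "t - s"] by simp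
  qed
  moreover have "cos t \<in> {1, -1}" using assms(1) sin_cos_squared_add[of t] by (auto simp: power2_eq_1_iff)
  ultimately show ?thesis by (auto simp: sgn_mult)
qed

context two_zone
begin

text \<open>By \<open>level_side\<close> the zones along the curve are those for h = 0, given by the
  sign of - sin t; the switching curve is met only on the y-axis, at multiples of pi.\<close>

lemma loop_curve_sol:
  assumes k: "k > 0" "h k = 0"
  shows "sol UNIV (loop_curve \<gamma> k)"
proof -
  have sg: "sgn (HH h (loop_curve \<gamma> k t)) = - sgn (sin t)" and nz: "loop_curve \<gamma> k t \<noteq> 0" for t
  proof -
    obtain e where e: "e \<in> {1, -1}" "e * sin t \<le> 0" "amp \<gamma> e (loop_curve \<gamma> k t) = k" "loop_curve \<gamma> k t \<noteq> 0"
      by (rule loop_curve_amp[OF k(1)]) (rule that)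
    show "loop_curve \<gamma> k t \<noteq> 0" by (rule e(4))
    have "sgn (HH h (loop_curve \<gamma> k t)) = sgn (loop_curve \<gamma> k t $ 1)" by (rule level_side[OF e(1) k e(4,3)])
    then show "sgn (HH h (loop_curve \<gamma> k t)) = - sgn (sin t)" using k by (simp add: loop_curve_def sgn_mult)
  qed
  show ?thesis
    unfolding solution_on_def
  proof (intro conjI ballI impI)
    fix t :: real
    show "(loop_curve \<gamma> k has_vector_derivative FF \<gamma> h (loop_curve \<gamma> k t)) (at t)"
      if "HH h (loop_curve \<gamma> k t) \<noteq> 0 \<or> loop_curve \<gamma> k t = 0"
    proof -
      define e where "e = sgn (HH h (loop_curve \<gamma> k t))"
      have H: "HH h (loop_curve \<gamma> k t) \<noteq> 0" using that nz by blast
      then have e: "e \<in> {1,-1}" "e * HH h (loop_curve \<gamma> k t) > 0" by (auto simp: e_def sgn_if)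
      have "e * sin t < 0" using H sg[of t] by (auto simp: e_def sgn_if split: if_splits)
      then show ?thesis using loop_curve_derivative[OF _ e(1)] FF_zone[OF e] by simp
    qed
    show "crosses_at (HH h) UNIV (loop_curve \<gamma> k) t"
      if "HH h (loop_curve \<gamma> k t) = 0 \<and> loop_curve \<gamma> k t \<noteq> 0"
    proof -
      have s0: "sin t = 0" using that sg[of t] by (simp add: sgn_0_0)
      have c: "cos t = 1 \<or> cos t = -1" using s0 sin_cos_squared_add[of t] by (auto simp: power2_eq_1_iff)
      have H: "sgn (HH h (loop_curve \<gamma> k s)) = - cos t * sgn (s - t)" if "\<bar>s - t\<bar> < pi" "s \<noteq> t" for s
        using sg[of s] sin_side[OF s0 that] by simp
      have "cos t * HH h (loop_curve \<gamma> k s) > 0" if "t - pi < s" "s < t" for s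
        using H[of s] that c by (auto simp: sgn_if zero_less_mult_iff mult_less_0_iff split: if_splits)
      then have "\<forall>\<^sub>F s in at t within UNIV \<inter> {..<t}. cos t * HH h (loop_curve \<gamma> k s) > 0"
        unfolding eventually_at by (intro exI[of _ pi]) (auto simp: dist_real_def)
      moreover have "cos t * HH h (loop_curve \<gamma> k s) < 0" if "t < s" "s < t + pi" for s
        using H[of s] that c by (auto simp: sgn_if zero_less_mult_iff mult_less_0_iff split: if_splits)
      then have "\<forall>\<^sub>F s in at t within UNIV \<inter> {t<..}. cos t * HH h (loop_curve \<gamma> k s) < 0"
        unfolding eventually_at by (intro exI[of _ pi]) (auto simp: dist_real_def)
      ultimately show ?thesis using c unfolding crosses_at_def by auto
    qed
  qed (rule loop_curve_continuous)
qed

text \<open>The angle takes every value from \<theta> 0 on, and by homogeneity of \<open>NN\<close>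
  each ray meets the level curve only once.\<close>

lemma loop_covered:
  assumes s: "sol {0..} \<phi>" and n: "\<And>t. t \<ge> 0 \<Longrightarrow> \<phi> t \<noteq> 0"
    and k: "k > 0" and N: "\<And>t. t \<ge> 0 \<Longrightarrow> NN \<gamma> (\<phi> t) = k"
  shows "loop \<gamma> k \<subseteq> \<phi> ` {0..}"
proof
  fix X assume X: "X \<in> loop \<gamma> k"
  then have X0: "X \<noteq> 0" and NX: "NN \<gamma> X = k" using k by (auto simp: loop_def)
  obtain \<theta> \<delta> where \<theta>: "continuous_on {0..} \<theta>"
    "\<And>t. t \<ge> 0 \<Longrightarrow> \<phi> t = norm (\<phi> t) *\<^sub>R vector [cos (\<theta> t), sin (\<theta> t)]"
    "\<delta> > 0" "\<And>s t. 0 \<le> s \<Longrightarrow> s \<le> t \<Longrightarrow> \<delta> * (t - s) \<le> \<theta> t - \<theta> s"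
    by (rule sol_angle[OF s n], assumption) (rule that)
  have "(X $ 1 / norm X)\<^sup>2 + (X $ 2 / norm X)\<^sup>2 = 1"
  proof -
    have "(norm X)\<^sup>2 = (X $ 1)\<^sup>2 + (X $ 2)\<^sup>2" by (simp add: norm_vec_def L2_set_def UNIV_2)
    then show ?thesis using X0 vec2_eq_0[of X] by (simp add: power_divide add_divide_distrib[symmetric])
  qed
  then obtain \<alpha> where \<alpha>: "X $ 1 / norm X = cos \<alpha>" "X $ 2 / norm X = sin \<alpha>"
    by (rule sincos_total_2pi) (rule that)
  obtain m :: nat where m: "(\<theta> 0 - \<alpha>) / (2 * pi) < real m" using reals_Archimedean2 by blast
  define a where "a = \<alpha> + 2 * pi * real m"
  have ta: "\<theta> 0 \<le> a" using m by (simp add: a_def field_simps)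
  obtain t where t: "0 \<le> t" "\<theta> t = a"
    by (rule angle_attains[OF \<theta>(1,3,4) order_refl ta], assumption, assumption) (rule that)
  have "cos (2 * pi * real m) = 1" "sin (2 * pi * real m) = 0" 
    using cos_2npi[of m] sin_2npi[of m] by (simp_all add: mult_ac)
  then have ca: "cos a = cos \<alpha>" "sin a = sin \<alpha>" unfolding a_def by (simp_all add: cos_add sin_add)
  define v :: "real^2" where "v = vector [cos \<alpha>, sin \<alpha>]"
  have Xv: "norm X *\<^sub>R v = X" unfolding v_def \<alpha>[symmetric] using X0 by (simp add: vec_eq_iff forall_2)
  have pv: "norm (\<phi> t) *\<^sub>R v = \<phi> t" using \<theta>(2)[OF t(1), symmetric] unfolding t(2) ca v_def .
  have v0: "v \<noteq> 0" using Xv X0 by (metis scaleR_zero_right)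
  have "norm X * NN \<gamma> v = NN \<gamma> (norm X *\<^sub>R v)" by (rule NN_scale[symmetric, OF norm_ge_zero])
  also have "\<dots> = k" unfolding Xv by (rule NX)
  also have "\<dots> = NN \<gamma> (norm (\<phi> t) *\<^sub>R v)" unfolding pv by (rule N[OF t(1), symmetric])
  also have "\<dots> = norm (\<phi> t) * NN \<gamma> v" by (rule NN_scale[OF norm_ge_zero])
  finally have nX: "norm X = norm (\<phi> t)" using NN_pos[OF v0, of \<gamma>] by simp
  have "X = \<phi> t" by (rule trans[OF Xv[symmetric] trans[OF arg_cong[OF nX, of "\<lambda>r. r *\<^sub>R v"] pv]])
  then show "X \<in> \<phi> ` {0..}" by (rule image_eqI) (use t(1) in simp)
qed

lemma loop_periodic:
  assumes k: "k > 0" "h k = 0"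
  shows "periodic_orbit (FF \<gamma> h) (HH h) (loop \<gamma> k)"
  unfolding periodic_orbit_def
proof (intro exI conjI allI)
  let ?\<phi> = "loop_curve \<gamma> k"
  show s: "sol UNIV ?\<phi>" by (rule loop_curve_sol[OF k])
  show "2 * pi > 0" by simp
  show "?\<phi> (t + 2 * pi) = ?\<phi> t" for t by (simp add: loop_curve_def)
  have "?\<phi> pi $ 2 < 0" "?\<phi> 0 $ 2 > 0" using k by (simp_all add: loop_curve_def)
  then show "?\<phi> pi \<noteq> ?\<phi> 0" by auto
  have N: "NN \<gamma> (?\<phi> t) = k" for t by (rule NN_loop_curve[OF k(1)])
  then have "?\<phi> t \<noteq> 0" for t using k by (metis NN_zero less_irrefl)
  then have "loop \<gamma> k \<subseteq> ?\<phi> ` {0..}"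
    by (intro loop_covered solution_on_subset[OF s] k(1) N) auto
  then show "loop \<gamma> k = range ?\<phi>" using N by (auto simp: loop_def)
qed

text \<open>An upper crossing recurs at the same height y1 after one period. Then the amplitude
  moves from \<open>sig (-1) y1\<close> to \<open>sig 1 y1\<close> in the meantime, which
  monotonicity forbids unless the two agree, that is h y1 = 0. From then on the amplitude is frozen
  at the level y1.\<close>

lemma periodic_is_loop:
  assumes "periodic_orbit (FF \<gamma> h) (HH h) \<Gamma>"
  obtains k where "k > 0" "h k = 0" "\<Gamma> = loop \<gamma> k"
proof -
  obtain \<phi> T where s: "sol UNIV \<phi>" and T: "T > 0" and per: "\<And>t. \<phi> (t + T) = \<phi> t"
    and nc: "\<exists>t. \<phi> t \<noteq> \<phi> 0" and \<Gamma>: "\<Gamma> = range \<phi>"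
    using assms unfolding periodic_orbit_def by auto
  obtain a where a: "\<phi> a \<noteq> 0" using nc by metis
  have n: "\<phi> t \<noteq> 0" for t by (rule sol_nonzero[OF s _ _ a]) auto
  have s0: "sol {0..} \<phi>" by (rule solution_on_subset[OF s]) simp
  obtain t1 where t1: "t1 > 0" "HH h (\<phi> t1) = 0" "\<phi> t1 $ 2 > 0"
    by (rule late_upper_crossing[OF s0 n, of 0]) (rule that)
  define y1 where "y1 = \<phi> t1 $ 2"
  have y1: "y1 > 0" using t1 by (simp add: y1_def)
  obtain r where r: "t1 < r" "r < t1 + T" "BB (\<phi> r) = sig 1 y1" "BB (\<phi> t1) = sig (-1) y1"
  proof -
    assume *: "\<And>r. t1 < r \<Longrightarrow> r < t1 + T \<Longrightarrow> BB (\<phi> r) = sig 1 y1 \<Longrightarrow> BB (\<phi> t1) = sig (-1) y1 \<Longrightarrow> thesis"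
    show thesis
    proof (rule BB_before_upper[OF s0, of "t1 + T" t1])
    show "\<phi> (t1 + T) \<noteq> 0" by (rule n)
    show "0 \<le> t1" "t1 < t1 + T" using t1 T by auto
    show "HH h (\<phi> (t1 + T)) = 0" "\<phi> (t1 + T) $ 2 > 0" using t1 per by auto
    show thesis if "t1 < s" "s < t1 + T" "BB (\<phi> s) = sig 1 (\<phi> (t1 + T) $ 2)"
       "BB (\<phi> (t1 + T)) = sig (- 1) (\<phi> (t1 + T) $ 2)" for s
      by (rule *) (use that per[of t1] in \<open>simp_all add: y1_def\<close>)
    qed
  qed
  have mono: "R (BB (\<phi> t1)) (BB (\<phi> t))" 
    if re: "\<And>b. R b b" and tr: "\<And>a b c. R a b \<Longrightarrow> R b c \<Longrightarrow> R a c" 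
      and ju: "\<And>y. y > 0 \<Longrightarrow> R (sig 1 y) (sig (-1) y)" and le: "t \<ge> t1" for R t
  proof (rule BB_monotone_relation[OF s0 _ n re])
    show "R a c" if "R a b" "R b c" for a b c by (rule tr[OF that])
    show "R (sig 1 y) (sig (-1) y)" if "y > 0" for y by (rule ju[OF that])
    show "t1 \<in> {0..}" "t \<in> {0..}" "t1 \<le> t" using t1(1) le by auto
  qed simp
  have h0: "h y1 = 0"
  proof -
    have "\<not> sig (-1) y1 < sig 1 y1"
    proof
      assume lt: "sig (-1) y1 < sig 1 y1"
      \<comment> \<open>By monotonicity of \<open>sig\<close>, amplitudes of at most \<open>sig (- 1) y1\<close> form a forward invariant set,
        so the amplitude \<open>sig 1 y1\<close> is never attained again.\<close>
      define R where "R b b' \<longleftrightarrow> (b \<le> sig (-1) y1 \<longrightarrow> b' \<le> sig (-1) y1)" for b b'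
      have "R (sig 1 y) (sig (-1) y)" if "y > 0" for y
        using sig_less_iff[of 1 y y1] sig_less_iff[of "-1" y y1] y1 that lt by (auto simp: R_def)
      with r(1) have "R (BB (\<phi> t1)) (BB (\<phi> r))" by - (rule mono[of R], simp_all add: R_def)
      then show False using lt r by (simp add: R_def)
    qed
    moreover have "\<not> sig 1 y1 < sig (-1) y1"
    proof
      assume lt: "sig 1 y1 < sig (-1) y1"
      define R where "R b b' \<longleftrightarrow> (sig (-1) y1 \<le> b \<longrightarrow> sig (-1) y1 \<le> b')" for b b'
      have "R (sig 1 y) (sig (-1) y)" if "y > 0" for y
        using sig_less_iff[of 1 y1 y] sig_less_iff[of "-1" y1 y] y1 that lt by (auto simp: R_def)
      with r(1) have "R (BB (\<phi> t1)) (BB (\<phi> r))" by - (rule mono[of R], simp_all add: R_def)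
      then show False using lt r by (simp add: R_def)
    qed
    ultimately show ?thesis using sig_equal_iff[OF y1] by simp
  qed
  have B: "BB (\<phi> t) = y1" if "t \<ge> t1" for t
  proof -
    define R where "R b b' \<longleftrightarrow> (b = y1 \<longrightarrow> b' = y1)" for b b'
    have "R (sig 1 y) (sig (-1) y)" if "y > 0" for y
      using sig_level(3)[OF _ that y1 h0, of 1] sig_level(3)[OF _ that y1 h0, of "-1"] by (auto simp: R_def)
    with that have "R (BB (\<phi> t1)) (BB (\<phi> t))" by - (rule mono[of R], simp_all add: R_def)
    then show ?thesis using r(4) sig_fix[of "-1" y1] y1 h0 by (simp add: R_def)
  qed
  have perm: "\<phi> (t + real m * T) = \<phi> t" for t m
  proof (induction m)
    case (Suc m)
    have e: "t + real (Suc m) * T = (t + real m * T) + T" by (simp add: algebra_simps)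
    show ?case unfolding e per by (rule Suc)
  qed simp
  have N: "NN \<gamma> (\<phi> t) = y1" for t
  proof -
    obtain m :: nat where "(t1 - t) / T < real m" using reals_Archimedean2 by blast
    then have "t1 \<le> t + real m * T" using T by (simp add: field_simps)
    then have "BB (\<phi> t) = y1" using B[of "t + real m * T"] perm by simp
    then show ?thesis using BB_NN_eq[OF y1 h0 n] by simp
  qed
  have "loop \<gamma> y1 \<subseteq> \<phi> ` {0..}" by (rule loop_covered[OF s0 n y1 N])
  then have "\<Gamma> = loop \<gamma> y1" unfolding \<Gamma> using N by (auto simp: loop_def)
  then show thesis using that y1 h0 by blast
qed

section \<open>Existence of forward solutions\<close>

text \<open>Local form of a solution as a linear arc. The arc is the one dictated by the side of
  \<open>\<phi> t\<close>, so that crossing and staying inside a zone need not be told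
  apart.\<close>

definition left_flow :: "real set \<Rightarrow> (real \<Rightarrow> real^2) \<Rightarrow> real \<Rightarrow> bool" where
  "left_flow I \<phi> t \<longleftrightarrow> (\<exists>d>0. \<forall>s\<in>I. t - d < s \<and> s < t \<longrightarrow>
     \<phi> s = flow \<gamma> (side_before (\<phi> t)) (s - t) (\<phi> t) \<and> side_before (\<phi> t) * HH h (\<phi> s) > 0)"

definition right_flow :: "real set \<Rightarrow> (real \<Rightarrow> real^2) \<Rightarrow> real \<Rightarrow> bool" where
  "right_flow I \<phi> t \<longleftrightarrow> (\<exists>d>0. \<forall>s\<in>I. t < s \<and> s < t + d \<longrightarrow>
     \<phi> s = flow \<gamma> (side_after (\<phi> t)) (s - t) (\<phi> t) \<and> side_after (\<phi> t) * HH h (\<phi> s) > 0)"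

lemma sol_local_flowI:
  assumes n: "\<And>t. t \<in> I \<Longrightarrow> \<phi> t \<noteq> 0"
    and l: "\<And>t. t \<in> I \<Longrightarrow> left_flow I \<phi> t" and r: "\<And>t. t \<in> I \<Longrightarrow> right_flow I \<phi> t"
  shows "sol I \<phi>"
proof -
  have loc: "continuous (at t within I) \<phi> \<and> 
     (HH h (\<phi> t) \<noteq> 0 \<longrightarrow> (\<phi> has_vector_derivative FF \<gamma> h (\<phi> t)) (at t within I)) \<and>
     (HH h (\<phi> t) = 0 \<longrightarrow> crosses_at (HH h) I \<phi> t)" if t: "t \<in> I" for t
  proof -
    let ?eb = "side_before (\<phi> t)" and ?ea = "side_after (\<phi> t)"
    note sd = sides[OF n[OF t]]
    obtain d1 where d1: "d1 > 0" "\<And>s. s \<in> I \<Longrightarrow> t - d1 < s \<Longrightarrow> s < t \<Longrightarrow> \<phi> s = flow \<gamma> ?eb (s - t) (\<phi> t)"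
      "\<And>s. s \<in> I \<Longrightarrow> t - d1 < s \<Longrightarrow> s < t \<Longrightarrow> ?eb * HH h (\<phi> s) > 0"
      using l[OF t] unfolding left_flow_def by metis
    obtain d2 where d2: "d2 > 0" "\<And>s. s \<in> I \<Longrightarrow> t < s \<Longrightarrow> s < t + d2 \<Longrightarrow> \<phi> s = flow \<gamma> ?ea (s - t) (\<phi> t)"
      "\<And>s. s \<in> I \<Longrightarrow> t < s \<Longrightarrow> s < t + d2 \<Longrightarrow> ?ea * HH h (\<phi> s) > 0"
      using r[OF t] unfolding right_flow_def by metis
    define d where "d = min d1 d2"
    have d: "d > 0" using d1 d2 by (simp add: d_def)
    have cases: "\<phi> s = flow \<gamma> ?eb (s - t) (\<phi> t) \<or> \<phi> s = flow \<gamma> ?ea (s - t) (\<phi> t)"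
      if "s \<in> I" "dist s t < d" for s
      using d1(2)[of s] d2(2)[of s] that sd by (cases s t rule: linorder_cases) (auto simp: d_def dist_real_def)
    have fl: "((\<lambda>s. norm (flow \<gamma> e (s - t) (\<phi> t) - \<phi> t)) \<longlongrightarrow> 0) (at t within I)" if e: "e \<in> {1,-1}" for e
    proof -
      have "isCont (\<lambda>u. flow \<gamma> e u (\<phi> t)) (t - t)"
        using has_vector_derivative_continuous[OF flow_has_derivative[OF e]] by simp
      then have "isCont (\<lambda>s. flow \<gamma> e (s - t) (\<phi> t)) t"
        by (rule isCont_o2[rotated]) (intro continuous_intros)
      then have "((\<lambda>s. flow \<gamma> e (s - t) (\<phi> t)) \<longlongrightarrow> \<phi> t) (at t)" using e by (simp add: isCont_def)
      then have "((\<lambda>s. norm (flow \<gamma> e (s - t) (\<phi> t) - \<phi> t)) \<longlongrightarrow> 0) (at t)"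
        by (intro tendsto_norm_zero LIM_zero)
      then show ?thesis by (rule tendsto_within_subset) simp
    qed
    have "continuous (at t within I) \<phi>"
    proof -
      have "((\<lambda>s. \<phi> s - \<phi> t) \<longlongrightarrow> 0) (at t within I)"
      proof (rule Lim_null_comparison)
        show "\<forall>\<^sub>F s in at t within I. norm (\<phi> s - \<phi> t) \<le>
           norm (flow \<gamma> ?eb (s - t) (\<phi> t) - \<phi> t) + norm (flow \<gamma> ?ea (s - t) (\<phi> t) - \<phi> t)"
          unfolding eventually_at
        proof (intro exI conjI ballI impI)
          fix s assume "s \<in> I" "s \<noteq> t \<and> dist s t < d"
          then show "norm (\<phi> s - \<phi> t) \<le>
           norm (flow \<gamma> ?eb (s - t) (\<phi> t) - \<phi> t) + norm (flow \<gamma> ?ea (s - t) (\<phi> t) - \<phi> t)"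
            using cases[of s] norm_ge_zero[of "flow \<gamma> ?eb (s - t) (\<phi> t) - \<phi> t"] 
              norm_ge_zero[of "flow \<gamma> ?ea (s - t) (\<phi> t) - \<phi> t"] by auto
        qed (rule d)
        show "((\<lambda>s. norm (flow \<gamma> ?eb (s - t) (\<phi> t) - \<phi> t) + norm (flow \<gamma> ?ea (s - t) (\<phi> t) - \<phi> t)) \<longlongrightarrow> 0) (at t within I)"
          using tendsto_add[OF fl[OF sd(1)] fl[OF sd(2)]] by simp
      qed
      then show ?thesis by (simp add: continuous_within LIM_zero_iff)
    qed
    moreover have "(\<phi> has_vector_derivative FF \<gamma> h (\<phi> t)) (at t within I)" if H: "HH h (\<phi> t) \<noteq> 0"
    proof -
      have eq: "?ea = ?eb" using H by (simp add: side_after_def side_before_def)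
      have "?ea * HH h (\<phi> t) > 0" using H by (simp add: side_after_def sgn_if)
      then have F: "FF \<gamma> h (\<phi> t) = fld \<gamma> ?ea (\<phi> t)" by (rule FF_zone[OF sd(2)])
      have lin: "((\<lambda>s. s - t) has_vector_derivative 1) (at t within I)"
        by (auto intro!: derivative_eq_intros)
      have fd: "((\<lambda>u. flow \<gamma> ?ea u (\<phi> t)) has_vector_derivative fld \<gamma> ?ea (\<phi> t)) (at (t - t) within (\<lambda>s. s - t) ` I)"
        using flow_has_derivative[OF sd(2), of \<gamma> "\<phi> t" "t - t"] sd(2) by simp
      have D: "((\<lambda>s. flow \<gamma> ?ea (s - t) (\<phi> t)) has_vector_derivative fld \<gamma> ?ea (\<phi> t)) (at t within I)"
        using vector_diff_chain_within[OF lin fd] by (simp add: o_def)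
      show ?thesis unfolding F
        by (rule has_vector_derivative_transform_within[OF D d t]) (use cases eq in auto)
    qed
    moreover have "crosses_at (HH h) I \<phi> t" if H: "HH h (\<phi> t) = 0"
    proof -
      have eq: "?ea = - ?eb" using H by (simp add: side_after_def side_before_def)
      have "\<forall>\<^sub>F s in at t within I \<inter> {..<t}. ?eb * HH h (\<phi> s) > 0"
        unfolding eventually_at using d1 by (intro exI[of _ d1]) (auto simp: dist_real_def)
      moreover have "\<forall>\<^sub>F s in at t within I \<inter> {t<..}. ?ea * HH h (\<phi> s) > 0"
        unfolding eventually_at using d2 by (intro exI[of _ d2]) (auto simp: dist_real_def)
      ultimately show ?thesis using sd(1) unfolding crosses_at_def eq by auto
    qed
    ultimately show ?thesis by blast
  qed
  show ?thesis
    unfolding solution_on_def continuous_on_eq_continuous_within using loc n by blast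
qed

text \<open>Along the flow the argument of z grows with unit speed, so at arbitrarily late times it
  is - e pi/2 modulo 2 pi. This is the negative y-axis, where \<open>HH\<close> vanishes for every
  h. It guarantees that the zone is left at this time or earlier.\<close>

lemma flow_reaches_lower_axis:
  assumes e: "e \<in> {1, -1}" and p: "p \<noteq> 0"
  obtains t where "t > a" "HH h (flow \<gamma> e t p) = 0"
proof -
  let ?z = "zc \<gamma> e p"
  have z: "?z \<noteq> 0" using p by (simp add: zc_eq_0[OF e])
  define \<alpha> where "\<alpha> = Im (Ln ?z)"
  obtain m :: nat where m: "(a + \<alpha> + pi) / (2 * pi) < real m" using reals_Archimedean2 by blast
  define t where "t = - \<alpha> - e * (pi / 2) + 2 * pi * real m"
  have "a + \<alpha> + pi < 2 * pi * real m" using m by (simp add: field_simps)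
  moreover have "e * (pi / 2) \<le> pi / 2" using e by auto
  ultimately have ta: "t > a" using pi_gt_zero unfolding t_def by linarith
  have s: "cos (2 * pi * real m) = 1" "sin (2 * pi * real m) = 0"
    using cos_2npi[of m] sin_2npi[of m] by (simp_all add: mult_ac)
  have w: "exp (of_real t * Complex (e * \<gamma>) 1) * ?z = exp (of_real t * Complex (e * \<gamma>) 1 + Ln ?z)"
    using z by (simp add: exp_add)
  have im: "Im (of_real t * Complex (e * \<gamma>) 1 + Ln ?z) = - e * (pi / 2) + 2 * pi * real m"
    by (simp add: \<alpha>_def[symmetric] t_def)
  have c: "cos (- e * (pi / 2) + 2 * pi * real m) = 0" "sin (- e * (pi / 2) + 2 * pi * real m) = - e"
    unfolding cos_add sin_add s using e by auto
  let ?w = "exp (of_real t * Complex (e * \<gamma>) 1 + Ln ?z)"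
  have "Re ?w = 0" "Im ?w = - e * exp (Re (of_real t * Complex (e * \<gamma>) 1 + Ln ?z))"
    unfolding Re_exp Im_exp im c by simp_all
  then have "flow \<gamma> e t p $ 1 = 0" "flow \<gamma> e t p $ 2 \<le> 0"
    unfolding flow_def w iz_def using e by auto
  then have "HH h (flow \<gamma> e t p) = 0" by (simp add: HH_def)
  then show thesis using that ta by blast
qed

lemma HH_flow_continuous: "e \<in> {1, -1} \<Longrightarrow> continuous_on S (\<lambda>t. HH h (flow \<gamma> e t p))"
  by (rule continuous_on_compose2[OF HH_continuous flow_continuous]) auto

text \<open>The last clause names the branch of the exit: the upper one for the right zone, the
  lower one for the left zone.\<close>

definition zone_exit :: "real^2 \<Rightarrow> real \<Rightarrow> bool" where
  "zone_exit p T \<longleftrightarrow> T > 0 \<and> (\<forall>s. 0 < s \<and> s < T \<longrightarrow> side_after p * HH h (flow \<gamma> (side_after p) s p) > 0) \<and>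
     HH h (flow \<gamma> (side_after p) T p) = 0 \<and> sgn (flow \<gamma> (side_after p) T p $ 2) = side_after p"

lemma zone_exit_ex:
  assumes p: "p \<noteq> 0"
  shows "\<exists>T. zone_exit p T"
proof -
  define e where "e = side_after p"
  have e: "e \<in> {1, -1}" using sides(2)[OF p] by (simp add: e_def)
  define f where "f s = e * HH h (flow \<gamma> e s p)" for s
  have cf: "continuous_on S f" for S unfolding f_def by (intro continuous_intros HH_flow_continuous e)
  have "\<exists>d>0. \<forall>s. 0 < s \<and> s < d \<longrightarrow> f s > 0"
  proof (cases "HH h p = 0")
    case True
    obtain d where d: "d > 0" "\<And>t. 0 < t \<Longrightarrow> t < d \<Longrightarrow> sgn (p $ 2) * HH h (flow \<gamma> e t p) < 0"
      "\<And>t. 0 < t \<Longrightarrow> t < d \<Longrightarrow> sgn (p $ 2) * HH h (flow \<gamma> e (- t) p) > 0"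
      by (rule flow_crossing[OF e p True]) (rule that)
    then show ?thesis using True by (intro exI[of _ d]) (auto simp: f_def e_def side_after_def)
  next
    case False
    have "f 0 > 0" using False e by (simp add: f_def) (simp add: e_def side_after_def sgn_if)
    moreover have "isCont f 0" using cf[of UNIV] by (simp add: continuous_on_eq_continuous_at)
    ultimately have "\<forall>\<^sub>F s in at 0. f s > 0" by (simp add: isCont_def order_tendstoD)
    then show ?thesis by (auto simp: eventually_at dist_real_def)
  qed
  then obtain d where d: "d > 0" "\<And>s. 0 < s \<Longrightarrow> s < d \<Longrightarrow> f s > 0" by blast
  obtain t where t: "t > d" "HH h (flow \<gamma> e t p) = 0" by (rule flow_reaches_lower_axis[OF e p]) (rule that)
  \<comment> \<open>The search for the first zero starts at d/2 because f vanishes at 0 when p lies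
    on the switching curve; before d there are no other zeros.\<close>
  define Z where "Z = {s \<in> {d / 2..t}. f s = 0}"
  have "closed Z" unfolding Z_def by (rule continuous_closed_preimage_constant[OF cf]) simp
  moreover have Zb: "bdd_below Z" unfolding Z_def by (rule bdd_belowI[of _ "d / 2"]) auto
  moreover have "t \<in> Z" using t d by (simp add: Z_def f_def)
  ultimately have T: "Inf Z \<in> Z" by (intro closed_contains_Inf) auto
  define T where "T = Inf Z"
  have T: "d / 2 \<le> T" "f T = 0" using T by (auto simp: Z_def T_def)
  then have dT: "d \<le> T" using d(2)[of T] d(1) by force
  have pos: "f s > 0" if s: "0 < s" "s < T" for s
  proof (rule ccontr)
    assume "\<not> f s > 0"
    then have ds: "d \<le> s" using d(2)[of s] s by force
    have "\<exists>u. d / 2 \<le> u \<and> u \<le> s \<and> f u = 0"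
      by (rule IVT2') (use d(2)[of "d / 2"] d(1) \<open>\<not> f s > 0\<close> ds cf in auto)
    then obtain u where u: "d / 2 \<le> u" "u \<le> s" "f u = 0" by blast
    moreover have "T \<le> t" unfolding T_def using \<open>t \<in> Z\<close> Zb by (rule cInf_lower)
    ultimately have "u \<in> Z" using s by (simp add: Z_def)
    then have "T \<le> u" unfolding T_def using Zb by (rule cInf_lower)
    then show False using u s by simp
  qed
  let ?q = "flow \<gamma> e T p"
  have q: "?q \<noteq> 0" "HH h ?q = 0" using p T(2) e by (auto simp: flow_eq_0 f_def)
  obtain d' where d': "d' > 0" "\<And>t. 0 < t \<Longrightarrow> t < d' \<Longrightarrow> sgn (?q $ 2) * HH h (flow \<gamma> e t ?q) < 0"
     "\<And>t. 0 < t \<Longrightarrow> t < d' \<Longrightarrow> sgn (?q $ 2) * HH h (flow \<gamma> e (- t) ?q) > 0"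
    by (rule flow_crossing[OF e q]) (rule that)
  define u where "u = min (d' / 2) (T / 2)"
  have u: "0 < u" "u < d'" "u < T" using d' dT d(1) by (auto simp: u_def)
  have "sgn (?q $ 2) * HH h (flow \<gamma> e (T - u) p) > 0" using d'(3)[OF u(1,2)] by (simp add: flow_add[OF e])
  moreover have "f (T - u) > 0" by (rule pos) (use u in auto)
  ultimately have "sgn (?q $ 2) = e" using e by (auto simp: f_def sgn_if zero_less_mult_iff split: if_splits)
  then have "zone_exit p T"
    using dT d(1) pos q(2) unfolding zone_exit_def e_def[symmetric] by (simp add: f_def)
  then show ?thesis by blast
qed

definition exit_time :: "real^2 \<Rightarrow> real" where
  "exit_time p = (SOME T. zone_exit p T)"

lemma zone_exit_time: "p \<noteq> 0 \<Longrightarrow> zone_exit p (exit_time p)"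
  unfolding exit_time_def by (rule someI_ex[OF zone_exit_ex])

definition exit_point :: "real^2 \<Rightarrow> real^2" where
  "exit_point p = flow \<gamma> (side_after p) (exit_time p) p"

lemma exit_point:
  assumes "p \<noteq> 0"
  shows "exit_point p \<noteq> 0" "HH h (exit_point p) = 0" "side_before (exit_point p) = side_after p"
    "side_after (exit_point p) = - side_after p" "sgn (exit_point p $ 2) = side_after p"
proof -
  note z = zone_exit_time[OF assms, unfolded zone_exit_def, folded exit_point_def]
  show 1: "HH h (exit_point p) = 0" "sgn (exit_point p $ 2) = side_after p" using z by blast+
  show "exit_point p \<noteq> 0" using sides(2)[OF assms] assms by (simp add: exit_point_def flow_eq_0)
  show "side_before (exit_point p) = side_after p" "side_after (exit_point p) = - side_after p"
    using 1 by (simp_all add: side_before_def side_after_def)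
qed

text \<open>This rules out an accumulation of crossing times. From the lower branch the exit lies in
  the upper half-plane, but the height keeps its negative sign while
  \<open>cos T - \<gamma> * sin T\<close> is positive. For T < c the cosine is at least 7/8 and
  \<open>\<gamma> * sin T\<close> at most 1/2.\<close>

lemma exit_time_lower:
  obtains c where "c > 0" "\<And>p. HH h p = 0 \<Longrightarrow> p $ 2 < 0 \<Longrightarrow> c \<le> exit_time p"
proof -
  define c where "c = min (1 / 2) (1 / (2 * \<gamma>))"
  have c: "c > 0" using g_pos by (simp add: c_def)
  have "c \<le> exit_time p" if p: "HH h p = 0" "p $ 2 < 0" for p
  proof (rule ccontr)
    assume "\<not> c \<le> exit_time p"
    moreover have p0: "p \<noteq> 0" using p by auto
    moreover define T where "T = exit_time p"
    ultimately have T: "T < c" "zone_exit p T" using zone_exit_time by auto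
    have sa: "side_after p = 1" using p by (simp add: side_after_def)
    have p1: "p $ 1 = 0" using p by (simp add: HH_def)
    have T0: "T > 0" using T by (simp add: zone_exit_def)
    have y: "flow \<gamma> 1 T p $ 2 = p $ 2 * exp (\<gamma> * T) * (cos T - \<gamma> * sin T)"
      by (simp add: flow_def iz_def zc_def p1 Re_exp Im_exp algebra_simps)
    have "T^2 \<le> (1/2)^2" using T0 T(1) by (intro power_mono) (auto simp: c_def)
    then have "cos T \<ge> 7/8" using cos_ge_taylor2[of T] by (simp add: power2_eq_square)
    moreover have "\<gamma> * sin T \<le> \<gamma> * T" using g_pos T0 by (simp add: sin_x_le_x)
    moreover have "\<gamma> * (1 / (2 * \<gamma>)) = 1/2" using g_pos by simp
    moreover have "\<gamma> * T \<le> \<gamma> * (1 / (2 * \<gamma>))" using g_pos T(1) by (intro mult_left_mono) (auto simp: c_def)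
    ultimately have "cos T - \<gamma> * sin T > 0" by linarith
    then have "flow \<gamma> 1 T p $ 2 < 0" unfolding y using p by (intro mult_neg_pos) auto
    then show False using T(2) by (simp add: zone_exit_def sa)
  qed
  then show thesis using that c by blast
qed

lemma forward_solution_exists:
  assumes p: "p \<noteq> 0"
  obtains \<phi> where "sol {0..} \<phi>" "\<phi> 0 = p"
proof -
  define P where "P i = (exit_point ^^ i) p" for i
  define E where "E i = side_after (P i)" for i
  define \<tau> where "\<tau> i = (\<Sum>j<i. exit_time (P j))" for i
  have P_Suc: "P (Suc i) = exit_point (P i)" for i by (simp add: P_def)
  have P0: "P i \<noteq> 0" for i by (induction i) (simp_all add: P_Suc exit_point(1), simp add: P_def p)
  note z = zone_exit_time[OF P0]
  have E: "E i \<in> {1,-1}" for i unfolding E_def by (rule sides(2)[OF P0])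
  have \<tau>_Suc: "\<tau> (Suc i) = \<tau> i + exit_time (P i)" for i by (simp add: \<tau>_def)
  have \<tau>_less: "\<tau> i < \<tau> (Suc i)" for i using z[of i] by (simp add: \<tau>_Suc zone_exit_def)
  then have \<tau>_mono: "strict_mono \<tau>" by (simp add: strict_mono_Suc_iff)
  obtain c where c: "c > 0" "\<And>p. HH h p = 0 \<Longrightarrow> p $ 2 < 0 \<Longrightarrow> c \<le> exit_time p"
    by (rule exit_time_lower) (rule that)
  \<comment> \<open>Branches alternate, so one of the two exit points after \<open>P i\<close> lies
    on the lower branch and the arc from it lasts at least c. \<open>P i\<close> itself is left
    aside because the initial point may be anywhere; hence three arcs.\<close>
  have jump: "\<tau> i + c \<le> \<tau> (Suc (Suc (Suc i)))" for i
  proof -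
    have "c \<le> exit_time (P (Suc i)) \<or> c \<le> exit_time (P (Suc (Suc i)))"
    proof (cases "E i = 1")
      case True
      have "sgn (P (Suc (Suc i)) $ 2) = side_after (P (Suc i))"
        unfolding P_Suc[of "Suc i"] by (rule exit_point(5)[OF P0])
      also have "\<dots> = - side_after (P i)" unfolding P_Suc[of i] by (rule exit_point(4)[OF P0])
      finally have "sgn (P (Suc (Suc i)) $ 2) = -1" using True by (simp add: E_def)
      then show ?thesis using c(2)[of "P (Suc (Suc i))"] exit_point(2)[OF P0[of "Suc i"]]
        by (simp add: P_Suc[of "Suc i"] sgn_if split: if_splits)
    next
      case False
      have "sgn (P (Suc i) $ 2) = side_after (P i)" unfolding P_Suc by (rule exit_point(5)[OF P0])
      with False have "sgn (P (Suc i) $ 2) = -1" using E[of i] by (simp add: E_def)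
      then show ?thesis using c(2)[of "P (Suc i)"] exit_point(2)[OF P0[of i]]
        by (simp add: P_Suc[of i] sgn_if split: if_splits)
    qed
    then show ?thesis using \<tau>_less[of i] \<tau>_less[of "Suc i"] \<tau>_less[of "Suc (Suc i)"] \<tau>_Suc[of "Suc i"] \<tau>_Suc[of "Suc (Suc i)"] by linarith
  qed
  have unb: "\<exists>i. t < \<tau> i" for t
  proof -
    have "real m * c \<le> \<tau> (3 * m)" for m
    proof (induction m)
      case (Suc m)
      have e3: "3 * Suc m = Suc (Suc (Suc (3 * m)))" by simp
      have "real (Suc m) * c = real m * c + c" by (simp add: distrib_right)
      then show ?case unfolding e3 using jump[of "3 * m"] Suc by linarith
    qed (simp add: \<tau>_def)
    moreover obtain m :: nat where "t / c < real m" using reals_Archimedean2 by blast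
    then have "t < real m * c" using c(1) by (simp add: field_simps)
    ultimately show ?thesis by (meson less_le_trans)
  qed
  define ix where "ix t = (LEAST i. t < \<tau> (Suc i))" for t
  have ix: "t < \<tau> (Suc (ix t))" "\<tau> (ix t) \<le> t" if "t \<ge> 0" for t
  proof -
    obtain i where i: "t < \<tau> i" using unb by blast
    moreover have "\<tau> i < \<tau> (Suc i)" by (rule \<tau>_less)
    ultimately have ex: "\<exists>i. t < \<tau> (Suc i)" using less_trans by blast
    then show "t < \<tau> (Suc (ix t))" unfolding ix_def by (rule LeastI_ex)
    show "\<tau> (ix t) \<le> t"
    proof (cases "ix t")
      case 0
      then show ?thesis using that by (simp add: \<tau>_def)
    next
      case (Suc j)
      then have "j < ix t" by simp
      then have "\<not> t < \<tau> (Suc j)" unfolding ix_def by (rule not_less_Least)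
      then show ?thesis using Suc by simp
    qed
  qed
  have ix_eq: "ix t = i" if "\<tau> i \<le> t" "t < \<tau> (Suc i)" "t \<ge> 0" for t i
  proof -
    have "\<tau> i < \<tau> (Suc (ix t))" "\<tau> (ix t) < \<tau> (Suc i)" using ix[OF that(3)] that by linarith+
    then show ?thesis by (simp add: strict_mono_less[OF \<tau>_mono])
  qed
  define \<phi> where "\<phi> t = flow \<gamma> (E (ix t)) (t - \<tau> (ix t)) (P (ix t))" for t
  have \<tau>0: "\<tau> i \<ge> 0" for i using strict_mono_less_eq[OF \<tau>_mono, of 0 i] by (simp add: \<tau>_def)
  have \<phi>: "\<phi> t = flow \<gamma> (E i) (t - \<tau> i) (P i)" if "\<tau> i \<le> t" "t < \<tau> (Suc i)" for t i
    using ix_eq[OF that] \<tau>0[of i] that by (simp add: \<phi>_def)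
  have \<phi>\<tau>: "\<phi> (\<tau> i) = P i" for i using \<phi>[of i "\<tau> i"] \<tau>_less E by simp
  have inner: "E i * HH h (\<phi> t) > 0" if "\<tau> i < t" "t < \<tau> (Suc i)" for t i
    using z[of i] that \<phi>[of i t] by (simp add: zone_exit_def E_def \<tau>_Suc)
  \<comment> \<open>The curve is defined on half-open pieces; the formula of a piece also holds at
    its right end because the next piece starts at the exit point.\<close>
  have closed: "flow \<gamma> (E i) (t - \<tau> i) (P i) = \<phi> t" if "\<tau> i \<le> t" "t \<le> \<tau> (Suc i)" for t i
  proof (cases "t = \<tau> (Suc i)")
    case True
    then show ?thesis using \<phi>\<tau>[of "Suc i"] by (simp add: P_Suc exit_point_def E_def \<tau>_Suc)
  next
    case False
    then show ?thesis using \<phi>[of i t] that by simp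
  qed
  have rel: "\<phi> s = flow \<gamma> (E i) (s - t) (\<phi> t)" if "\<tau> i \<le> t" "t \<le> \<tau> (Suc i)" "\<tau> i \<le> s" "s \<le> \<tau> (Suc i)" for s t i
  proof -
    have "flow \<gamma> (E i) (s - t) (\<phi> t) = flow \<gamma> (E i) (s - t) (flow \<gamma> (E i) (t - \<tau> i) (P i))"
      by (simp only: closed[OF that(1,2)])
    also have "\<dots> = flow \<gamma> (E i) (s - \<tau> i) (P i)" by (simp add: flow_add[OF E])
    also have "\<dots> = \<phi> s" by (rule closed[OF that(3,4)])
    finally show ?thesis ..
  qed
  have "sol {0..} \<phi>"
  proof (rule sol_local_flowI)
    fix t :: real assume "t \<in> {0..}"
    then have t: "t \<ge> 0" by simp
    let ?i = "ix t"
    note i = ix[OF t]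
    show "\<phi> t \<noteq> 0" unfolding \<phi>_def by (simp add: flow_eq_0[OF E] P0)
    have after: "side_after (\<phi> t) = E ?i"
    proof (cases "t = \<tau> ?i")
      case True
      then have "\<phi> t = P ?i" using \<phi>\<tau>[of ?i] by simp
      then show ?thesis by (simp add: E_def)
    next
      case False
      then show ?thesis using inner[of ?i t] i E[of ?i] by (auto simp: side_after_def sgn_if zero_less_mult_iff)
    qed
    show "right_flow {0..} \<phi> t"
      unfolding right_flow_def after
    proof (intro exI conjI ballI impI)
      show "\<tau> (Suc ?i) - t > 0" using i by simp
      fix s assume s: "t < s \<and> s < t + (\<tau> (Suc ?i) - t)"
      show "\<phi> s = flow \<gamma> (E ?i) (s - t) (\<phi> t)" by (rule rel) (use s i in auto)
      show "0 < E ?i * HH h (\<phi> s)" by (rule inner) (use s i in auto)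
    qed
    show "left_flow {0..} \<phi> t"
    proof (cases "t = 0")
      case True
      then show ?thesis unfolding left_flow_def by (intro exI[of _ 1]) auto
    next
      case False
      obtain j where j: "\<tau> j < t" "t \<le> \<tau> (Suc j)"
      proof (cases "t = \<tau> ?i")
        case True
        then have "?i \<noteq> 0" using False by (intro notI) (simp add: \<tau>_def)
        then obtain j where "?i = Suc j" using not0_implies_Suc by blast
        then show ?thesis using that[of j] True \<tau>_less[of j] by simp
      next
        case False
        then show ?thesis using that[of ?i] i by simp
      qed
      have before: "side_before (\<phi> t) = E j"
      proof (cases "t = \<tau> (Suc j)")
        case True
        then have "\<phi> t = exit_point (P j)" using \<phi>\<tau>[of "Suc j"] P_Suc by simp
        then show ?thesis using exit_point(3)[OF P0] by (simp add: E_def)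
      next
        case False
        then show ?thesis using inner[of j t] j E[of j] by (auto simp: side_before_def sgn_if zero_less_mult_iff)
      qed
      show ?thesis
        unfolding left_flow_def before
      proof (intro exI conjI ballI impI)
        show "t - \<tau> j > 0" using j by simp
        fix s assume s: "t - (t - \<tau> j) < s \<and> s < t"
        show "\<phi> s = flow \<gamma> (E j) (s - t) (\<phi> t)" by (rule rel) (use s j in auto)
        show "0 < E j * HH h (\<phi> s)" by (rule inner) (use s j in auto)
      qed
    qed
  qed
  moreover have "\<phi> 0 = p" using \<phi>\<tau>[of 0] by (simp add: \<tau>_def P_def)
  ultimately show thesis by (rule that)
qed

section \<open>Stability\<close>

text \<open>Amplitudes and heights are positive, so every nonpositive number trivially separates
  them; this admits 0 and -1 as lower ends of bands.\<close>

definition level :: "real \<Rightarrow> bool" where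
  "level j \<longleftrightarrow> j \<le> 0 \<or> h j = 0"

lemma sig_compare_level:
  assumes "e \<in> {1, -1}" "y > 0" "level j"
  shows "sig e y < j \<longleftrightarrow> y < j" "j < sig e y \<longleftrightarrow> j < y"
  using sig_level[OF assms(1,2), of j] sig_pos[of e y] assms by (cases "j > 0"; force simp: level_def)+

lemma BB_NN_compare_level:
  assumes "X \<noteq> 0" "level j"
  shows "BB X < j \<longleftrightarrow> NN \<gamma> X < j" "j < BB X \<longleftrightarrow> j < NN \<gamma> X"
  using BB_NN_compare[of j X] BB_pos[of X] NN_pos[OF assms(1), of \<gamma>] assms by (cases "j > 0"; force simp: level_def)+

text \<open>The flag c switches the upper bound off for the outermost cycle, beyond which there is
  no further level.\<close>

definition band :: "real \<Rightarrow> bool \<Rightarrow> real \<Rightarrow> real set" where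
  "band a c b = {y. a < y \<and> (c \<longrightarrow> y < b)}"

lemma band_attracting:
  assumes "level a" "c \<longrightarrow> level b" "k \<in> band a c b" "0 \<le> k" "k > 0 \<longrightarrow> h k = 0"
    and "\<And>y. y > 0 \<Longrightarrow> y \<in> band a c b \<Longrightarrow> y \<noteq> k \<Longrightarrow> h y * (y - k) > 0"
  shows "attracting_band k (band a c b)"
proof -
  have "is_interval (band a c b)" by (auto simp: band_def is_interval_1)
  moreover have "sig e y \<in> band a c b \<longleftrightarrow> y \<in> band a c b" if "y > 0" "e \<in> {1,-1}" for e y
    using sig_compare_level[OF that(2,1)] assms(1,2) by (auto simp: band_def)
  ultimately show ?thesis using assms(3-6) by (auto simp: attracting_band_def)
qed

lemma open_NN_band: "open {X. NN \<gamma> X \<in> band a c b}"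
proof -
  have "{X. NN \<gamma> X \<in> band a c b} = {X. a < NN \<gamma> X} \<inter> (if c then {X. NN \<gamma> X < b} else UNIV)"
    by (auto simp: band_def)
  then show ?thesis using open_NN_less[OF g_pos] by (auto intro!: open_Int)
qed

lemma BB_band:
  assumes "X \<noteq> 0" "level a" "c \<longrightarrow> level b"
  shows "BB X \<in> band a c b \<longleftrightarrow> NN \<gamma> X \<in> band a c b"
  using BB_NN_compare_level[OF assms(1)] assms(2,3) by (auto simp: band_def)

lemma sol_forward_nonzero: "sol {0..} \<phi> \<Longrightarrow> \<phi> 0 \<noteq> 0 \<Longrightarrow> t \<ge> 0 \<Longrightarrow> \<phi> t \<noteq> 0"
  by (rule sol_nonzero[of "{0..}" \<phi> 0]) auto

text \<open>The sets for \<open>NN\<close> and \<open>BB\<close> with values in the band agree off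
  the origin, so the neighbourhood is open and consists of attracted points. The condition 0 \<le> a
  keeps the resting solution at the origin out of it.\<close>

lemma stable_loop:
  assumes l: "level a" "c \<longrightarrow> level b" and k: "k \<in> band a c b" "0 < k" "h k = 0" and a: "0 \<le> a"
    and sgn: "\<And>y. y > 0 \<Longrightarrow> y \<in> band a c b \<Longrightarrow> y \<noteq> k \<Longrightarrow> h y * (y - k) > 0"
  shows "stable_orbit (FF \<gamma> h) (HH h) (loop \<gamma> k)"
  unfolding stable_orbit_def
proof (intro exI[of _ "{X. NN \<gamma> X \<in> band a c b}"] conjI ballI allI impI)
  have J: "attracting_band k (band a c b)" by (rule band_attracting) (use l k sgn in auto)
  show "open {X. NN \<gamma> X \<in> band a c b}" by (rule open_NN_band)
  show "loop \<gamma> k \<subseteq> {X. NN \<gamma> X \<in> band a c b}" using k(1) by (auto simp: loop_def)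
  fix p assume p: "p \<in> {X. NN \<gamma> X \<in> band a c b}"
  have p0: "p \<noteq> 0" using p a by (auto simp: band_def)
  obtain \<phi> where "sol {0..} \<phi>" "\<phi> 0 = p" by (rule forward_solution_exists[OF p0]) (rule that)
  then show "\<exists>\<phi>. sol {0..} \<phi> \<and> \<phi> 0 = p" by blast
  fix \<phi> assume s: "sol {0..} \<phi> \<and> \<phi> 0 = p"
  show "((\<lambda>t. infdist (\<phi> t) (loop \<gamma> k)) \<longlongrightarrow> 0) at_top"
  proof (rule attracted_to_loop[OF _ _ J _ k(2)])
    show "sol {0..} \<phi>" using s by simp
    show "\<phi> t \<noteq> 0" if "t \<ge> 0" for t using sol_forward_nonzero[of \<phi> t] s p0 that by simp
    show "BB (\<phi> 0) \<in> band a c b" using BB_band[OF p0 l] s p by simp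
  qed
qed

lemma stable_focus:
  assumes b: "b > 0" "h b = 0" and sgn: "\<And>y. 0 < y \<Longrightarrow> y < b \<Longrightarrow> h y > 0"
  shows "stable_focus_origin (FF \<gamma> h) (HH h)"
  unfolding stable_focus_origin_def
proof
  have F0: "FF \<gamma> h 0 = 0" by (simp add: FF_def fld_def vec2_eq_0)
  show z: "sol UNIV (\<lambda>t. 0)" by (simp add: solution_on_def F0)
  \<comment> \<open>The lower end -1 lets the neighbourhood contain the origin, where
    \<open>NN\<close> is 0.\<close>
  define J where "J = band (-1) True b"
  have l: "level (-1)" "level b" using b by (auto simp: level_def)
  have J: "attracting_band 0 J" unfolding J_def
    by (rule band_attracting) (use l b sgn in \<open>auto simp: band_def\<close>)
  show "\<exists>U. open U \<and> 0 \<in> U \<and> (\<forall>p\<in>U. (\<exists>\<phi>. sol {0..} \<phi> \<and> \<phi> 0 = p) \<and>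
        (\<forall>\<phi>. sol {0..} \<phi> \<and> \<phi> 0 = p \<and> (\<exists>t\<ge>0. \<phi> t \<noteq> \<phi> 0) \<longrightarrow> spirals_around_origin \<phi> \<and> (\<phi> \<longlongrightarrow> 0) at_top))"
  proof (intro exI[of _ "{X. NN \<gamma> X \<in> J}"] conjI ballI allI impI)
    show "open {X. NN \<gamma> X \<in> J}" unfolding J_def by (rule open_NN_band)
    show "0 \<in> {X. NN \<gamma> X \<in> J}" using b by (simp add: J_def band_def)
    fix p assume p: "p \<in> {X. NN \<gamma> X \<in> J}"
    show "\<exists>\<phi>. sol {0..} \<phi> \<and> \<phi> 0 = p"
    proof (cases "p = 0")
      case True
      then show ?thesis using solution_on_subset[OF z, of "{0..}"] by auto
    next
      case False
      obtain \<phi> where "sol {0..} \<phi>" "\<phi> 0 = p" by (rule forward_solution_exists[OF False]) (rule that)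
      then show ?thesis by blast
    qed
    fix \<phi> assume a: "sol {0..} \<phi> \<and> \<phi> 0 = p \<and> (\<exists>t\<ge>0. \<phi> t \<noteq> \<phi> 0)"
    then have s: "sol {0..} \<phi>" and start: "\<phi> 0 = p" by auto
    obtain t0 where t0: "t0 \<ge> 0" "\<phi> t0 \<noteq> \<phi> 0" using a by blast
    \<comment> \<open>\<open>sol_nonzero\<close> works in both directions of time: a solution that
      is nonzero at t0 was nonzero at time 0.\<close>
    have p0: "\<phi> 0 \<noteq> 0"
    proof
      assume "\<phi> 0 = 0"
      moreover from this have "\<phi> 0 \<noteq> 0"
        using t0 by (intro sol_nonzero[OF s, of t0 0]) auto
      ultimately show False by simp
    qed
    have n: "\<phi> t \<noteq> 0" if "t \<ge> 0" for t by (rule sol_forward_nonzero[OF s p0 that])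
    show "(\<phi> \<longlongrightarrow> 0) at_top"
      by (rule attracted_to_origin[OF s n J]) (use BB_band[OF p0, of "-1" True b] l p start in \<open>simp_all add: J_def\<close>)
    obtain \<theta> \<delta> where \<theta>: "continuous_on {0..} \<theta>"
      "\<And>t. t \<ge> 0 \<Longrightarrow> \<phi> t = norm (\<phi> t) *\<^sub>R vector [cos (\<theta> t), sin (\<theta> t)]"
      "\<delta> > 0" "\<And>s t. 0 \<le> s \<Longrightarrow> s \<le> t \<Longrightarrow> \<delta> * (t - s) \<le> \<theta> t - \<theta> s"
      by (rule sol_angle[OF s n], assumption) (rule that)
    have "filterlim (\<lambda>t. \<bar>\<theta> t\<bar>) at_top at_top"
      by (rule filterlim_at_top_mono[OF angle_at_top[OF \<theta>(3,4)]]) (auto intro: always_eventually)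
    then show "spirals_around_origin \<phi>"
      unfolding spirals_around_origin_def using n \<theta>(1,2) by blast
  qed
qed

end

section \<open>Reversing time\<close>

text \<open>The reflection \<open>x \<mapsto> - x\<close> together with the reversal of time exchanges the two foci and
  replaces \<open>h\<close> by \<open>- h\<close>.\<close>

definition mirror :: "real^2 \<Rightarrow> real^2" where
  "mirror X = vector [- X $ 1, X $ 2]"

lemma mirror_mirror [simp]: "mirror (mirror X) = X"
  by (simp add: mirror_def vec_eq_iff forall_2)

lemma bounded_linear_mirror: "bounded_linear mirror"
  unfolding mirror_def
  by (intro linear_conv_bounded_linear[THEN iffD1] linearI) (auto simp: vec_eq_iff forall_2)

lemma mirror_eq_0 [simp]: "mirror X = 0 \<longleftrightarrow> X = 0"
  by (simp add: mirror_def vec2_eq_0)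

lemma dist_mirror: "dist (mirror X) (mirror Y) = dist X Y"
proof -
  have "norm (mirror Z) = norm Z" for Z by (simp add: mirror_def norm_vec_def L2_set_def UNIV_2)
  moreover have "mirror X - mirror Y = mirror (X - Y)" by (simp add: mirror_def vec_eq_iff forall_2)
  ultimately show ?thesis by (simp add: dist_norm)
qed

text \<open>The coordinate of zone - e at the mirrored point is the complex conjugate of that of
  zone e. Conjugation flips \<open>Im (Ln z)\<close>, which compensates the flipped e in
  \<open>LV\<close>.\<close>

lemma NN_mirror: "NN \<gamma> (mirror X) = NN \<gamma> X"
proof (cases "X = 0")
  case False
  define e where "e = (if X $ 1 \<ge> 0 then 1 else -1 :: real)"
  have e: "e \<in> {1,-1}" "- e \<in> {1,-1}" "e * X $ 1 \<ge> 0" "- e * mirror X $ 1 \<ge> 0" by (auto simp: e_def mirror_def)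
  have "zc \<gamma> (- e) (mirror X) = cnj (zc \<gamma> e X)" by (simp add: zc_def mirror_def complex_eq_iff)
  then have "Ln (zc \<gamma> (- e) (mirror X)) = cnj (Ln (zc \<gamma> e X))"
    using zc_dom_side[OF e(1,3) False, of \<gamma>] by (simp add: cnj_Ln)
  then have "amp \<gamma> (- e) (mirror X) = amp \<gamma> e X" by (simp add: amp_def LV_def)
  then show ?thesis
    using NN_amp[OF e(1) False e(3), of \<gamma>] NN_amp[OF e(2) _ e(4), of \<gamma>] False by simp
qed (simp add: mirror_def NN_def vec2_eq_0)

lemma mirror_loop: "mirror ` loop \<gamma> r = loop \<gamma> r"
proof
  show "mirror ` loop \<gamma> r \<subseteq> loop \<gamma> r" by (auto simp: loop_def NN_mirror)
  show "loop \<gamma> r \<subseteq> mirror ` loop \<gamma> r"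
  proof
    fix X assume "X \<in> loop \<gamma> r"
    then have "mirror X \<in> loop \<gamma> r" by (simp add: loop_def NN_mirror)
    then show "X \<in> mirror ` loop \<gamma> r" by (rule image_eqI[rotated]) simp
  qed
qed

lemma HH_mirror: "HH (\<lambda>y. - f y) (mirror X) = - HH f X"
  by (simp add: HH_def mirror_def)

text \<open>The switching curve off the origin is left out because \<open>FF\<close> takes the field
  of the right zone there, before as well as after the reflection.\<close>

lemma FF_mirror:
  assumes "HH f X \<noteq> 0 \<or> X = 0"
  shows "FF \<gamma> (\<lambda>y. - f y) (mirror X) = - mirror (FF \<gamma> f X)"
  using assms by (auto simp: FF_def HH_mirror) (auto simp: fld_def mirror_def vec_eq_iff forall_2 HH_def)

lemma eventually_within_uminus:
  fixes t :: real
  assumes "\<forall>\<^sub>F s in at t within A. P s"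
  shows "\<forall>\<^sub>F s in at (- t) within uminus ` A. P (- s)"
  using assms unfolding eventually_at by (auto simp: dist_real_def)

lemma solution_mirror:
  assumes s: "solution_on (FF \<gamma> f) (HH f) I \<phi>"
  shows "solution_on (FF \<gamma> (\<lambda>y. - f y)) (HH (\<lambda>y. - f y)) (uminus ` I) (\<lambda>t. mirror (\<phi> (- t)))"
  unfolding solution_on_def
proof (intro conjI ballI impI)
  have I: "uminus ` uminus ` I = I" by (simp add: image_image)
  have "continuous_on I \<phi>" using s by (simp add: solution_on_def)
  then have "continuous_on (uminus ` I) (\<lambda>t. \<phi> (- t))"
    by (rule continuous_on_compose2) (auto intro: continuous_intros)
  then show "continuous_on (uminus ` I) (\<lambda>t. mirror (\<phi> (- t)))"
    by (rule linear_continuous_on_compose[OF _ bounded_linear.linear[OF bounded_linear_mirror]])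
  fix t assume "t \<in> uminus ` I"
  then have t: "- t \<in> I" by auto
  {
    assume "HH (\<lambda>y. - f y) (mirror (\<phi> (- t))) \<noteq> 0 \<or> mirror (\<phi> (- t)) = 0"
    then have H: "HH f (\<phi> (- t)) \<noteq> 0 \<or> \<phi> (- t) = 0" by (simp add: HH_mirror)
    have lin: "((\<lambda>s. - s) has_vector_derivative -1) (at t within uminus ` I)"
      by (auto intro!: derivative_eq_intros)
    have "(\<phi> has_vector_derivative FF \<gamma> f (\<phi> (- t))) (at (- t) within uminus ` uminus ` I)"
      unfolding I using s t H by (simp add: solution_on_def)
    from bounded_linear.has_vector_derivative[OF bounded_linear_mirror vector_diff_chain_within[OF lin this]]
    show "((\<lambda>t. mirror (\<phi> (- t))) has_vector_derivative FF \<gamma> (\<lambda>y. - f y) (mirror (\<phi> (- t)))) (at t within uminus ` I)"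
      unfolding FF_mirror[OF H] by (simp add: o_def linear_neg[OF bounded_linear.linear[OF bounded_linear_mirror]])
  }
  {
    assume "HH (\<lambda>y. - f y) (mirror (\<phi> (- t))) = 0 \<and> mirror (\<phi> (- t)) \<noteq> 0"
    then have "crosses_at (HH f) I \<phi> (- t)" using s t by (simp add: solution_on_def HH_mirror)
    moreover have im: "uminus ` (I \<inter> {..<- t}) = uminus ` I \<inter> {t<..}" "uminus ` (I \<inter> {- t<..}) = uminus ` I \<inter> {..<t}" by force+
    ultimately show "crosses_at (HH (\<lambda>y. - f y)) (uminus ` I) (\<lambda>t. mirror (\<phi> (- t))) t"
      using eventually_within_uminus[of _ "- t" "I \<inter> {..<- t}"] eventually_within_uminus[of _ "- t" "I \<inter> {- t<..}"]
      unfolding crosses_at_def HH_mirror im by fastforce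
  }
qed

lemma unstable_orbit_mirror:
  assumes st: "stable_orbit (FF \<gamma> (\<lambda>y. - f y)) (HH (\<lambda>y. - f y)) \<Gamma>" and \<Gamma>: "mirror ` \<Gamma> = \<Gamma>"
  shows "unstable_orbit (FF \<gamma> f) (HH f) \<Gamma>"
proof -
  obtain U where U: "open U" "\<Gamma> \<subseteq> U" "\<And>p. p \<in> U \<Longrightarrow>
        (\<exists>\<phi>. solution_on (FF \<gamma> (\<lambda>y. - f y)) (HH (\<lambda>y. - f y)) {0..} \<phi> \<and> \<phi> 0 = p)"
    "\<And>p \<phi>. p \<in> U \<Longrightarrow> solution_on (FF \<gamma> (\<lambda>y. - f y)) (HH (\<lambda>y. - f y)) {0..} \<phi> \<Longrightarrow> \<phi> 0 = p \<Longrightarrow>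
             ((\<lambda>t. infdist (\<phi> t) \<Gamma>) \<longlongrightarrow> 0) at_top"
    using st unfolding stable_orbit_def by auto
  have neg: "uminus ` {0::real..} = {..0}" "uminus ` {..0::real} = {0..}" by auto
  have inf: "infdist (mirror X) \<Gamma> = infdist X \<Gamma>" for X
  proof -
    have "infdist (mirror X) (mirror ` \<Gamma>) = infdist X \<Gamma>" by (simp add: infdist_def image_image dist_mirror)
    then show ?thesis using \<Gamma> by simp
  qed
  show ?thesis
    unfolding unstable_orbit_def
  proof (intro exI[of _ "mirror -` U"] conjI ballI allI impI)
    have "isCont mirror X" for X by (rule linear_continuous_at[OF bounded_linear_mirror])
    then show "open (mirror -` U)" by (intro open_vimage U(1)) (auto intro: continuous_at_imp_continuous_on)
    show "\<Gamma> \<subseteq> mirror -` U" using U(2) \<Gamma> by blast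
    fix p assume p: "p \<in> mirror -` U"
    then obtain \<psi> where \<psi>: "solution_on (FF \<gamma> (\<lambda>y. - f y)) (HH (\<lambda>y. - f y)) {0..} \<psi>" "\<psi> 0 = mirror p"
      using U(3)[of "mirror p"] by auto
    have "solution_on (FF \<gamma> f) (HH f) {..0} (\<lambda>t. mirror (\<psi> (- t)))"
      using solution_mirror[OF \<psi>(1)] unfolding neg by simp
    then show "\<exists>\<phi>. solution_on (FF \<gamma> f) (HH f) {..0} \<phi> \<and> \<phi> 0 = p"
      using \<psi>(2) by (intro exI[of _ "\<lambda>t. mirror (\<psi> (- t))"]) simp
    fix \<phi> assume \<phi>: "solution_on (FF \<gamma> f) (HH f) {..0} \<phi> \<and> \<phi> 0 = p"
    have "solution_on (FF \<gamma> (\<lambda>y. - f y)) (HH (\<lambda>y. - f y)) {0..} (\<lambda>t. mirror (\<phi> (- t)))"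
      using solution_mirror[OF conjunct1[OF \<phi>]] unfolding neg .
    from U(4)[OF _ this, of "mirror p"] have "((\<lambda>t. infdist (\<phi> (- t)) \<Gamma>) \<longlongrightarrow> 0) at_top"
      using p \<phi> by (simp add: inf)
    then show "((\<lambda>t. infdist (\<phi> t) \<Gamma>) \<longlongrightarrow> 0) at_bot"
      by (simp add: filterlim_at_bot_mirror)
  qed
qed

section \<open>The sinusoidal switching curve\<close>

definition h_slope :: "nat \<Rightarrow> real \<Rightarrow> real \<Rightarrow> real" where
  "h_slope n \<gamma> y = 2 * \<gamma> / ((\<gamma>\<^sup>2 + 1) * pi) *
     (if y \<le> (2 * real n + 1) / 2 then pi * cos (pi * y) else 0)"

lemma cos_odd_half: "cos (pi * ((2 * real n + 1) / 2)) = 0"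
  and sin_odd_half: "sin (pi * ((2 * real n + 1) / 2)) = (-1) ^ n"
proof -
  have e: "pi * ((2 * real n + 1) / 2) = pi * real n + pi / 2" by (simp add: field_simps)
  show "cos (pi * ((2 * real n + 1) / 2)) = 0" "sin (pi * ((2 * real n + 1) / 2)) = (-1) ^ n"
    unfolding e by (simp_all add: cos_add sin_add cos_npi2 sin_npi2)
qed

lemma has_real_derivative_glue:
  fixes f g :: "real \<Rightarrow> real"
  assumes f: "(f has_real_derivative d) (at a)" and g: "(g has_real_derivative d) (at a)" and fg: "f a = g a"
  shows "((\<lambda>y. if y \<le> a then f y else g y) has_real_derivative d) (at a)"
  unfolding has_field_derivative_iff filterlim_at_split
proof
  have l: "((\<lambda>y. (f y - f a) / (y - a)) \<longlongrightarrow> d) (at_left a)" and r: "((\<lambda>y. (g y - g a) / (y - a)) \<longlongrightarrow> d) (at_right a)"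
    using f g unfolding has_field_derivative_iff filterlim_at_split by blast+
  show "((\<lambda>y. ((if y \<le> a then f y else g y) - (if a \<le> a then f a else g a)) / (y - a)) \<longlongrightarrow> d) (at_left a)"
    by (rule Lim_transform_eventually[OF l]) (simp add: eventually_at_filter)
  show "((\<lambda>y. ((if y \<le> a then f y else g y) - (if a \<le> a then f a else g a)) / (y - a)) \<longlongrightarrow> d) (at_right a)"
    by (rule Lim_transform_eventually[OF r]) (simp add: eventually_at_filter fg)
qed

text \<open>At y = n + 1/2 the sine takes the value \<open>(-1) ^ n\<close> with slope 0, so the
  constant continues it with a derivative.\<close>

lemma h_has_derivative: "(h n \<gamma> has_real_derivative h_slope n \<gamma> y) (at y)"
proof -
  let ?N = "(2 * real n + 1) / 2"
  define k where "k y = (if y \<le> ?N then sin (pi * y) else (-1) ^ n)" for y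
  define k' where "k' = (if y \<le> ?N then pi * cos (pi * y) else 0)"
  have s: "((\<lambda>y. sin (pi * y)) has_real_derivative pi * cos (pi * y)) (at y)" for y
    by (auto intro!: derivative_eq_intros)
  have "(k has_real_derivative k') (at y)"
  proof (cases y ?N rule: linorder_cases)
    case less
    then have "\<forall>\<^sub>F x in nhds y. k x = sin (pi * x)"
      using eventually_nhds_in_open[of "{..<?N}" y] by (auto simp: k_def elim!: eventually_mono)
    then show ?thesis using s[of y] less by (subst DERIV_cong_ev[OF refl _ refl]) (auto simp: k'_def)
  next
    case equal
    have "((\<lambda>y. if y \<le> ?N then sin (pi * y) else (-1) ^ n) has_real_derivative 0) (at ?N)"
      by (rule has_real_derivative_glue) (use s[of ?N] in \<open>simp_all add: cos_odd_half sin_odd_half del: times_divide_eq_right\<close>)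
    moreover have "k' = 0"
      unfolding k'_def equal using cos_odd_half[of n] by (simp only: order_refl if_True mult_zero_right)
    ultimately show ?thesis unfolding k_def[abs_def] equal by simp
  next
    case greater
    then have "\<forall>\<^sub>F x in nhds y. k x = (-1) ^ n"
      using eventually_nhds_in_open[of "{?N<..}" y] by (auto simp: k_def elim!: eventually_mono)
    then show ?thesis using greater by (subst DERIV_cong_ev[OF refl _ refl]) (auto simp: k'_def)
  qed
  from DERIV_cmult[OF this, of "2 * \<gamma> / ((\<gamma>\<^sup>2 + 1) * pi)"] show ?thesis
    by (simp add: h_def[abs_def] h_slope_def k_def k'_def)
qed

context
  fixes n :: nat and \<gamma> :: real
  assumes g: "0 < \<gamma>" "\<gamma> < sqrt (3 / 5)"
begin

text \<open>The value 3/2 is attained at \<open>\<gamma>\<^sup>2 = 3/5\<close>; this is how the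
  upper bound on \<gamma> enters.\<close>

lemma amplitude_bound: "4 * \<gamma>\<^sup>2 / (\<gamma>\<^sup>2 + 1) \<le> 3 / 2"
proof -
  have "\<gamma>\<^sup>2 < (sqrt (3 / 5))\<^sup>2" using g by (intro power_strict_mono) auto
  moreover have "\<gamma>\<^sup>2 + 1 > 0" by (simp add: add_nonneg_pos)
  ultimately show ?thesis by (simp add: pos_divide_le_eq)
qed

lemma amplitude_pos: "2 * \<gamma> / ((\<gamma>\<^sup>2 + 1) * pi) > 0"
  using g by (intro divide_pos_pos mult_pos_pos add_nonneg_pos) auto

text \<open>Where the sine is negative, a shift by pi turns the left side into its form for a
  positive sine at the smaller argument t - pi, which only strengthens the bound.\<close>

lemma sin_transversal:
  fixes t :: real
  assumes "0 < t"
  shows "4 * \<gamma>\<^sup>2 / (\<gamma>\<^sup>2 + 1) * (\<bar>sin t\<bar> - sin t * cos t) < t"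
proof -
  have pos: "4 * \<gamma>\<^sup>2 / (\<gamma>\<^sup>2 + 1) * (sin u * (1 - cos u)) < u" if "0 < u" "sin u \<ge> 0" for u
  proof -
    have "4 * \<gamma>\<^sup>2 / (\<gamma>\<^sup>2 + 1) * (sin u * (1 - cos u)) \<le> 3 / 2 * (sin u * (1 - cos u))"
      using that by (intro mult_right_mono amplitude_bound) auto
    also have "\<dots> < u" by (rule sin_one_minus_cos_bound[OF that(1)])
    finally show ?thesis .
  qed
  show ?thesis
  proof (cases "sin t \<ge> 0")
    case True
    then show ?thesis using pos[OF assms True] by (simp add: algebra_simps)
  next
    case False
    have "t > pi" using sin_ge_zero[of t] assms False by force
    moreover have "sin (t - pi) = - sin t" "cos (t - pi) = - cos t" by (simp_all add: sin_diff cos_diff)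
    ultimately have "4 * \<gamma>\<^sup>2 / (\<gamma>\<^sup>2 + 1) * (- sin t * (1 + cos t)) < t - pi"
      using pos[of "t - pi"] False by simp
    then have "4 * \<gamma>\<^sup>2 / (\<gamma>\<^sup>2 + 1) * (- sin t * (1 + cos t)) < t" using pi_gt_zero by linarith
    moreover have "\<bar>sin t\<bar> - sin t * cos t = - sin t * (1 + cos t)" using False by (simp add: algebra_simps)
    ultimately show ?thesis by simp
  qed
qed

text \<open>On the sinusoidal part this is \<open>sin_transversal\<close> at t = pi y, divided by
  pi. Beyond n + 1/2 the slope vanishes and \<open>2 * \<gamma> * \<bar>h n \<gamma> y\<bar>\<close>
  is at most 3/(2 pi) < 1/2 < y.\<close>

lemma h_transversal:
  assumes y: "y > 0"
  shows "0 < y - 2 * \<gamma> * \<bar>h n \<gamma> y\<bar> + (\<gamma>\<^sup>2 + 1) * h n \<gamma> y * h_slope n \<gamma> y"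
proof (cases "y \<le> (2 * real n + 1) / 2")
  case True
  define A where "A = 2 * \<gamma> / ((\<gamma>\<^sup>2 + 1) * pi)"
  have A: "A > 0" unfolding A_def by (rule amplitude_pos)
  have c: "\<gamma>\<^sup>2 + 1 > 0" by (simp add: add_nonneg_pos)
  have Ac: "(\<gamma>\<^sup>2 + 1) * pi * A = 2 * \<gamma>" using c by (simp add: A_def)
  have gA: "2 * \<gamma> * A * pi = 4 * \<gamma>\<^sup>2 / (\<gamma>\<^sup>2 + 1)" using c by (simp add: A_def power2_eq_square)
  have h: "h n \<gamma> y = A * sin (pi * y)" "h_slope n \<gamma> y = A * (pi * cos (pi * y))"
    using True by (simp_all add: h_def h_slope_def A_def)
  have "(\<gamma>\<^sup>2 + 1) * h n \<gamma> y * h_slope n \<gamma> y = ((\<gamma>\<^sup>2 + 1) * pi * A) * A * (sin (pi * y) * cos (pi * y))"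
    unfolding h by (simp only: mult_ac)
  also have "\<dots> = 2 * \<gamma> * A * (sin (pi * y) * cos (pi * y))" unfolding Ac ..
  finally have e: "(\<gamma>\<^sup>2 + 1) * h n \<gamma> y * h_slope n \<gamma> y = 2 * \<gamma> * A * (sin (pi * y) * cos (pi * y))" .
  have a: "\<bar>h n \<gamma> y\<bar> = A * \<bar>sin (pi * y)\<bar>" using A unfolding h by (simp add: abs_mult)
  have "(2 * \<gamma> * A * pi) * (\<bar>sin (pi * y)\<bar> - sin (pi * y) * cos (pi * y)) < pi * y"
    unfolding gA using y by (intro sin_transversal) simp
  then have "pi * (2 * \<gamma> * A * (\<bar>sin (pi * y)\<bar> - sin (pi * y) * cos (pi * y))) < pi * y" by (simp only: mult_ac)
  then have "2 * \<gamma> * A * (\<bar>sin (pi * y)\<bar> - sin (pi * y) * cos (pi * y)) < y" by simp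
  then show ?thesis unfolding e a by (simp add: algebra_simps)
next
  case False
  have c: "\<gamma>\<^sup>2 + 1 > 0" by (simp add: add_nonneg_pos)
  have "2 * \<gamma> * \<bar>h n \<gamma> y\<bar> = 4 * \<gamma>\<^sup>2 / (\<gamma>\<^sup>2 + 1) / pi"
    using False g c by (simp add: h_def abs_mult power2_eq_square)
  also have "\<dots> \<le> (3 / 2) / pi" using amplitude_bound by (intro divide_right_mono) auto
  also have "\<dots> < 1 / 2" using pi_gt3 by (simp add: field_simps)
  also have "\<dots> < y" using False by simp
  finally show ?thesis using False by (simp add: h_slope_def)
qed

lemma h_linear: "y > 0 \<Longrightarrow> \<bar>h n \<gamma> y\<bar> \<le> 2 * \<gamma> / ((\<gamma>\<^sup>2 + 1) * pi) * pi * y"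
proof -
  assume y: "y > 0"
  define A where "A = 2 * \<gamma> / ((\<gamma>\<^sup>2 + 1) * pi)"
  have A: "A > 0" unfolding A_def by (rule amplitude_pos)
  have "\<bar>if y \<le> (2 * real n + 1) / 2 then sin (pi * y) else (-1) ^ n\<bar> \<le> pi * y"
  proof (cases "y \<le> (2 * real n + 1) / 2")
    case True
    then show ?thesis using abs_sin_le_one[of "pi * y"] abs_sin_x_le_abs_x[of "pi * y"] y by simp
  next
    case False
    then have "1 / 2 \<le> y" by simp
    then have "pi * (1 / 2) \<le> pi * y" by (intro mult_left_mono) auto
    then have "1 \<le> pi * y" using pi_ge_two by linarith
    then show ?thesis using False by simp
  qed
  then have "A * \<bar>if y \<le> (2 * real n + 1) / 2 then sin (pi * y) else (-1) ^ n\<bar> \<le> A * (pi * y)"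
    using A by (intro mult_left_mono) auto
  then show ?thesis using A by (simp add: h_def A_def[symmetric] abs_mult mult.assoc)
qed

lemma two_zone_h: "two_zone \<gamma> (h n \<gamma>) (h_slope n \<gamma>)"
  by unfold_locales (use g h_has_derivative h_transversal h_linear in \<open>auto intro!: exI[of _ "2 * \<gamma> / ((\<gamma>\<^sup>2 + 1) * pi) * pi"]\<close>)

lemma two_zone_minus_h: "two_zone \<gamma> (\<lambda>y. - h n \<gamma> y) (\<lambda>y. - h_slope n \<gamma> y)"
  by unfold_locales (use g h_transversal h_linear in \<open>auto intro!: h_has_derivative derivative_intros exI[of _ "2 * \<gamma> / ((\<gamma>\<^sup>2 + 1) * pi) * pi"]\<close>)

lemma h_integer: "k \<le> n \<Longrightarrow> h n \<gamma> (real k) = 0"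
  by (simp add: h_def)

lemma h_zero:
  assumes "y > 0" "h n \<gamma> y = 0"
  obtains k where "k \<in> {1..n}" "y = real k"
proof -
  have y: "y \<le> (2 * real n + 1) / 2" "sin (pi * y) = 0"
    using assms(2) amplitude_pos by (auto simp: h_def split: if_splits)
  then obtain i :: int where i: "pi * y = of_int i * pi" using sin_zero_iff_int2 by blast
  then have yi: "y = of_int i" by simp
  then have "i > 0" using assms(1) by simp
  moreover have "i \<le> int n"
  proof (rule ccontr)
    assume "\<not> i \<le> int n"
    then have "int n + 1 \<le> i" by simp
    then have "real_of_int (int n + 1) \<le> real_of_int i" by (simp only: of_int_le_iff)
    then show False using y(1) yi by simp
  qed
  ultimately show thesis using that[of "nat i"] yi by simp
qed

text \<open>One statement for all bands: k = 0 is the neighbourhood of the origin, and for k = n the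
  upper bound disappears because h keeps its sign after the sine ends. An even k gives attraction;
  for odd k the same holds with - h.\<close>

lemma h_sign:
  assumes k: "k \<le> n" and y: "y > 0" "real k - 1 < y" "k < n \<longrightarrow> y < real k + 1" "y \<noteq> real k"
  shows "(-1) ^ k * h n \<gamma> y * (y - real k) > 0"
proof -
  define A where "A = 2 * \<gamma> / ((\<gamma>\<^sup>2 + 1) * pi)"
  have A: "A > 0" unfolding A_def by (rule amplitude_pos)
  have sq: "(-1) ^ k * (-1) ^ k = (1 :: real)" by (simp add: power_mult_distrib[symmetric])
  define b where "b = (if y \<le> (2 * real n + 1) / 2 then sin (pi * y) else (-1) ^ n)"
  have "(-1) ^ k * b * (y - real k) > 0"
  proof (cases "y \<le> (2 * real n + 1) / 2")
    case True
    have less: "y < real k + 1" using y(3) True k by (cases "k < n") auto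
    have "sin (pi * y) = sin (pi * (y - real k) + pi * real k)" by (simp add: algebra_simps)
    also have "\<dots> = (-1) ^ k * sin (pi * (y - real k))" by (simp add: sin_add cos_npi2 sin_npi2)
    finally have eq: "(-1) ^ k * b * (y - real k) = ((-1) ^ k * (-1) ^ k) * (sin (pi * (y - real k)) * (y - real k))"
      using True by (simp add: b_def)
    have "sin (pi * (y - real k)) * (y - real k) > 0"
    proof (cases "y > real k")
      case True
      then show ?thesis using less by (intro mult_pos_pos sin_gt_zero) auto
    next
      case False
      have "sin (pi * (real k - y)) > 0" using y False by (intro sin_gt_zero) auto
      moreover have "sin (pi * (real k - y)) = - sin (pi * (y - real k))"
        by (metis minus_diff_eq mult_minus_right sin_minus)
      ultimately show ?thesis using False y by (intro mult_neg_neg) auto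
    qed
    then show ?thesis unfolding eq sq by simp
  next
    case False
    then have "k = n" using k y(3) by (cases "k < n") auto
    then show ?thesis using False sq by (simp add: b_def)
  qed
  then have "A * ((-1) ^ k * b * (y - real k)) > 0" using A by simp
  moreover have "h n \<gamma> y = A * b" by (simp add: h_def A_def b_def)
  ultimately show ?thesis by (simp add: mult_ac)
qed

end

section \<open>The given system as an instance of the abstract one, and the theorem\<close>

lemma F_eq_FF: "F n \<gamma> = FF \<gamma> (h n \<gamma>)" and H_eq_HH: "H n \<gamma> = HH (h n \<gamma>)"
proof -
  show H: "H n \<gamma> = HH (h n \<gamma>)" by (auto simp: H_def HH_def)
  have "G_minus \<gamma> *v X = fld \<gamma> (-1) X" "G_plus \<gamma> *v X = fld \<gamma> 1 X" for X
    by (simp_all add: G_minus_def G_plus_def fld_def vec_eq_iff forall_2 matrix_vector_mult_def UNIV_2)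
  then show "F n \<gamma> = FF \<gamma> (h n \<gamma>)" by (auto simp: F_def FF_def H)
qed

theorem corollary3:
  fixes n :: nat and \<gamma> :: real
  assumes "n \<ge> 1" and "0 < \<gamma>" and "\<gamma> < sqrt (3 / 5)"
  shows "\<exists>L :: nat \<Rightarrow> (real^2) set.
           bij_betw L {1..n} {\<Gamma>. limit_cycle (F n \<gamma>) (H n \<gamma>) \<Gamma>} \<and>
           (\<forall>j\<in>{1..n}. \<forall>k\<in>{1..n}. j < k \<longrightarrow> L j \<subseteq> inside (L k)) \<and>
           (\<forall>k\<in>{1..n}. 0 \<in> inside (L k)) \<and>
           stable_focus_origin (F n \<gamma>) (H n \<gamma>) \<and>
           (\<forall>k\<in>{1..n}. L k \<inter> {X. X $ 1 = 0} =
              {vector [0, real k], vector [0, - real k * exp (- pi * \<gamma>)]}) \<and>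
           (\<forall>k\<in>{1..n}. (even k \<longrightarrow> stable_orbit (F n \<gamma>) (H n \<gamma>) (L k)) \<and>
                       (odd k \<longrightarrow> unstable_orbit (F n \<gamma>) (H n \<gamma>) (L k)))"
proof -
  note g = assms(2,3)
  interpret T: two_zone \<gamma> "h n \<gamma>" "h_slope n \<gamma>" by (rule two_zone_h[OF g])
  interpret M: two_zone \<gamma> "\<lambda>y. - h n \<gamma> y" "\<lambda>y. - h_slope n \<gamma> y" by (rule two_zone_minus_h[OF g])
  define L where "L k = loop \<gamma> (real k)" for k :: nat
  have disj: "L j \<inter> L k = {}" if "j \<noteq> k" for j k using that by (auto simp: L_def loop_def)
  have axis: "L k \<inter> {X. X $ 1 = 0} = {vector [0, real k], vector [0, - real k * exp (- pi * \<gamma>)]}"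
    if "k \<in> {1..n}" for k unfolding L_def using that by (intro loop_axis) simp
  have ne: "L k \<noteq> {}" if "k \<in> {1..n}" for k using axis[OF that] by auto
  have per: "periodic_orbit (F n \<gamma>) (H n \<gamma>) (L k)" if "k \<in> {1..n}" for k
    unfolding F_eq_FF H_eq_HH L_def using that by (intro T.loop_periodic h_integer[OF g]) auto
  have only: "\<exists>k\<in>{1..n}. \<Gamma> = L k" if P: "periodic_orbit (F n \<gamma>) (H n \<gamma>) \<Gamma>" for \<Gamma>
  proof -
    obtain y where y: "y > 0" "h n \<gamma> y = 0" "\<Gamma> = loop \<gamma> y"
      by (rule T.periodic_is_loop[OF P[unfolded F_eq_FF H_eq_HH]])
    show ?thesis by (rule h_zero[OF g y(1,2)]) (use y(3) in \<open>auto simp: L_def\<close>)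
  qed
  \<comment> \<open>The other periodic orbits lie at integer values of \<open>NN\<close>, so an
    annulus reaching to k - 1 and k + 1, ends excluded, isolates the k-th one.\<close>
  have cyc: "limit_cycle (F n \<gamma>) (H n \<gamma>) (L k)" if k: "k \<in> {1..n}" for k
    unfolding limit_cycle_def
  proof (intro conjI per[OF k] exI[of _ "{X. real k - 1 < NN \<gamma> X} \<inter> {X. NN \<gamma> X < real k + 1}"] allI impI)
    show "open ({X. real k - 1 < NN \<gamma> X} \<inter> {X. NN \<gamma> X < real k + 1})"
      using open_NN_less[OF g(1)] by (intro open_Int)
    show "L k \<subseteq> {X. real k - 1 < NN \<gamma> X} \<inter> {X. NN \<gamma> X < real k + 1}" by (auto simp: L_def loop_def)
    fix \<Gamma> assume \<Gamma>: "periodic_orbit (F n \<gamma>) (H n \<gamma>) \<Gamma> \<and> \<Gamma> \<noteq> L k"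
    then obtain j where j: "\<Gamma> = L j" using only by blast
    then have "j \<noteq> k" using \<Gamma> by blast
    then have "\<not> (real k - 1 < real j \<and> real j < real k + 1)" by linarith
    then show "\<Gamma> \<inter> ({X. real k - 1 < NN \<gamma> X} \<inter> {X. NN \<gamma> X < real k + 1}) = {}"
      unfolding j by (auto simp: L_def loop_def)
  qed
  have "inj_on L {1..n}"
  proof (rule inj_onI, rule ccontr)
    fix j k assume "j \<in> {1..n}" "L j = L k" "j \<noteq> k"
    then show False using disj[of j k] ne[of j] by simp
  qed
  moreover have "L ` {1..n} = {\<Gamma>. limit_cycle (F n \<gamma>) (H n \<gamma>) \<Gamma>}"
  proof
    show "L ` {1..n} \<subseteq> {\<Gamma>. limit_cycle (F n \<gamma>) (H n \<gamma>) \<Gamma>}" using cyc by blast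
    show "{\<Gamma>. limit_cycle (F n \<gamma>) (H n \<gamma>) \<Gamma>} \<subseteq> L ` {1..n}"
    proof
      fix \<Gamma> assume "\<Gamma> \<in> {\<Gamma>. limit_cycle (F n \<gamma>) (H n \<gamma>) \<Gamma>}"
      then have "periodic_orbit (F n \<gamma>) (H n \<gamma>) \<Gamma>" by (simp add: limit_cycle_def)
      from only[OF this] show "\<Gamma> \<in> L ` {1..n}" by (rule bexE) (rule image_eqI)
    qed
  qed
  ultimately have bij: "bij_betw L {1..n} {\<Gamma>. limit_cycle (F n \<gamma>) (H n \<gamma>) \<Gamma>}"
    by (simp add: bij_betw_def)
  have ins: "inside (L k) = {X. NN \<gamma> X < real k}" if "k \<in> {1..n}" for k
    unfolding L_def using that by (intro inside_loop g) simp
  have focus: "stable_focus_origin (F n \<gamma>) (H n \<gamma>)"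
    unfolding F_eq_FF H_eq_HH
  proof (rule T.stable_focus)
    show "h n \<gamma> 1 = 0" using h_integer[OF g assms(1)] by simp
    show "h n \<gamma> y > 0" if "0 < y" "y < 1" for y
      using h_sign[OF g, of 0 n y] that by (simp add: zero_less_mult_iff)
  qed simp
  have lev: "h n \<gamma> (real k - 1) = 0 \<or> real k - 1 \<le> 0" "k < n \<longrightarrow> h n \<gamma> (real k + 1) = 0" "h n \<gamma> (real k) = 0"
    if k: "k \<in> {1..n}" for k
    using h_integer[OF g, of "k - 1" n] h_integer[OF g, of "k + 1" n] h_integer[OF g, of k n] k
    by (auto simp: of_nat_diff add.commute)
  have stab: "stable_orbit (F n \<gamma>) (H n \<gamma>) (L k)" if k: "k \<in> {1..n}" "even k" for k
    unfolding F_eq_FF H_eq_HH L_def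
  proof (rule T.stable_loop[where a = "real k - 1" and c = "k < n" and b = "real k + 1"])
    show "h n \<gamma> y * (y - real k) > 0" 
      if "y > 0" "y \<in> T.band (real k - 1) (k < n) (real k + 1)" "y \<noteq> real k" for y
      using h_sign[OF g, of k n y] that k by (simp add: T.band_def)
  qed (use k lev[OF k(1)] in \<open>auto simp: T.level_def T.band_def\<close>)
  \<comment> \<open>\<open>M\<close> is the system for - h. For odd k the factor
    \<open>(-1) ^ k\<close> in \<open>h_sign\<close> supplies this sign, so the cycle is stable for
    \<open>M\<close> and hence unstable here.\<close>
  have unstab: "unstable_orbit (F n \<gamma>) (H n \<gamma>) (L k)" if k: "k \<in> {1..n}" "odd k" for k
    unfolding F_eq_FF H_eq_HH L_def
  proof (rule unstable_orbit_mirror[OF _ mirror_loop],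
      rule M.stable_loop[where a = "real k - 1" and c = "k < n" and b = "real k + 1"])
    show "- h n \<gamma> y * (y - real k) > 0" 
      if "y > 0" "y \<in> M.band (real k - 1) (k < n) (real k + 1)" "y \<noteq> real k" for y
      using h_sign[OF g, of k n y] that k by (simp add: M.band_def)
  qed (use k lev[OF k(1)] in \<open>auto simp: M.level_def M.band_def\<close>)
  show ?thesis
  proof (intro exI[of _ L] conjI ballI impI)
    fix j k assume jk: "j \<in> {1..n}" "k \<in> {1..n}" "j < k"
    show "L j \<subseteq> inside (L k)" unfolding ins[OF jk(2)] using jk(3) by (auto simp: L_def loop_def)
  next
    fix k assume k: "k \<in> {1..n}"
    show "0 \<in> inside (L k)" unfolding ins[OF k] using k by simp
    show "L k \<inter> {X. X $ 1 = 0} = {vector [0, real k], vector [0, - real k * exp (- pi * \<gamma>)]}"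
      by (rule axis[OF k])
    show "stable_orbit (F n \<gamma>) (H n \<gamma>) (L k)" if "even k" by (rule stab[OF k that])
    show "unstable_orbit (F n \<gamma>) (H n \<gamma>) (L k)" if "odd k" by (rule unstab[OF k that])
  qed (rule bij focus)+
qed

end
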